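(* Let $k$ be a field and let $Q=(Q_0,Q_1)$ be a finite acyclic quiver. The simple modules of $\mathcal{B}_Q$ are, up to isomorphism, parametrized by the subsets $M$ of $Q_0$ via $M\mapsto E_M$; hence so are the vertices $[E_M]$ of the Gabriel quiver $\Gamma(\mathcal{B}_Q)$. Moreover there is at most one arrow from one vertex of $\Gamma(\mathcal{B}_Q)$ to another. More precisely, for subsets $M,N\subseteq Q_0$ there is an arrow $[E_M]\to[E_N]$ in $\Gamma(\mathcal{B}_Q)$ if and only if $M\setminus N$ and $N\setminus M$ are both non-empty and for each pair $(m,n)\in (M\setminus N)\times(N\setminus M)$ there is an arrow $m\to n$ in $Q$.
   Context: A finite acyclic quiver is a finite directed graph (finite vertex set $Q_0$, finite arrow set $Q_1$, multiple arrows allowed) without oriented cycles. $\mathcal{B}_Q$ is the associative unital $k$-algebra with generators $X_t$ ($t\in Q_0$) and relations: $X_s^2=X_s$ for all $s\in Q_0$; $X_sX_tX_s=X_tX_sX_t$ for all $s,t\in Q_0$; $X_tX_sX_t=X_sX_t$ for all $s,t\in Q_0$ such that there is no arrow from $t$ to $s$ in $Q$. For $M\subseteq Q_0$, $E_M$ is the one-dimensional left $\mathcal{B}_Q$-module $k$ on which $X_q$ acts as $1$ if $q\in M$ and as $0$ if $q\notin M$. The Gabriel quiver $\Gamma(\mathcal{B}_Q)$ has as vertices the isomorphism classes of simple (left) $\mathcal{B}_Q$-modules, and the number of arrows from $[E]$ to $[E']$ is $\dim_k\mathrm{Ext}^1_{\mathcal{B}_Q}(E,E')$. *)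

theory Defs
  imports
    "HOL-Algebra.QuotRing"
    "HOL-Library.Extended_Nat"
    "Jordan_Normal_Form.Missing_VectorSpace"
    "Graph_Theory.Arc_Walk"
begin

section \<open>Left modules over a ring\<close>

text \<open>The library locale \<open>module\<close> requires a commutative base ring. The locale below has the
  same axioms over an arbitrary unital ring; the fields \<open>mult\<close> and \<open>one\<close> of the module record play
  no role.\<close>

locale left_module = R?: ring R + M?: abelian_group M
  for R :: "('a, 'x) ring_scheme" (structure) and M :: "('a, 'm, 'y) module_scheme" (structure) +
  assumes smult_closed:
      "\<lbrakk>a \<in> carrier R; x \<in> carrier M\<rbrakk> \<Longrightarrow> a \<odot>\<^bsub>M\<^esub> x \<in> carrier M"
    and smult_l_distr:
      "\<lbrakk>a \<in> carrier R; b \<in> carrier R; x \<in> carrier M\<rbrakk> \<Longrightarrow>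
        (a \<oplus>\<^bsub>R\<^esub> b) \<odot>\<^bsub>M\<^esub> x = a \<odot>\<^bsub>M\<^esub> x \<oplus>\<^bsub>M\<^esub> b \<odot>\<^bsub>M\<^esub> x"
    and smult_r_distr:
      "\<lbrakk>a \<in> carrier R; x \<in> carrier M; y \<in> carrier M\<rbrakk> \<Longrightarrow>
        a \<odot>\<^bsub>M\<^esub> (x \<oplus>\<^bsub>M\<^esub> y) = a \<odot>\<^bsub>M\<^esub> x \<oplus>\<^bsub>M\<^esub> a \<odot>\<^bsub>M\<^esub> y"
    and smult_assoc1:
      "\<lbrakk>a \<in> carrier R; b \<in> carrier R; x \<in> carrier M\<rbrakk> \<Longrightarrow>
        (a \<otimes>\<^bsub>R\<^esub> b) \<odot>\<^bsub>M\<^esub> x = a \<odot>\<^bsub>M\<^esub> (b \<odot>\<^bsub>M\<^esub> x)"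
    and smult_one:
      "x \<in> carrier M \<Longrightarrow> \<one>\<^bsub>R\<^esub> \<odot>\<^bsub>M\<^esub> x = x"

text \<open>\<open>Module.submodule\<close> and \<open>LinearCombinations.module_hom\<close> do not presuppose commutativity.\<close>

definition simple_left_module ::
    "('a, 'x) ring_scheme \<Rightarrow> ('a, 'm, 'y) module_scheme \<Rightarrow> bool" where
  "simple_left_module R M \<longleftrightarrow>
     left_module R M \<and> carrier M \<noteq> {\<zero>\<^bsub>M\<^esub>} \<and>
     (\<forall>H. Module.submodule H R M \<longrightarrow> H = {\<zero>\<^bsub>M\<^esub>} \<or> H = carrier M)"

definition left_module_iso ::
    "('a, 'x) ring_scheme \<Rightarrow> ('a, 'm, 'y) module_scheme \<Rightarrow> ('a, 'n, 'z) module_scheme \<Rightarrow> bool" where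
  "left_module_iso R M N \<longleftrightarrow> (\<exists>f \<in> LinearCombinations.module_hom R M N. bij_betw f (carrier M) (carrier N))"

text \<open>The quotient by \<open>N\<close> with its induced scalar multiplication. It serves both for modules modulo
  a submodule (then \<open>mult\<close> and \<open>one\<close> are meaningless) and for algebras modulo a two-sided ideal, in
  which case its ring part is \<open>M Quot N\<close>.\<close>

definition quotient ::
    "('a, 'm, 'y) module_scheme \<Rightarrow> 'm set \<Rightarrow> ('a, 'm set) module" where
  "quotient M N =
     \<lparr>carrier = carrier (M Quot N), mult = mult (M Quot N), one = one (M Quot N),
      zero = zero (M Quot N), add = add (M Quot N),
      smult = (\<lambda>c X. \<Union>x\<in>X. N +>\<^bsub>M\<^esub> (c \<odot>\<^bsub>M\<^esub> x))\<rparr>"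


section \<open>The first extension group over an algebra\<close>

text \<open>A unital algebra over a field \<open>K\<close> is encoded as a module record \<open>A\<close>, whose ring part is the
  underlying ring and whose \<open>smult\<close> is the action of \<open>K\<close>. A left \<open>A\<close>-module \<open>N\<close> is a \<open>K\<close>-vector space
  via \<open>c \<mapsto> c \<odot> 1\<close>, and so is \<open>Hom_A(M, N)\<close> with pointwise operations. Homomorphisms are taken to be
  extensional, so that equality in \<open>hom_space\<close> is equality on the carrier of \<open>M\<close>.\<close>

definition hom_space ::
    "('k, 'a, 'x) module_scheme \<Rightarrow> ('a, 'm, 'y) module_scheme \<Rightarrow> ('a, 'n, 'z) module_scheme
      \<Rightarrow> ('k, 'm \<Rightarrow> 'n) module" where
  "hom_space A M N =
     \<lparr>carrier = LinearCombinations.module_hom A M N \<inter> extensional (carrier M),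
      mult = (\<lambda>f g. \<lambda>x\<in>carrier M. \<zero>\<^bsub>N\<^esub>),
      one = (\<lambda>x\<in>carrier M. \<zero>\<^bsub>N\<^esub>),
      zero = (\<lambda>x\<in>carrier M. \<zero>\<^bsub>N\<^esub>),
      add = (\<lambda>f g. \<lambda>x\<in>carrier M. f x \<oplus>\<^bsub>N\<^esub> g x),
      smult = (\<lambda>c f. \<lambda>x\<in>carrier M. (c \<odot>\<^bsub>A\<^esub> \<one>\<^bsub>A\<^esub>) \<odot>\<^bsub>N\<^esub> f x)\<rparr>"

text \<open>The free left module with basis \<open>S\<close>, as finitely supported functions.\<close>

definition free_left_module :: "('a, 'x) ring_scheme \<Rightarrow> 's set \<Rightarrow> ('a, 's \<Rightarrow> 'a) module" where
  "free_left_module R S =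
     \<lparr>carrier = {f. (\<forall>s. f s \<in> carrier R) \<and> (\<forall>s. s \<notin> S \<longrightarrow> f s = \<zero>\<^bsub>R\<^esub>) \<and> finite {s. f s \<noteq> \<zero>\<^bsub>R\<^esub>}},
      mult = (\<lambda>f g s. \<zero>\<^bsub>R\<^esub>),
      one = (\<lambda>s. \<zero>\<^bsub>R\<^esub>),
      zero = (\<lambda>s. \<zero>\<^bsub>R\<^esub>),
      add = (\<lambda>f g s. f s \<oplus>\<^bsub>R\<^esub> g s),
      smult = (\<lambda>a f s. a \<otimes>\<^bsub>R\<^esub> f s)\<rparr>"

text \<open>The canonical free presentation \<open>0 \<rightarrow> \<Omega>M \<rightarrow> F(M) \<rightarrow> M \<rightarrow> 0\<close>, where \<open>F(M)\<close> is free on the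
  elements of \<open>M\<close>.\<close>

definition free_cover :: "('a, 'x) ring_scheme \<Rightarrow> ('a, 'm, 'y) module_scheme \<Rightarrow> ('a, 'm \<Rightarrow> 'a) module" where
  "free_cover R M = free_left_module R (carrier M)"

definition cover_map :: "('a, 'x) ring_scheme \<Rightarrow> ('a, 'm, 'y) module_scheme \<Rightarrow> ('m \<Rightarrow> 'a) \<Rightarrow> 'm" where
  "cover_map R M f = (\<Oplus>\<^bsub>M\<^esub>s\<in>{s. f s \<noteq> \<zero>\<^bsub>R\<^esub>}. f s \<odot>\<^bsub>M\<^esub> s)"

definition syzygy :: "('a, 'x) ring_scheme \<Rightarrow> ('a, 'm, 'y) module_scheme \<Rightarrow> ('a, 'm \<Rightarrow> 'a) module" where
  "syzygy R M =
     (free_cover R M)\<lparr>carrier := {f \<in> carrier (free_cover R M). cover_map R M f = \<zero>\<^bsub>M\<^esub>}\<rparr>"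

text \<open>\<open>Ext\<^sup>1(M, N)\<close> is the cokernel of the restriction map \<open>Hom(F(M), N) \<rightarrow> Hom(\<Omega>M, N)\<close>, i.e. the first
  right derived functor of \<open>Hom(-, N)\<close> computed with the canonical free presentation.\<close>

definition ext1 ::
    "('k, 'a, 'x) module_scheme \<Rightarrow> ('a, 'm, 'y) module_scheme \<Rightarrow> ('a, 'n, 'z) module_scheme
      \<Rightarrow> ('k, (('m \<Rightarrow> 'a) \<Rightarrow> 'n) set) module" where
  "ext1 A M N =
     quotient (hom_space A (syzygy A M) N)
       ((\<lambda>f. restrict f (carrier (syzygy A M))) ` carrier (hom_space A (free_cover A M) N))"

text \<open>\<open>vectorspace.dim\<close> is only meaningful for finite-dimensional spaces.\<close>

definition vs_dim :: "('k, 'x) ring_scheme \<Rightarrow> ('k, 'v, 'y) module_scheme \<Rightarrow> enat" where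
  "vs_dim K V = (if vectorspace.fin_dim K V then enat (vectorspace.dim K V) else \<infinity>)"


section \<open>The Gabriel quiver of an algebra\<close>

text \<open>Isomorphism classes are formed inside the type of modules whose elements are sets of elements
  of \<open>A\<close>. This loses nothing: a simple left \<open>A\<close>-module is isomorphic to \<open>A/L\<close> for a maximal left ideal
  \<open>L\<close>, and the elements of \<open>A/L\<close> are cosets. The module \<open>S\<close> whose class is taken may live on any type.\<close>

definition iso_class ::
    "('a, 'x) ring_scheme \<Rightarrow> ('a, 'm, 'y) module_scheme \<Rightarrow> ('a, 'a set) module set" where
  "iso_class A S = {T. simple_left_module A T \<and> left_module_iso A T S}"

definition simple_classes :: "('a, 'x) ring_scheme \<Rightarrow> ('a, 'a set) module set set" where
  "simple_classes A = {iso_class A S | S :: ('a, 'a set) module. simple_left_module A S}"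

text \<open>There are \<open>dim Ext\<^sup>1(E, E')\<close> arrows from \<open>[E]\<close> to \<open>[E']\<close>, labelled by the natural numbers below
  that dimension (all of them, if it is infinite); the dimension does not depend on the chosen
  representatives \<open>E\<close>, \<open>E'\<close>.\<close>

definition gabriel_quiver ::
    "('k, 'w) ring_scheme \<Rightarrow> ('k, 'a, 'x) module_scheme \<Rightarrow>
      (('a, 'a set) module set, ('a, 'a set) module set \<times> ('a, 'a set) module set \<times> nat) pre_digraph"
where
  "gabriel_quiver K A =
     \<lparr>verts = simple_classes A,
      arcs = {(C, D, i). C \<in> simple_classes A \<and> D \<in> simple_classes A \<and>
                enat i < vs_dim K (ext1 A (SOME E. E \<in> C) (SOME E'. E' \<in> D))},
      tail = (\<lambda>(C, D, i). C),
      head = (\<lambda>(C, D, i). D)\<rparr>"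


section \<open>The algebra of a quiver\<close>

definition acyclic_quiver :: "('v, 'e) pre_digraph \<Rightarrow> bool" where
  "acyclic_quiver Q \<longleftrightarrow> (\<nexists>p. pre_digraph.cycle Q p)"

text \<open>The free unital associative algebra on the set \<open>V\<close>: finitely supported functions on words over
  \<open>V\<close>, multiplied by convolution with respect to concatenation.\<close>

definition free_algebra :: "('k, 'w) ring_scheme \<Rightarrow> 'v set \<Rightarrow> ('k, 'v list \<Rightarrow> 'k) module" where
  "free_algebra K V =
     \<lparr>carrier = {f. (\<forall>w. f w \<in> carrier K) \<and> (\<forall>w. w \<notin> lists V \<longrightarrow> f w = \<zero>\<^bsub>K\<^esub>) \<and> finite {w. f w \<noteq> \<zero>\<^bsub>K\<^esub>}},
      mult = (\<lambda>f g w. \<Oplus>\<^bsub>K\<^esub>i\<in>{..length w}. f (take i w) \<otimes>\<^bsub>K\<^esub> g (drop i w)),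
      one = (\<lambda>w. if w = [] then \<one>\<^bsub>K\<^esub> else \<zero>\<^bsub>K\<^esub>),
      zero = (\<lambda>w. \<zero>\<^bsub>K\<^esub>),
      add = (\<lambda>f g w. f w \<oplus>\<^bsub>K\<^esub> g w),
      smult = (\<lambda>c f w. c \<otimes>\<^bsub>K\<^esub> f w)\<rparr>"

definition free_gen :: "('k, 'w) ring_scheme \<Rightarrow> 'v \<Rightarrow> 'v list \<Rightarrow> 'k" where
  "free_gen K t = (\<lambda>w. if w = [t] then \<one>\<^bsub>K\<^esub> else \<zero>\<^bsub>K\<^esub>)"

text \<open>A relation \<open>a = b\<close> is represented by the element \<open>a - b\<close> of the free algebra.\<close>

definition quiver_relations :: "('k, 'w) ring_scheme \<Rightarrow> ('v, 'e) pre_digraph \<Rightarrow> ('v list \<Rightarrow> 'k) set" where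
  "quiver_relations K Q =
     (let F = free_algebra K (verts Q); X = free_gen K in
        {X s \<otimes>\<^bsub>F\<^esub> X s \<ominus>\<^bsub>F\<^esub> X s | s. s \<in> verts Q} \<union>
        {X s \<otimes>\<^bsub>F\<^esub> X t \<otimes>\<^bsub>F\<^esub> X s \<ominus>\<^bsub>F\<^esub> X t \<otimes>\<^bsub>F\<^esub> X s \<otimes>\<^bsub>F\<^esub> X t | s t. s \<in> verts Q \<and> t \<in> verts Q} \<union>
        {X t \<otimes>\<^bsub>F\<^esub> X s \<otimes>\<^bsub>F\<^esub> X t \<ominus>\<^bsub>F\<^esub> X s \<otimes>\<^bsub>F\<^esub> X t | s t.
           s \<in> verts Q \<and> t \<in> verts Q \<and> (t, s) \<notin> arcs_ends Q})"

definition quiver_algebra ::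
    "('k, 'w) ring_scheme \<Rightarrow> ('v, 'e) pre_digraph \<Rightarrow> ('k, ('v list \<Rightarrow> 'k) set) module" where
  "quiver_algebra K Q =
     quotient (free_algebra K (verts Q)) (Idl\<^bsub>free_algebra K (verts Q)\<^esub> (quiver_relations K Q))"

text \<open>The algebra homomorphism from the free algebra to \<open>K\<close> that sends the generator \<open>X_q\<close> to \<open>1\<close> if
  \<open>q \<in> M\<close> and to \<open>0\<close> otherwise.\<close>

definition free_character :: "('k, 'w) ring_scheme \<Rightarrow> 'v set \<Rightarrow> ('v list \<Rightarrow> 'k) \<Rightarrow> 'k" where
  "free_character K M f =
     (\<Oplus>\<^bsub>K\<^esub>w\<in>{w. f w \<noteq> \<zero>\<^bsub>K\<^esub>}.
        f w \<otimes>\<^bsub>K\<^esub> foldr (\<lambda>q c. (if q \<in> M then \<one>\<^bsub>K\<^esub> else \<zero>\<^bsub>K\<^esub>) \<otimes>\<^bsub>K\<^esub> c) w \<one>\<^bsub>K\<^esub>)"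

text \<open>An element \<open>b\<close> of the quotient algebra is a coset on which \<open>free_character\<close> is constant; it acts
  on the one-dimensional space \<open>K\<close> through that constant value.\<close>

definition E_module :: "('k, 'w) ring_scheme \<Rightarrow> 'v set \<Rightarrow> (('v list \<Rightarrow> 'k) set, 'k) module" where
  "E_module K M =
     \<lparr>carrier = carrier K, mult = mult K, one = one K, zero = zero K, add = add K,
      smult = (\<lambda>b x. the_elem (free_character K M ` b) \<otimes>\<^bsub>K\<^esub> x)\<rparr>"

end

theory Submission
  imports Defs
begin

text \<open>If \<open>S\<close> is simple and \<open>q\<close> is a sink, then \<open>X_q X_s X_q = X_s X_q\<close> for all \<open>s\<close> makes \<open>X_q S\<close> a
  submodule, so \<open>X_q\<close> acts on \<open>S\<close> as \<open>0\<close> or \<open>1\<close>. Going up along the arrows, all generators act as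
  \<open>0\<close> or \<open>1\<close>, so \<open>S\<close> is one of the modules \<open>E_M\<close>.

  A homomorphism from the syzygy of \<open>E_M\<close> to \<open>E_N\<close> amounts, modulo those that extend to the free
  cover, to a derivation \<open>d\<close> of the algebra with values in \<open>Hom(E_M, E_N)\<close> modulo inner ones. The
  relations force \<open>d(X_t)\<close> to be a constant \<open>a\<close> on \<open>M - N\<close>, a constant \<open>b\<close> on \<open>N - M\<close> and \<open>0\<close>
  elsewhere, with \<open>a + b = 0\<close> as soon as some arrow from \<open>M - N\<close> to \<open>N - M\<close> is missing. The inner
  derivations are those with \<open>a + b = 0\<close> (if one of the two sets is empty, all of them are inner).
  Hence \<open>a + b\<close> embeds \<open>Ext\<^sup>1(E_M, E_N)\<close> into the ground field, and its image is nonzero exactly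
  in the stated case.\<close>

section \<open>Free algebras\<close>


text \<open>For the characters \<open>\<chi>\<close> of \<open>E_M\<close> and \<open>\<psi>\<close>
  of \<open>E_N\<close>, a derivation satisfies
  \<open>d (a b) = \<psi> a * d b + d a * \<chi> b\<close>. Characters take the values 0 and 1 on
  generators, so each relation becomes a linear equation between at most two values of
  \<open>d\<close>. The equation \<open>d X_s + d X_t = 0\<close> stems from
  \<open>X_t X_s X_t = X_s X_t\<close> with \<open>t\<close> in \<open>M - N\<close> and
  \<open>s\<close> in \<open>N - M\<close>: the left corner vanishes, the right one is the sum. An
  arrow from \<open>t\<close> to \<open>s\<close> removes this relation, which is how arrows enter.
  Inner derivations are \<open>c * (\<psi> - \<chi>)\<close>, with values \<open>- c\<close> on
  \<open>M - N\<close> and \<open>c\<close> on \<open>N - M\<close>; if one set is empty,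
  \<open>c\<close> can match the only remaining value.

  The free cover has every element of the module in its basis. Over the field it splits as the
  syzygy plus the line of one basis vector \<open>e\<close> over a generator;
  \<open>b \<mapsto> f ((b - \<chi> b) e)\<close> is the derivation of \<open>f\<close>, and
  extending \<open>f\<close> means choosing an image of \<open>e\<close>.

  The Gabriel quiver evaluates Ext at chosen representatives, which live on another type than
  \<open>E_M\<close>; hence the computation treats arbitrary modules isomorphic to
  \<open>E_M\<close> and \<open>E_N\<close>.\<close>

definition monomial :: "('k, 'w) ring_scheme \<Rightarrow> 'k \<Rightarrow> 'v list \<Rightarrow> 'v list \<Rightarrow> 'k" where
  "monomial K c w = (\<lambda>u. if u = w then c else \<zero>\<^bsub>K\<^esub>)"

text \<open>The product of \<open>free_algebra\<close>, detached from its carrier. The identities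
  for it ask only for values in the ring, so shifted functions such as
  \<open>\<lambda>u. f (q # u)\<close> can be inserted without a look at supports.\<close>

definition convolution :: "('k, 'w) ring_scheme \<Rightarrow> ('v list \<Rightarrow> 'k) \<Rightarrow> ('v list \<Rightarrow> 'k) \<Rightarrow> 'v list \<Rightarrow> 'k" where
  "convolution K f g w = (\<Oplus>\<^bsub>K\<^esub>i\<in>{..length w}. f (take i w) \<otimes>\<^bsub>K\<^esub> g (drop i w))"

context ring
begin

lemma convolution_Nil:
  assumes "f \<in> UNIV \<rightarrow> carrier R" "g \<in> UNIV \<rightarrow> carrier R"
  shows "convolution R f g [] = f [] \<otimes> g []"
  using assms by (simp add: convolution_def Pi_iff)

lemma convolution_closed:
  assumes "f \<in> UNIV \<rightarrow> carrier R" "g \<in> UNIV \<rightarrow> carrier R"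
  shows "convolution R f g w \<in> carrier R"
  using assms unfolding convolution_def by (auto intro!: finsum_closed)

text \<open>Separates the cut in front of \<open>q\<close> from the cuts behind it. This gives a
  recursion on words, in which the left factor is shifted.\<close>

lemma convolution_Cons:
  assumes "f \<in> UNIV \<rightarrow> carrier R" "g \<in> UNIV \<rightarrow> carrier R"
  shows "convolution R f g (q # w) = f [] \<otimes> g (q # w) \<oplus> convolution R (\<lambda>u. f (q # u)) g w"
proof -
  have "convolution R f g (q # w) =
      (\<Oplus>i\<in>{..Suc (length w)}. f (take i (q # w)) \<otimes> g (drop i (q # w)))"
    by (simp add: convolution_def)
  also have "\<dots> = (\<Oplus>i\<in>{..length w}. f (take (Suc i) (q # w)) \<otimes> g (drop (Suc i) (q # w)))
      \<oplus> f (take 0 (q # w)) \<otimes> g (drop 0 (q # w))"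
    using assms by (subst finsum_Suc2) auto
  finally show ?thesis
    using assms convolution_closed[of "\<lambda>u. f (q # u)" g w]
    by (auto simp: convolution_def Pi_iff intro!: a_comm)
qed

lemma convolution_add_left:
  assumes "f \<in> UNIV \<rightarrow> carrier R" "f' \<in> UNIV \<rightarrow> carrier R" "g \<in> UNIV \<rightarrow> carrier R"
  shows "convolution R (\<lambda>u. f u \<oplus> f' u) g w = convolution R f g w \<oplus> convolution R f' g w"
  using assms unfolding convolution_def
  by (subst finsum_addf[symmetric]) (auto simp: Pi_iff l_distr intro!: finsum_cong')

lemma convolution_add_right:
  assumes "f \<in> UNIV \<rightarrow> carrier R" "g \<in> UNIV \<rightarrow> carrier R" "g' \<in> UNIV \<rightarrow> carrier R"
  shows "convolution R f (\<lambda>u. g u \<oplus> g' u) w = convolution R f g w \<oplus> convolution R f g' w"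
  using assms unfolding convolution_def
  by (subst finsum_addf[symmetric]) (auto simp: Pi_iff r_distr intro!: finsum_cong')

lemma convolution_smult_left:
  assumes "c \<in> carrier R" "f \<in> UNIV \<rightarrow> carrier R" "g \<in> UNIV \<rightarrow> carrier R"
  shows "convolution R (\<lambda>u. c \<otimes> f u) g w = c \<otimes> convolution R f g w"
  using assms unfolding convolution_def
  by (subst finsum_rdistr) (auto simp: Pi_iff m_assoc intro!: finsum_cong')

text \<open>Induction on the word. The recursion replaces \<open>f\<close> by its shift
  \<open>?f\<close>, so the induction hypothesis has to be available for other left factors.\<close>

lemma convolution_assoc:
  assumes "f \<in> UNIV \<rightarrow> carrier R" "g \<in> UNIV \<rightarrow> carrier R" "h \<in> UNIV \<rightarrow> carrier R"
  shows "convolution R (convolution R f g) h w = convolution R f (convolution R g h) w"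
  using assms
proof (induction w arbitrary: f g)
  case Nil
  then show ?case
    by (simp add: convolution_Nil convolution_closed Pi_iff m_assoc)
next
  case (Cons q w)
  let ?f = "\<lambda>u. f (q # u)" and ?g = "\<lambda>u. g (q # u)"
  have cl: "convolution R f g \<in> UNIV \<rightarrow> carrier R" "convolution R g h \<in> UNIV \<rightarrow> carrier R"
      "convolution R ?f g \<in> UNIV \<rightarrow> carrier R" "?f \<in> UNIV \<rightarrow> carrier R" "?g \<in> UNIV \<rightarrow> carrier R"
    using Cons.prems by (auto intro!: convolution_closed)
  have "convolution R (convolution R f g) h (q # w) =
      f [] \<otimes> g [] \<otimes> h (q # w) \<oplus> convolution R (\<lambda>u. f [] \<otimes> ?g u \<oplus> convolution R ?f g u) h w"
    using Cons.prems cl by (simp add: convolution_Cons convolution_Nil)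
  also have "convolution R (\<lambda>u. f [] \<otimes> ?g u \<oplus> convolution R ?f g u) h w =
      f [] \<otimes> convolution R ?g h w \<oplus> convolution R ?f (convolution R g h) w"
    using Cons.prems cl Cons.IH[OF cl(4) Cons.prems(2,3)]
    by (subst convolution_add_left) (auto simp: Pi_iff convolution_smult_left)
  also have "f [] \<otimes> g [] \<otimes> h (q # w) \<oplus> (f [] \<otimes> convolution R ?g h w \<oplus> convolution R ?f (convolution R g h) w) =
      convolution R f (convolution R g h) (q # w)"
  proof -
    have "f [] \<in> carrier R" "g [] \<in> carrier R" "h (q # w) \<in> carrier R" 
      "convolution R ?g h w \<in> carrier R" "convolution R ?f (convolution R g h) w \<in> carrier R"
      using Cons.prems cl by (auto intro!: convolution_closed)
    then show ?thesis
      using Cons.prems cl by (simp add: convolution_Cons r_distr m_assoc a_assoc)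
  qed
  finally show ?case .
qed

lemma convolution_monomial:
  assumes "c \<in> carrier R" "d \<in> carrier R"
  shows "convolution R (monomial R c u) (monomial R d v) = monomial R (c \<otimes> d) (u @ v)"
proof
  fix w
  show "convolution R (monomial R c u) (monomial R d v) w = monomial R (c \<otimes> d) (u @ v) w"
  proof (cases "w = u @ v")
    case True
    have "convolution R (monomial R c u) (monomial R d v) w =
        (\<Oplus>i\<in>{..length w}. if i = length u then c \<otimes> d else \<zero>)"
      unfolding convolution_def using assms True
      by (intro finsum_cong') (auto simp: monomial_def dest: arg_cong[of _ u length])
    also have "\<dots> = c \<otimes> d"
      using assms True finsum_singleton[of "length u" "{..length w}" "\<lambda>_. c \<otimes> d"] 
      by (simp add: eq_commute[of _ "length u"])
    finally show ?thesis using True by (simp add: monomial_def)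
  next
    case False
    have "convolution R (monomial R c u) (monomial R d v) w = (\<Oplus>i\<in>{..length w}. \<zero>)"
      unfolding convolution_def using assms False
      by (intro finsum_cong') (auto simp: monomial_def append_take_drop_id)
    then show ?thesis using False by (simp add: monomial_def)
  qed
qed

lemma convolution_one_left:
  assumes "g \<in> UNIV \<rightarrow> carrier R"
  shows "convolution R (monomial R \<one> []) g w = g w"
proof (cases w)
  case Nil
  then show ?thesis using assms by (subst Nil, subst convolution_Nil) (auto simp: monomial_def Pi_iff)
next
  case (Cons q w')
  have "convolution R (\<lambda>u. \<zero>) g w' = \<zero>"
    using assms by (auto simp: convolution_def Pi_iff intro!: add.finprod_one_eqI)
  then show ?thesis using assms Cons by (subst Cons, subst convolution_Cons) (auto simp: monomial_def Pi_iff)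
qed

lemma convolution_one_right:
  assumes "f \<in> UNIV \<rightarrow> carrier R"
  shows "convolution R f (monomial R \<one> []) w = f w"
  using assms
proof (induction w arbitrary: f)
  case Nil
  then show ?case by (subst convolution_Nil) (auto simp: monomial_def Pi_iff)
next
  case (Cons q w)
  then show ?case using Cons.IH[of "\<lambda>u. f (q # u)"]
    by (subst convolution_Cons) (auto simp: monomial_def Pi_iff)
qed

lemma free_algebra_simps:
  "add (free_algebra R V) f g = (\<lambda>w. f w \<oplus> g w)"
  "zero (free_algebra R V) = (\<lambda>w. \<zero>)"
  "one (free_algebra R V) = monomial R \<one> []"
  "mult (free_algebra R V) f g = convolution R f g"
  "smult (free_algebra R V) c f = (\<lambda>w. c \<otimes> f w)"
  "f \<in> carrier (free_algebra R V) \<longleftrightarrow>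
     f \<in> UNIV \<rightarrow> carrier R \<and> (\<forall>w. w \<notin> lists V \<longrightarrow> f w = \<zero>) \<and> finite {w. f w \<noteq> \<zero>}"
  by (auto simp: free_algebra_def monomial_def fun_eq_iff convolution_def)

lemma monomial_closed:
  "c \<in> carrier R \<Longrightarrow> w \<in> lists V \<Longrightarrow> monomial R c w \<in> carrier (free_algebra R V)"
  by (auto simp: free_algebra_simps monomial_def)

lemma free_algebra_abelian_group: "abelian_group (free_algebra R V)"
proof (rule abelian_groupI; (unfold free_algebra_simps)?)
  fix f g h
  let ?C = "\<lambda>f. f \<in> UNIV \<rightarrow> carrier R \<and> (\<forall>w. w \<notin> lists V \<longrightarrow> f w = \<zero>) \<and> finite {w. f w \<noteq> \<zero>}"
  assume f: "?C f" 
  show "\<exists>g\<in>carrier (free_algebra R V). (\<lambda>w. g w \<oplus> f w) = (\<lambda>w. \<zero>)"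
  proof (rule bexI[where x = "\<lambda>w. \<ominus> f w"])
    show "(\<lambda>w. \<ominus> f w) \<in> carrier (free_algebra R V)"
      using f by (auto simp: free_algebra_simps Pi_iff elim!: rev_finite_subset)
  qed (use f in \<open>auto simp: Pi_iff l_neg\<close>)
  show "(\<lambda>w. \<zero> \<oplus> f w) = f" using f by (auto simp: Pi_iff)
  assume g: "?C g"
  show "?C (\<lambda>w. f w \<oplus> g w)"
    using f g by (auto simp: Pi_iff intro: finite_subset[of _ "{w. f w \<noteq> \<zero>} \<union> {w. g w \<noteq> \<zero>}"])
  show "(\<lambda>w. f w \<oplus> g w) = (\<lambda>w. g w \<oplus> f w)" using f g a_comm by (auto simp: Pi_iff)
  assume h: "?C h"
  show "(\<lambda>w. f w \<oplus> g w \<oplus> h w) = (\<lambda>w. f w \<oplus> (g w \<oplus> h w))"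
    using f g h by (auto simp: Pi_iff a_assoc)
qed (auto simp: Pi_iff)

text \<open>A nonzero value at \<open>w\<close> requires a factorization \<open>w = u @ v\<close>
  with \<open>u\<close> and \<open>v\<close> in the two supports. There are finitely many such
  words, and all their letters lie in \<open>V\<close>.\<close>

lemma convolution_finite_support:
  assumes f: "f \<in> carrier (free_algebra R V)" and g: "g \<in> carrier (free_algebra R V)"
  shows "convolution R f g \<in> carrier (free_algebra R V)"
proof -
  have supp: "\<exists>u v. w = u @ v \<and> f u \<noteq> \<zero> \<and> g v \<noteq> \<zero>" if "convolution R f g w \<noteq> \<zero>" for w
  proof (rule ccontr)
    assume "\<nexists>u v. w = u @ v \<and> f u \<noteq> \<zero> \<and> g v \<noteq> \<zero>"
    then have "f (take i w) = \<zero> \<or> g (drop i w) = \<zero>" for i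
      by (metis append_take_drop_id)
    then have "f (take i w) \<otimes> g (drop i w) = \<zero>" for i
      using f g by (metis (no_types, lifting) PiE UNIV_I free_algebra_simps(6) l_null r_null)
    then have "convolution R f g w = \<zero>" by (simp add: convolution_def)
    with that show False by simp
  qed
  have "{w. convolution R f g w \<noteq> \<zero>} \<subseteq> (\<lambda>(u, v). u @ v) ` ({w. f w \<noteq> \<zero>} \<times> {w. g w \<noteq> \<zero>})"
    by (auto dest!: supp)
  moreover have "finite ({w. f w \<noteq> \<zero>} \<times> {w. g w \<noteq> \<zero>})"
    using f g by (auto simp: free_algebra_simps)
  ultimately have fin: "finite {w. convolution R f g w \<noteq> \<zero>}"
    by (meson finite_imageI finite_subset)
  have "convolution R f g w = \<zero>" if "w \<notin> lists V" for w
  proof (rule ccontr)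
    assume "convolution R f g w \<noteq> \<zero>"
    then obtain u v where "w = u @ v" "f u \<noteq> \<zero>" "g v \<noteq> \<zero>" using supp by blast
    then have "u \<in> lists V" "v \<in> lists V" using f g unfolding free_algebra_simps by blast+
    then show False using that \<open>w = u @ v\<close> by simp
  qed
  then show ?thesis using fin f g by (auto simp: free_algebra_simps intro!: convolution_closed)
qed

lemma free_algebra_ring: "ring (free_algebra R V)"
proof (rule ringI)
  show "abelian_group (free_algebra R V)" by (rule free_algebra_abelian_group)
  show "Group.monoid (free_algebra R V)"
  proof (rule monoidI)
    show "\<one>\<^bsub>free_algebra R V\<^esub> \<in> carrier (free_algebra R V)"
      by (simp add: free_algebra_simps(3) monomial_closed)
    fix f g h assume f: "f \<in> carrier (free_algebra R V)"
    then have f': "f \<in> UNIV \<rightarrow> carrier R" by (simp add: free_algebra_simps)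
    show "\<one>\<^bsub>free_algebra R V\<^esub> \<otimes>\<^bsub>free_algebra R V\<^esub> f = f"
      "f \<otimes>\<^bsub>free_algebra R V\<^esub> \<one>\<^bsub>free_algebra R V\<^esub> = f"
      by (auto simp: free_algebra_simps(3,4) fun_eq_iff convolution_one_left[OF f'] convolution_one_right[OF f'])
    assume g: "g \<in> carrier (free_algebra R V)"
    then show "f \<otimes>\<^bsub>free_algebra R V\<^esub> g \<in> carrier (free_algebra R V)"
      using f by (simp add: free_algebra_simps(4) convolution_finite_support)
    assume h: "h \<in> carrier (free_algebra R V)"
    show "f \<otimes>\<^bsub>free_algebra R V\<^esub> g \<otimes>\<^bsub>free_algebra R V\<^esub> h =
          f \<otimes>\<^bsub>free_algebra R V\<^esub> (g \<otimes>\<^bsub>free_algebra R V\<^esub> h)"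
      using f g h by (auto simp: free_algebra_simps fun_eq_iff convolution_assoc)
  qed
qed (auto simp: free_algebra_simps fun_eq_iff convolution_add_left convolution_add_right)

text \<open>Reduces additive statements to monomials. The induction runs over the support and erases
  one word at a time.\<close>

lemma free_algebra_additive_induct [consumes 1, case_names zero monomial add]:
  assumes f: "f \<in> carrier (free_algebra R V)"
    and zero: "P \<zero>\<^bsub>free_algebra R V\<^esub>"
    and monomial: "\<And>c w. c \<in> carrier R \<Longrightarrow> w \<in> lists V \<Longrightarrow> P (monomial R c w)"
    and add: "\<And>f g. f \<in> carrier (free_algebra R V) \<Longrightarrow> g \<in> carrier (free_algebra R V) \<Longrightarrow>
      P f \<Longrightarrow> P g \<Longrightarrow> P (f \<oplus>\<^bsub>free_algebra R V\<^esub> g)"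
  shows "P f"
proof -
  have "finite A \<Longrightarrow> f \<in> carrier (free_algebra R V) \<Longrightarrow> {w. f w \<noteq> \<zero>} = A \<Longrightarrow> P f" for A
  proof (induction A arbitrary: f rule: finite_induct)
    case empty
    then have "f = \<zero>\<^bsub>free_algebra R V\<^esub>" by (auto simp: free_algebra_simps)
    then show ?case using zero by simp
  next
    case (insert a A)
    let ?g = "f(a := \<zero>)"
    have f: "f \<in> UNIV \<rightarrow> carrier R" using insert.prems by (simp add: free_algebra_simps)
    have a: "a \<in> lists V" "f a \<in> carrier R"
      using insert.prems f by (auto simp: free_algebra_simps(6))
    have g: "?g \<in> carrier (free_algebra R V)" 
      using insert.prems unfolding free_algebra_simps by (auto intro: finite_subset[of _ "{w. f w \<noteq> \<zero>}"])
    have "{w. ?g w \<noteq> \<zero>} = A" using insert by auto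
    then have "P ?g" by (rule insert.IH[OF g])
    then have "P (monomial R (f a) a \<oplus>\<^bsub>free_algebra R V\<^esub> ?g)"
      using a g by (intro add monomial monomial_closed)
    also have "monomial R (f a) a \<oplus>\<^bsub>free_algebra R V\<^esub> ?g = f"
      using f a by (auto simp: free_algebra_simps monomial_def fun_eq_iff Pi_iff)
    finally show ?case .
  qed
  from this[OF _ f refl] f show ?thesis by (simp add: free_algebra_simps)
qed

end


text \<open>The zero \<open>z\<close> of the coefficients is a parameter because it may differ from
  the zero of the target. The index set consists of words for functionals on the free algebra and of
  module elements for functionals on the free cover.\<close>

definition support_sum ::
    "('n, 'y) ring_scheme \<Rightarrow> 'a \<Rightarrow> ('s \<Rightarrow> 'a \<Rightarrow> 'n) \<Rightarrow> ('s \<Rightarrow> 'a) \<Rightarrow> 'n" where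
  "support_sum N z \<theta> f = (\<Oplus>\<^bsub>N\<^esub>s\<in>{s. f s \<noteq> z}. \<theta> s (f s))"

context abelian_monoid
begin

text \<open>Allows sums over different supports to be compared on a common finite set.\<close>

lemma support_sum_superset:
  assumes "finite A" "{s. f s \<noteq> z} \<subseteq> A" "\<And>s. \<theta> s z = \<zero>" "\<And>s. \<theta> s (f s) \<in> carrier G"
  shows "support_sum G z \<theta> f = (\<Oplus>s\<in>A. \<theta> s (f s))"
  unfolding support_sum_def
  by (rule add.finprod_mono_neutral_cong_left) (use assms in auto)

lemma support_sum_closed:
  assumes "\<And>s. \<theta> s (f s) \<in> carrier G"
  shows "support_sum G z \<theta> f \<in> carrier G"
  using assms unfolding support_sum_def by (auto intro: finsum_closed)

lemma support_sum_add:
  assumes "finite {s. f s \<noteq> z}" "finite {s. g s \<noteq> z}" "\<And>s. \<theta> s z = \<zero>"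
    and "\<And>s. \<theta> s (f s) \<in> carrier G" "\<And>s. \<theta> s (g s) \<in> carrier G"
    and "\<And>s. \<theta> s (h s) = \<theta> s (f s) \<oplus> \<theta> s (g s)" "\<And>s. f s = z \<Longrightarrow> g s = z \<Longrightarrow> h s = z"
  shows "support_sum G z \<theta> h = support_sum G z \<theta> f \<oplus> support_sum G z \<theta> g"
proof -
  let ?A = "{s. f s \<noteq> z} \<union> {s. g s \<noteq> z}"
  have "support_sum G z \<theta> h = (\<Oplus>s\<in>?A. \<theta> s (h s))"
    by (rule support_sum_superset) (use assms in auto)
  also have "\<dots> = (\<Oplus>s\<in>?A. \<theta> s (f s)) \<oplus> (\<Oplus>s\<in>?A. \<theta> s (g s))"
    using assms by (subst finsum_addf[symmetric]) auto
  also have "(\<Oplus>s\<in>?A. \<theta> s (f s)) = support_sum G z \<theta> f"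
    by (rule support_sum_superset[symmetric]) (use assms in auto)
  also have "(\<Oplus>s\<in>?A. \<theta> s (g s)) = support_sum G z \<theta> g"
    by (rule support_sum_superset[symmetric]) (use assms in auto)
  finally show ?thesis .
qed

end

text \<open>The scalar by which a word acts on \<open>E_M\<close>, and the upper right entry of its image under the
  triangular representation sending \<open>X_q\<close> to the matrix with diagonal \<open>([q \<in> N], [q \<in> M])\<close> and
  upper right entry \<open>d q\<close>. Such representations are the extensions of \<open>E_M\<close> by \<open>E_N\<close>.\<close>

abbreviation generator_char :: "('k, 'w) ring_scheme \<Rightarrow> 'v set \<Rightarrow> 'v \<Rightarrow> 'k" where
  "generator_char K M q \<equiv> if q \<in> M then \<one>\<^bsub>K\<^esub> else \<zero>\<^bsub>K\<^esub>"

definition word_char :: "('k, 'w) ring_scheme \<Rightarrow> 'v set \<Rightarrow> 'v list \<Rightarrow> 'k" where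
  "word_char K M w = foldr (\<lambda>q c. generator_char K M q \<otimes>\<^bsub>K\<^esub> c) w \<one>\<^bsub>K\<^esub>"

fun word_deriv :: "('k, 'w) ring_scheme \<Rightarrow> 'v set \<Rightarrow> 'v set \<Rightarrow> ('v \<Rightarrow> 'k) \<Rightarrow> 'v list \<Rightarrow> 'k" where
  "word_deriv K N M d [] = \<zero>\<^bsub>K\<^esub>"
| "word_deriv K N M d (q # w) =
     generator_char K N q \<otimes>\<^bsub>K\<^esub> word_deriv K N M d w \<oplus>\<^bsub>K\<^esub> d q \<otimes>\<^bsub>K\<^esub> word_char K M w"

definition linear_extension :: "('k, 'w) ring_scheme \<Rightarrow> ('v list \<Rightarrow> 'k) \<Rightarrow> ('v list \<Rightarrow> 'k) \<Rightarrow> 'k" where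
  "linear_extension K \<theta> = support_sum K \<zero>\<^bsub>K\<^esub> (\<lambda>w c. c \<otimes>\<^bsub>K\<^esub> \<theta> w)"

abbreviation free_deriv :: 
    "('k, 'w) ring_scheme \<Rightarrow> 'v set \<Rightarrow> 'v set \<Rightarrow> ('v \<Rightarrow> 'k) \<Rightarrow> ('v list \<Rightarrow> 'k) \<Rightarrow> 'k" where
  "free_deriv K N M d \<equiv> linear_extension K (word_deriv K N M d)"

lemma free_character_eq: "free_character K M = linear_extension K (word_char K M)"
  by (simp add: fun_eq_iff free_character_def linear_extension_def support_sum_def word_char_def)

section \<open>Linear functionals on the free algebra and their product rules\<close>

context cring
begin

lemma linear_extension_closed:
  assumes "f \<in> carrier (free_algebra R V)" "\<And>w. \<theta> w \<in> carrier R"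
  shows "linear_extension R \<theta> f \<in> carrier R"
  using assms unfolding linear_extension_def free_algebra_simps by (auto intro!: support_sum_closed)

lemma linear_extension_zero: "linear_extension R \<theta> \<zero>\<^bsub>free_algebra R V\<^esub> = \<zero>"
  by (simp add: linear_extension_def support_sum_def free_algebra_simps)

lemma linear_extension_add:
  assumes "f \<in> carrier (free_algebra R V)" "g \<in> carrier (free_algebra R V)" "\<And>w. \<theta> w \<in> carrier R"
  shows "linear_extension R \<theta> (f \<oplus>\<^bsub>free_algebra R V\<^esub> g) = linear_extension R \<theta> f \<oplus> linear_extension R \<theta> g"
  using assms unfolding linear_extension_def free_algebra_simps
  by (intro support_sum_add) (auto simp: Pi_iff l_distr)

lemma linear_extension_monomial:
  assumes "c \<in> carrier R" "\<And>w. \<theta> w \<in> carrier R"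
  shows "linear_extension R \<theta> (monomial R c w) = c \<otimes> \<theta> w"
proof -
  have "linear_extension R \<theta> (monomial R c w) = (\<Oplus>s\<in>{w}. monomial R c w s \<otimes> \<theta> s)"
    unfolding linear_extension_def
    by (rule support_sum_superset) (use assms in \<open>auto simp: monomial_def\<close>)
  then show ?thesis using assms by (simp add: monomial_def)
qed

lemma word_char_closed [simp]: "word_char R M w \<in> carrier R"
  by (induction w) (auto simp: word_char_def)

lemma word_char_append: "word_char R M (u @ w) = word_char R M u \<otimes> word_char R M w"
proof (induction u)
  case Nil
  show ?case using word_char_closed[of M w] by (simp add: word_char_def)
next
  case (Cons q u)
  then show ?case using word_char_closed[of M w] word_char_closed[of M u]
    by (simp add: word_char_def m_assoc)
qed

lemma word_deriv_closed [simp]: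
  "(\<And>q. d q \<in> carrier R) \<Longrightarrow> word_deriv R N M d w \<in> carrier R"
  by (induction w) auto

text \<open>This is the upper right entry of a product of two upper triangular matrices, computed
  one letter at a time.\<close>

lemma word_deriv_append:
  assumes d: "\<And>q. d q \<in> carrier R"
  shows "word_deriv R N M d (u @ w) =
    word_char R N u \<otimes> word_deriv R N M d w \<oplus> word_deriv R N M d u \<otimes> word_char R M w"
proof (induction u)
  case Nil
  have "word_char R N [] = \<one>" by (simp add: word_char_def)
  then show ?case using d by simp
next
  case (Cons q u)
  have N: "word_char R N (q # u) = generator_char R N q \<otimes> word_char R N u"
    by (simp add: word_char_def)
  have *: "n \<otimes> (x \<otimes> y \<oplus> z \<otimes> m) \<oplus> e \<otimes> (p \<otimes> m) = n \<otimes> x \<otimes> y \<oplus> (n \<otimes> z \<oplus> e \<otimes> p) \<otimes> m"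
    if "n \<in> carrier R" "x \<in> carrier R" "y \<in> carrier R" "z \<in> carrier R" "m \<in> carrier R"
      "e \<in> carrier R" "p \<in> carrier R" for n x y z m e p
    using that by algebra
  show ?case using d
    by (simp only: append_Cons word_deriv.simps Cons.IH word_char_append N) (rule *, auto)
qed

text \<open>Both sides are bilinear in \<open>f\<close> and \<open>g\<close>, so monomials suffice.
  The right side has two products in order to cover both uses: with \<open>\<gamma> = 0\<close> it
  says that characters are multiplicative, in general it is the Leibniz rule for
  \<open>free_deriv\<close>.\<close>

lemma linear_extension_mult:
  assumes f: "f \<in> carrier (free_algebra R V)" and g: "g \<in> carrier (free_algebra R V)"
    and cl: "\<And>w. \<alpha> w \<in> carrier R" "\<And>w. \<beta> w \<in> carrier R" "\<And>w. \<gamma> w \<in> carrier R" "\<And>w. \<delta> w \<in> carrier R"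
      "\<And>w. \<theta> w \<in> carrier R"
    and \<theta>: "\<And>u w. \<theta> (u @ w) = \<alpha> u \<otimes> \<beta> w \<oplus> \<gamma> u \<otimes> \<delta> w"
  shows "linear_extension R \<theta> (f \<otimes>\<^bsub>free_algebra R V\<^esub> g) =
    linear_extension R \<alpha> f \<otimes> linear_extension R \<beta> g \<oplus> linear_extension R \<gamma> f \<otimes> linear_extension R \<delta> g"
proof -
  interpret F: ring "free_algebra R V" by (rule free_algebra_ring)
  have *: "(a \<oplus> a') \<otimes> b \<oplus> (c \<oplus> c') \<otimes> e = (a \<otimes> b \<oplus> c \<otimes> e) \<oplus> (a' \<otimes> b \<oplus> c' \<otimes> e)"
    "b \<otimes> (a \<oplus> a') \<oplus> e \<otimes> (c \<oplus> c') = (b \<otimes> a \<oplus> e \<otimes> c) \<oplus> (b \<otimes> a' \<oplus> e \<otimes> c')"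
    if "a \<in> carrier R" "a' \<in> carrier R" "b \<in> carrier R" "c \<in> carrier R" "c' \<in> carrier R" "e \<in> carrier R"
    for a a' b c c' e
    using that by algebra+
  note lin = linear_extension_zero[where V = V] linear_extension_add[where V = V]
    linear_extension_monomial linear_extension_closed[where V = V]
  show ?thesis
    using f
  proof (induction rule: free_algebra_additive_induct)
    case zero
    then show ?case using g cl by (simp add: lin)
  next
    case (add f f')
    then show ?case using g cl
      by (simp add: lin F.l_distr *)
  next
    case (monomial c u)
    note u = monomial_closed[OF monomial]
    show ?case using g
    proof (induction rule: free_algebra_additive_induct)
      case zero
      then show ?case using u cl by (simp add: lin)
    next
      case (add g g')
      then show ?case using u cl
        by (simp add: lin F.r_distr *)
    next
      case (monomial e w)
      have **: "(c \<otimes> e) \<otimes> (x \<otimes> y \<oplus> x' \<otimes> y') = c \<otimes> x \<otimes> (e \<otimes> y) \<oplus> c \<otimes> x' \<otimes> (e \<otimes> y')"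
        if "x \<in> carrier R" "y \<in> carrier R" "x' \<in> carrier R" "y' \<in> carrier R" for x y x' y'
        using that monomial \<open>c \<in> carrier R\<close> by algebra
      show ?case using cl monomial \<open>c \<in> carrier R\<close>
        by (simp add: lin free_algebra_simps(4) convolution_monomial \<theta> **)
    qed
  qed
qed

lemma free_character_mult:
  assumes f: "f \<in> carrier (free_algebra R V)" and g: "g \<in> carrier (free_algebra R V)"
  shows "free_character R M (f \<otimes>\<^bsub>free_algebra R V\<^esub> g) = free_character R M f \<otimes> free_character R M g"
proof -
  have 0: "linear_extension R (\<lambda>w. \<zero>) f = \<zero>"
    using f by (auto simp: linear_extension_def support_sum_def free_algebra_simps Pi_iff 
      intro!: add.finprod_one_eqI)
  have "free_character R M (f \<otimes>\<^bsub>free_algebra R V\<^esub> g) =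
      free_character R M f \<otimes> free_character R M g \<oplus>
      linear_extension R (\<lambda>w. \<zero>) f \<otimes> free_character R M g"
    unfolding free_character_eq using f g
    by (intro linear_extension_mult) (auto simp: word_char_append)
  then show ?thesis
    using f g 0 by (simp add: free_character_eq linear_extension_closed)
qed

lemma free_deriv_mult:
  assumes "f \<in> carrier (free_algebra R V)" "g \<in> carrier (free_algebra R V)" "\<And>q. d q \<in> carrier R"
  shows "free_deriv R N M d (f \<otimes>\<^bsub>free_algebra R V\<^esub> g) =
    free_character R N f \<otimes> free_deriv R N M d g \<oplus> free_deriv R N M d f \<otimes> free_character R M g"
  unfolding free_character_eq using assms
  by (intro linear_extension_mult) (auto simp: word_deriv_append)

end


section \<open>The algebra of a quiver and its characters\<close>

lemma quotient_simps:
  "carrier (quotient M N) = a_rcosets\<^bsub>M\<^esub> N"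
  "X \<otimes>\<^bsub>quotient M N\<^esub> Y = rcoset_mult M N X Y"
  "\<one>\<^bsub>quotient M N\<^esub> = N +>\<^bsub>M\<^esub> \<one>\<^bsub>M\<^esub>"
  "\<zero>\<^bsub>quotient M N\<^esub> = N"
  "X \<oplus>\<^bsub>quotient M N\<^esub> Y = X <+>\<^bsub>M\<^esub> Y"
  "c \<odot>\<^bsub>quotient M N\<^esub> X = (\<Union>x\<in>X. N +>\<^bsub>M\<^esub> (c \<odot>\<^bsub>M\<^esub> x))"
  by (simp_all add: quotient_def FactRing_def)

text \<open>\<open>quotient\<close> builds a module record whose ring fields are those of the factor
  ring, so the axioms are carried over field by field.\<close>

lemma ring_quotient:
  assumes "ideal I R"
  shows "ring (quotient R I)"
proof -
  interpret q: ring "R Quot I" using assms by (rule ideal.quotient_is_ring)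
  have eq: "carrier (quotient R I) = carrier (R Quot I)" "add (quotient R I) = add (R Quot I)"
    "mult (quotient R I) = mult (R Quot I)" "one (quotient R I) = one (R Quot I)"
    "zero (quotient R I) = zero (R Quot I)"
    by (simp_all add: quotient_def)
  show ?thesis
  proof (rule ringI)
    show "abelian_group (quotient R I)"
      by (rule abelian_groupI; unfold eq)
        (simp_all add: q.a_ac q.add.l_inv_ex)
    show "Group.monoid (quotient R I)"
      by (rule monoidI; unfold eq) (auto simp: q.m_assoc)
  qed (unfold eq, auto simp: q.l_distr q.r_distr)
qed

section \<open>The quotient algebra in terms of cosets\<close>

locale quiver_algebra_over = K?: field K + fin_digraph Q
  for K :: "('k, 'w) ring_scheme" (structure) and Q :: "('v, 'e) pre_digraph"
begin

abbreviation "V \<equiv> verts Q"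
abbreviation "F \<equiv> free_algebra K V"
abbreviation "I \<equiv> Idl\<^bsub>F\<^esub> (quiver_relations K Q)"
abbreviation "B \<equiv> quiver_algebra K Q"
abbreviation "X t \<equiv> I +>\<^bsub>F\<^esub> free_gen K t"
abbreviation "\<iota> c \<equiv> c \<odot>\<^bsub>B\<^esub> \<one>\<^bsub>B\<^esub>"

sublocale F: ring F by (rule free_algebra_ring)

lemma free_gen_eq: "free_gen K t = monomial K \<one> [t]"
  by (simp add: free_gen_def monomial_def)

lemma free_gen_closed [simp]: "t \<in> V \<Longrightarrow> free_gen K t \<in> carrier F"
  by (simp add: free_gen_eq monomial_closed)

lemma relations_closed: "quiver_relations K Q \<subseteq> carrier F"
  unfolding quiver_relations_def Let_def by auto

sublocale I: ideal I F
  by (intro F.genideal_ideal relations_closed)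

lemma B_eq: "B = quotient F I"
  by (simp add: quiver_algebra_def)

sublocale B: ring B
  unfolding B_eq by (rule ring_quotient) (rule I.ideal_axioms)

lemma B_simps:
  "f \<in> carrier F \<Longrightarrow> I +>\<^bsub>F\<^esub> f \<in> carrier B"
  "f \<in> carrier F \<Longrightarrow> g \<in> carrier F \<Longrightarrow>
    (I +>\<^bsub>F\<^esub> f) \<oplus>\<^bsub>B\<^esub> (I +>\<^bsub>F\<^esub> g) = I +>\<^bsub>F\<^esub> (f \<oplus>\<^bsub>F\<^esub> g)"
  "f \<in> carrier F \<Longrightarrow> g \<in> carrier F \<Longrightarrow>
    (I +>\<^bsub>F\<^esub> f) \<otimes>\<^bsub>B\<^esub> (I +>\<^bsub>F\<^esub> g) = I +>\<^bsub>F\<^esub> (f \<otimes>\<^bsub>F\<^esub> g)"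
  by (auto simp: B_eq quotient_simps F.a_rcosetsI I.a_subset I.a_rcos_sum I.rcoset_mult_add)

lemma B_one_eq: "\<one>\<^bsub>B\<^esub> = I +>\<^bsub>F\<^esub> \<one>\<^bsub>F\<^esub>"
  by (simp add: B_eq quotient_simps)

lemma B_zero_eq: "\<zero>\<^bsub>B\<^esub> = I +>\<^bsub>F\<^esub> \<zero>\<^bsub>F\<^esub>"
  by (simp add: B_eq quotient_simps I.a_rcos_const)

lemma B_cases [consumes 1, case_names coset]:
  assumes "b \<in> carrier B"
  obtains f where "f \<in> carrier F" "b = I +>\<^bsub>F\<^esub> f"
  using assms unfolding B_eq quotient_simps A_RCOSETS_def' by auto

lemma coset_eq_iff:
  assumes "f \<in> carrier F" "g \<in> carrier F"
  shows "I +>\<^bsub>F\<^esub> f = I +>\<^bsub>F\<^esub> g \<longleftrightarrow> f \<ominus>\<^bsub>F\<^esub> g \<in> I"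
proof
  assume "I +>\<^bsub>F\<^esub> f = I +>\<^bsub>F\<^esub> g"
  then have "f \<in> I +>\<^bsub>F\<^esub> g" using assms I.a_rcos_self by blast
  then show "f \<ominus>\<^bsub>F\<^esub> g \<in> I"
    using assms by (simp add: I.a_rcos_module_minus[OF F.ring_axioms])
next
  assume "f \<ominus>\<^bsub>F\<^esub> g \<in> I"
  then have "f \<in> I +>\<^bsub>F\<^esub> g"
    using assms by (simp add: I.a_rcos_module_minus[OF F.ring_axioms])
  then show "I +>\<^bsub>F\<^esub> f = I +>\<^bsub>F\<^esub> g"
    using assms I.a_repr_independence' by metis
qed

text \<open>The scalar action on a coset is a union over its representatives. Scaling is left
  multiplication by the constant \<open>monomial K c []\<close>, and \<open>I\<close> is an ideal,
  so all representatives yield the same coset.\<close>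

lemma iota_eq:
  assumes c: "c \<in> carrier K"
  shows "\<iota> c = I +>\<^bsub>F\<^esub> monomial K c []"
proof -
  have smult: "c \<odot>\<^bsub>F\<^esub> f = monomial K c [] \<otimes>\<^bsub>F\<^esub> f" if "f \<in> carrier F" for f
  proof -
    have f: "f \<in> UNIV \<rightarrow> carrier K" using that by (simp add: free_algebra_simps)
    have eq: "monomial K c [] = (\<lambda>u. c \<otimes> monomial K \<one> [] u)"
      using c by (auto simp: monomial_def)
    have one: "monomial K \<one> [] \<in> UNIV \<rightarrow> carrier K" by (auto simp: monomial_def)
    have "convolution K (monomial K c []) f w = c \<otimes> f w" for w
      unfolding eq convolution_smult_left[OF c one f] convolution_one_left[OF f] ..
    then show ?thesis by (simp add: free_algebra_simps(4,5) fun_eq_iff)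
  qed
  have c': "monomial K c [] \<in> carrier F" using c by (simp add: monomial_closed)
  have "I +>\<^bsub>F\<^esub> (c \<odot>\<^bsub>F\<^esub> x) = I +>\<^bsub>F\<^esub> monomial K c []" if x: "x \<in> I +>\<^bsub>F\<^esub> \<one>\<^bsub>F\<^esub>" for x
  proof -
    have xF: "x \<in> carrier F" using x I.a_elemrcos_carrier by blast
    have "x \<ominus>\<^bsub>F\<^esub> \<one>\<^bsub>F\<^esub> \<in> I" using x xF I.a_rcos_module_minus[OF F.ring_axioms] by simp
    then have "monomial K c [] \<otimes>\<^bsub>F\<^esub> (x \<ominus>\<^bsub>F\<^esub> \<one>\<^bsub>F\<^esub>) \<in> I" using c' I.I_l_closed by simp
    then show ?thesis
      using xF c' by (subst coset_eq_iff) (auto simp: smult F.r_distr F.minus_eq F.r_minus)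
  qed
  moreover have "\<one>\<^bsub>F\<^esub> \<in> I +>\<^bsub>F\<^esub> \<one>\<^bsub>F\<^esub>" by (intro I.a_rcos_self) simp
  ultimately show ?thesis unfolding B_eq quotient_simps by blast
qed

lemma generator_closed [simp]: "t \<in> V \<Longrightarrow> X t \<in> carrier B"
  by (simp add: B_simps)

lemma iota_closed [simp]: "c \<in> carrier K \<Longrightarrow> \<iota> c \<in> carrier B"
  by (simp add: iota_eq B_simps monomial_closed)

lemma iota_add:
  assumes "c \<in> carrier K" "e \<in> carrier K"
  shows "\<iota> (c \<oplus> e) = \<iota> c \<oplus>\<^bsub>B\<^esub> \<iota> e"
proof -
  have "monomial K (c \<oplus> e) [] = monomial K c [] \<oplus>\<^bsub>F\<^esub> monomial K e []"
    by (auto simp: monomial_def free_algebra_simps)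
  then show ?thesis using assms by (simp add: iota_eq B_simps monomial_closed)
qed

lemma iota_mult:
  assumes "c \<in> carrier K" "e \<in> carrier K"
  shows "\<iota> (c \<otimes> e) = \<iota> c \<otimes>\<^bsub>B\<^esub> \<iota> e"
proof -
  have "monomial K (c \<otimes> e) [] = monomial K c [] \<otimes>\<^bsub>F\<^esub> monomial K e []"
    using assms by (simp add: free_algebra_simps(4) convolution_monomial)
  then show ?thesis using assms by (simp add: iota_eq B_simps monomial_closed)
qed

lemma iota_one: "\<iota> \<one> = \<one>\<^bsub>B\<^esub>"
  by (simp add: iota_eq) (simp add: B_one_eq free_algebra_simps)

lemma iota_zero: "\<iota> \<zero> = \<zero>\<^bsub>B\<^esub>"
  by (simp add: iota_eq) (simp add: B_zero_eq free_algebra_simps monomial_def)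

text \<open>Scalars and generators generate the algebra: a word is a product of generators, a
  monomial a scalar times a word, and every element a sum of monomials.\<close>

lemma B_induct [consumes 1, case_names scalar generator add mult]:
  assumes b: "b \<in> carrier B"
    and scalar: "\<And>c. c \<in> carrier K \<Longrightarrow> P (\<iota> c)"
    and generator: "\<And>t. t \<in> V \<Longrightarrow> P (X t)"
    and add: "\<And>a b. a \<in> carrier B \<Longrightarrow> b \<in> carrier B \<Longrightarrow> P a \<Longrightarrow> P b \<Longrightarrow> P (a \<oplus>\<^bsub>B\<^esub> b)"
    and mult: "\<And>a b. a \<in> carrier B \<Longrightarrow> b \<in> carrier B \<Longrightarrow> P a \<Longrightarrow> P b \<Longrightarrow> P (a \<otimes>\<^bsub>B\<^esub> b)"
  shows "P b"
proof -
  have word: "P (I +>\<^bsub>F\<^esub> monomial K \<one> w)" if "w \<in> lists V" for w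
    using that
  proof (induction w)
    case Nil
    then show ?case using scalar[of \<one>] by (simp add: iota_eq)
  next
    case (Cons q w)
    then have "P (X q \<otimes>\<^bsub>B\<^esub> (I +>\<^bsub>F\<^esub> monomial K \<one> w))"
      by (intro mult generator) (auto simp: B_simps monomial_closed)
    also have "X q \<otimes>\<^bsub>B\<^esub> (I +>\<^bsub>F\<^esub> monomial K \<one> w) = I +>\<^bsub>F\<^esub> monomial K \<one> (q # w)"
      using Cons by (simp add: B_simps monomial_closed free_gen_eq free_algebra_simps(4)
        convolution_monomial)
    finally show ?case .
  qed
  obtain f where f: "f \<in> carrier F" "b = I +>\<^bsub>F\<^esub> f" using b by (rule B_cases)
  from f(1) have "P (I +>\<^bsub>F\<^esub> f)"
  proof (induction rule: free_algebra_additive_induct)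
    case zero
    then show ?case using scalar[of \<zero>] iota_zero by (simp add: B_zero_eq)
  next
    case (monomial c w)
    then have "P (\<iota> c \<otimes>\<^bsub>B\<^esub> (I +>\<^bsub>F\<^esub> monomial K \<one> w))"
      by (intro mult scalar word) (auto simp: B_simps monomial_closed)
    also have "\<iota> c \<otimes>\<^bsub>B\<^esub> (I +>\<^bsub>F\<^esub> monomial K \<one> w) = I +>\<^bsub>F\<^esub> monomial K c w"
      using monomial by (simp add: iota_eq B_simps monomial_closed free_algebra_simps(4)
        convolution_monomial)
    finally show ?case .
  next
    case (add f g)
    then show ?case using assms(4)[of "I +>\<^bsub>F\<^esub> f" "I +>\<^bsub>F\<^esub> g"] by (simp add: B_simps)
  qed
  then show ?thesis using f by simp
qed

lemma iota_central:
  assumes c: "c \<in> carrier K" and "b \<in> carrier B"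
  shows "\<iota> c \<otimes>\<^bsub>B\<^esub> b = b \<otimes>\<^bsub>B\<^esub> \<iota> c"
  using assms(2)
proof (induction rule: B_induct)
  case (scalar e)
  then show ?case using c by (simp add: iota_mult[symmetric] m_comm)
next
  case (generator t)
  then show ?case using c
    by (simp add: iota_eq B_simps monomial_closed free_gen_eq free_algebra_simps(4)
        convolution_monomial)
next
  case (add a b)
  then show ?case using c by (simp add: B.l_distr B.r_distr)
next
  case (mult a b)
  then show ?case using c by (metis B.m_assoc iota_closed)
qed

lemma generator_relations:
  assumes "s \<in> V" "t \<in> V"
  shows "X s \<otimes>\<^bsub>B\<^esub> X s = X s"
    and "X s \<otimes>\<^bsub>B\<^esub> X t \<otimes>\<^bsub>B\<^esub> X s = X t \<otimes>\<^bsub>B\<^esub> X s \<otimes>\<^bsub>B\<^esub> X t"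
    and "(t, s) \<notin> arcs_ends Q \<Longrightarrow> X t \<otimes>\<^bsub>B\<^esub> X s \<otimes>\<^bsub>B\<^esub> X t = X s \<otimes>\<^bsub>B\<^esub> X t"
proof -
  let ?X = "free_gen K"
  have eq: "I +>\<^bsub>F\<^esub> f = I +>\<^bsub>F\<^esub> g"
    if "f \<ominus>\<^bsub>F\<^esub> g \<in> quiver_relations K Q" "f \<in> carrier F" "g \<in> carrier F" for f g
    using that F.genideal_self[OF relations_closed] coset_eq_iff by blast
  have "?X s \<otimes>\<^bsub>F\<^esub> ?X s \<ominus>\<^bsub>F\<^esub> ?X s \<in> quiver_relations K Q"
    using assms unfolding quiver_relations_def Let_def by blast
  from eq[OF this] show "X s \<otimes>\<^bsub>B\<^esub> X s = X s"
    using assms by (simp add: B_simps)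
  have "?X s \<otimes>\<^bsub>F\<^esub> ?X t \<otimes>\<^bsub>F\<^esub> ?X s \<ominus>\<^bsub>F\<^esub> ?X t \<otimes>\<^bsub>F\<^esub> ?X s \<otimes>\<^bsub>F\<^esub> ?X t \<in> quiver_relations K Q"
    using assms unfolding quiver_relations_def Let_def by blast
  from eq[OF this] show "X s \<otimes>\<^bsub>B\<^esub> X t \<otimes>\<^bsub>B\<^esub> X s = X t \<otimes>\<^bsub>B\<^esub> X s \<otimes>\<^bsub>B\<^esub> X t"
    using assms by (simp add: B_simps)
  assume "(t, s) \<notin> arcs_ends Q"
  then have "?X t \<otimes>\<^bsub>F\<^esub> ?X s \<otimes>\<^bsub>F\<^esub> ?X t \<ominus>\<^bsub>F\<^esub> ?X s \<otimes>\<^bsub>F\<^esub> ?X t \<in> quiver_relations K Q"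
    using assms unfolding quiver_relations_def Let_def by blast
  from eq[OF this] show "X t \<otimes>\<^bsub>B\<^esub> X s \<otimes>\<^bsub>B\<^esub> X t = X s \<otimes>\<^bsub>B\<^esub> X t"
    using assms by (simp add: B_simps)
qed

end


text \<open>The upper right corners of the defining relations under the triangular representation above;
  \<open>d2\<close> and \<open>d3\<close> are the corners of products of two and of three generators.\<close>

definition satisfies_relations ::
    "('k, 'w) ring_scheme \<Rightarrow> ('v, 'e) pre_digraph \<Rightarrow> 'v set \<Rightarrow> 'v set \<Rightarrow> ('v \<Rightarrow> 'k) \<Rightarrow> bool" where
  "satisfies_relations K Q N M d \<longleftrightarrow>
     (let n = generator_char K N; m = generator_char K M;
          d2 = (\<lambda>s t. n s \<otimes>\<^bsub>K\<^esub> d t \<oplus>\<^bsub>K\<^esub> d s \<otimes>\<^bsub>K\<^esub> m t);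
          d3 = (\<lambda>s t u. n s \<otimes>\<^bsub>K\<^esub> n t \<otimes>\<^bsub>K\<^esub> d u \<oplus>\<^bsub>K\<^esub> d2 s t \<otimes>\<^bsub>K\<^esub> m u) in
       \<forall>s \<in> verts Q. \<forall>t \<in> verts Q.
         d2 s s = d s \<and> d3 s t s = d3 t s t \<and> ((t, s) \<notin> arcs_ends Q \<longrightarrow> d3 t s t = d2 s t))"

definition algebra_char :: "('k, 'w) ring_scheme \<Rightarrow> 'v set \<Rightarrow> ('v list \<Rightarrow> 'k) set \<Rightarrow> 'k" where
  "algebra_char K M b = the_elem (free_character K M ` b)"

definition algebra_deriv ::
    "('k, 'w) ring_scheme \<Rightarrow> 'v set \<Rightarrow> 'v set \<Rightarrow> ('v \<Rightarrow> 'k) \<Rightarrow> ('v list \<Rightarrow> 'k) set \<Rightarrow> 'k" where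
  "algebra_deriv K N M d b = the_elem (free_deriv K N M d ` b)"

section \<open>Descent of characters and derivations to the quotient\<close>

context quiver_algebra_over
begin

lemma free_char_simps:
  shows "f \<in> carrier F \<Longrightarrow> free_character K M f \<in> carrier K"
    and "f \<in> carrier F \<Longrightarrow> g \<in> carrier F \<Longrightarrow>
      free_character K M (f \<oplus>\<^bsub>F\<^esub> g) = free_character K M f \<oplus> free_character K M g"
    and "free_character K M \<zero>\<^bsub>F\<^esub> = \<zero>"
    and "c \<in> carrier K \<Longrightarrow> free_character K M (monomial K c []) = c"
    and "free_character K M (free_gen K t) = generator_char K M t"
  unfolding free_character_eq free_gen_eq
  by (auto simp: linear_extension_closed linear_extension_add linear_extension_zero
      linear_extension_monomial) (auto simp: word_char_def)

lemma free_deriv_simps: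
  assumes "\<And>q. d q \<in> carrier K"
  shows "f \<in> carrier F \<Longrightarrow> free_deriv K N M d f \<in> carrier K"
    and "f \<in> carrier F \<Longrightarrow> g \<in> carrier F \<Longrightarrow>
      free_deriv K N M d (f \<oplus>\<^bsub>F\<^esub> g) = free_deriv K N M d f \<oplus> free_deriv K N M d g"
    and "free_deriv K N M d \<zero>\<^bsub>F\<^esub> = \<zero>"
    and "c \<in> carrier K \<Longrightarrow> free_deriv K N M d (monomial K c []) = \<zero>"
    and "free_deriv K N M d (free_gen K t) = d t"
  using assms unfolding free_gen_eq
  by (auto simp: linear_extension_closed linear_extension_add linear_extension_zero
      linear_extension_monomial) (auto simp: word_char_def)

lemma additive_minus:
  assumes "\<And>f. f \<in> carrier F \<Longrightarrow> L f \<in> carrier K"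
    and "\<And>f g. f \<in> carrier F \<Longrightarrow> g \<in> carrier F \<Longrightarrow> L (f \<oplus>\<^bsub>F\<^esub> g) = L f \<oplus> L g"
    and "L \<zero>\<^bsub>F\<^esub> = \<zero>" and f: "f \<in> carrier F" and g: "g \<in> carrier F"
  shows "L (f \<ominus>\<^bsub>F\<^esub> g) = L f \<ominus> L g"
proof -
  have "L (\<ominus>\<^bsub>F\<^esub> g) \<oplus> L g = \<zero>"
    using assms(2)[of "\<ominus>\<^bsub>F\<^esub> g" g] assms(3) g by (simp add: F.l_neg)
  then have "L (\<ominus>\<^bsub>F\<^esub> g) = \<ominus> L g" using assms(1) g by (simp add: K.minus_equality)
  then show ?thesis using assms(2) f g by (simp add: F.minus_eq K.minus_eq)
qed

lemma free_char_minus: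
  "f \<in> carrier F \<Longrightarrow> g \<in> carrier F \<Longrightarrow>
    free_character K M (f \<ominus>\<^bsub>F\<^esub> g) = free_character K M f \<ominus> free_character K M g"
  by (rule additive_minus) (auto simp: free_char_simps)

lemma free_deriv_minus:
  "(\<And>q. d q \<in> carrier K) \<Longrightarrow> f \<in> carrier F \<Longrightarrow> g \<in> carrier F \<Longrightarrow>
    free_deriv K N M d (f \<ominus>\<^bsub>F\<^esub> g) = free_deriv K N M d f \<ominus> free_deriv K N M d g"
  by (rule additive_minus) (auto simp: free_deriv_simps)

text \<open>This is the kernel of the triangular representation. The product rule for
  \<open>free_deriv\<close> brings in the character for \<open>M\<close> or for \<open>N\<close> of
  the factor in the set, depending on the side, so the three conditions have to be imposed
  together.\<close>

lemma kernel_ideal: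
  assumes d: "\<And>q. d q \<in> carrier K"
  shows "ideal {f \<in> carrier F. free_character K M f = \<zero> \<and> free_character K N f = \<zero> \<and>
    free_deriv K N M d f = \<zero>} F" (is "ideal ?J F")
proof (rule idealI)
  note simps = free_char_simps free_deriv_simps[where d = d, OF d]
  have neg: "\<ominus>\<^bsub>F\<^esub> f = \<zero>\<^bsub>F\<^esub> \<ominus>\<^bsub>F\<^esub> f" if "f \<in> carrier F" for f
    using that by (simp add: F.minus_eq)
  show "ring F" by (rule F.ring_axioms)
  show "subgroup ?J (add_monoid F)"
  proof (rule F.add.subgroupI)
    fix f assume "f \<in> ?J"
    then have "free_character K M (\<zero>\<^bsub>F\<^esub> \<ominus>\<^bsub>F\<^esub> f) = \<zero>" "free_character K N (\<zero>\<^bsub>F\<^esub> \<ominus>\<^bsub>F\<^esub> f) = \<zero>"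
        "free_deriv K N M d (\<zero>\<^bsub>F\<^esub> \<ominus>\<^bsub>F\<^esub> f) = \<zero>"
      by (simp_all add: free_char_minus free_deriv_minus d simps K.minus_eq)
    then show "\<ominus>\<^bsub>F\<^esub> f \<in> ?J" using \<open>f \<in> ?J\<close> neg by auto
  next
    show "?J \<noteq> {}" using F.zero_closed by (auto simp: simps intro!: exI[of _ "\<zero>\<^bsub>F\<^esub>"])
  qed (auto simp: simps)
  fix f x assume f: "f \<in> ?J" and x: "x \<in> carrier F"
  show "x \<otimes>\<^bsub>F\<^esub> f \<in> ?J" "f \<otimes>\<^bsub>F\<^esub> x \<in> ?J"
    using f x by (auto simp: simps free_character_mult free_deriv_mult d)
qed

text \<open>A character sends the generators to commuting idempotents, which satisfy all three kinds
  of relations for any \<open>M'\<close>. For the derivation, the corners of the relations are the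
  equations in \<open>satisfies_relations\<close>.\<close>

lemma relations_in_kernel:
  assumes d: "\<And>q. d q \<in> carrier K" and rel: "satisfies_relations K Q N M d"
    and r: "r \<in> quiver_relations K Q"
  shows "free_character K M' r = \<zero>" "free_deriv K N M d r = \<zero>"
proof -
  let ?X = "free_gen K"
  note d' = free_deriv_simps[where d = d, OF d]
  note simps = free_char_minus free_deriv_minus[where d = d, OF d] free_character_mult free_deriv_mult[where d = d, OF _ _ d] free_char_simps d'
  consider
      s where "s \<in> V" "r = ?X s \<otimes>\<^bsub>F\<^esub> ?X s \<ominus>\<^bsub>F\<^esub> ?X s"
    | s t where "s \<in> V" "t \<in> V"
        "r = ?X s \<otimes>\<^bsub>F\<^esub> ?X t \<otimes>\<^bsub>F\<^esub> ?X s \<ominus>\<^bsub>F\<^esub> ?X t \<otimes>\<^bsub>F\<^esub> ?X s \<otimes>\<^bsub>F\<^esub> ?X t"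
    | s t where "s \<in> V" "t \<in> V" "(t, s) \<notin> arcs_ends Q"
        "r = ?X t \<otimes>\<^bsub>F\<^esub> ?X s \<otimes>\<^bsub>F\<^esub> ?X t \<ominus>\<^bsub>F\<^esub> ?X s \<otimes>\<^bsub>F\<^esub> ?X t"
    using r unfolding quiver_relations_def Let_def by blast
  then have "free_character K M' r = \<zero> \<and> free_deriv K N M d r = \<zero>"
  proof cases
    case 1
    then have "generator_char K N s \<otimes> d s \<oplus> d s \<otimes> generator_char K M s = d s"
      using rel unfolding satisfies_relations_def Let_def by blast
    then show ?thesis using 1(1) unfolding 1(2) by (simp only: simps F.m_closed free_gen_closed)
        (simp add: d K.minus_eq K.r_neg)
  next
    case 2
    then have "generator_char K N s \<otimes> generator_char K N t \<otimes> d s \<oplus>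
        (generator_char K N s \<otimes> d t \<oplus> d s \<otimes> generator_char K M t) \<otimes> generator_char K M s =
        generator_char K N t \<otimes> generator_char K N s \<otimes> d t \<oplus>
        (generator_char K N t \<otimes> d s \<oplus> d t \<otimes> generator_char K M s) \<otimes> generator_char K M t"
      using rel unfolding satisfies_relations_def Let_def by blast
    then show ?thesis using 2(1,2) unfolding 2(3)
      by (simp only: simps F.m_closed free_gen_closed) (simp add: d K.minus_eq K.r_neg)
  next
    case 3
    then have "generator_char K N t \<otimes> generator_char K N s \<otimes> d t \<oplus>
        (generator_char K N t \<otimes> d s \<oplus> d t \<otimes> generator_char K M s) \<otimes> generator_char K M t =
        generator_char K N s \<otimes> d t \<oplus> d s \<otimes> generator_char K M t"
      using rel unfolding satisfies_relations_def Let_def by blast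
    then show ?thesis using 3(1,2) unfolding 3(4)
      by (simp only: simps F.m_closed free_gen_closed) (simp add: d K.minus_eq K.r_neg)
  qed
  then show "free_character K M' r = \<zero>" "free_deriv K N M d r = \<zero>" by auto
qed

lemma ideal_in_kernel:
  assumes d: "\<And>q. d q \<in> carrier K" and rel: "satisfies_relations K Q N M d" and f: "f \<in> I"
  shows "free_character K M f = \<zero>" "free_deriv K N M d f = \<zero>"
proof -
  have "I \<subseteq> {f \<in> carrier F. free_character K M f = \<zero> \<and> free_character K N f = \<zero> \<and>
      free_deriv K N M d f = \<zero>}"
    using relations_closed relations_in_kernel[OF d rel]
    by (intro F.genideal_minimal kernel_ideal d) auto
  then show "free_character K M f = \<zero>" "free_deriv K N M d f = \<zero>" using f by blast+
qed

text \<open>With the zero derivation, \<open>ideal_in_kernel\<close> becomes a statement about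
  characters alone; in this way every character descends to \<open>B\<close>.\<close>

lemma satisfies_relations_zero: "satisfies_relations K Q N M (\<lambda>_. \<zero>)"
  by (auto simp: satisfies_relations_def)

lemma the_elem_coset:
  assumes L: "\<And>f. f \<in> carrier F \<Longrightarrow> L f \<in> carrier K"
    "\<And>f g. f \<in> carrier F \<Longrightarrow> g \<in> carrier F \<Longrightarrow> L (f \<oplus>\<^bsub>F\<^esub> g) = L f \<oplus> L g"
    and I: "\<And>f. f \<in> I \<Longrightarrow> L f = \<zero>" and f: "f \<in> carrier F"
  shows "the_elem (L ` (I +>\<^bsub>F\<^esub> f)) = L f"
proof -
  have "L x = L f" if "x \<in> I +>\<^bsub>F\<^esub> f" for x
    using that f I.a_subset by (auto simp: a_r_coset_def' L I)
  then have "L ` (I +>\<^bsub>F\<^esub> f) = {L f}" using I.a_rcos_self[OF f] by blast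
  then show ?thesis by simp
qed

lemma algebra_char_coset:
  "f \<in> carrier F \<Longrightarrow> algebra_char K M (I +>\<^bsub>F\<^esub> f) = free_character K M f"
  unfolding algebra_char_def
  by (rule the_elem_coset)
    (auto simp: free_char_simps intro: ideal_in_kernel[OF _ satisfies_relations_zero])

lemma algebra_char_simps:
  shows "b \<in> carrier B \<Longrightarrow> algebra_char K M b \<in> carrier K"
    and "a \<in> carrier B \<Longrightarrow> b \<in> carrier B \<Longrightarrow>
      algebra_char K M (a \<oplus>\<^bsub>B\<^esub> b) = algebra_char K M a \<oplus> algebra_char K M b"
    and "a \<in> carrier B \<Longrightarrow> b \<in> carrier B \<Longrightarrow>
      algebra_char K M (a \<otimes>\<^bsub>B\<^esub> b) = algebra_char K M a \<otimes> algebra_char K M b"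
    and "c \<in> carrier K \<Longrightarrow> algebra_char K M (\<iota> c) = c"
    and "t \<in> V \<Longrightarrow> algebra_char K M (X t) = generator_char K M t"
    and "algebra_char K M \<one>\<^bsub>B\<^esub> = \<one>"
    and "algebra_char K M \<zero>\<^bsub>B\<^esub> = \<zero>"
proof -
  show *: "c \<in> carrier K \<Longrightarrow> algebra_char K M (\<iota> c) = c" for c
    by (simp add: iota_eq algebra_char_coset monomial_closed free_char_simps)
  show "algebra_char K M \<one>\<^bsub>B\<^esub> = \<one>" "algebra_char K M \<zero>\<^bsub>B\<^esub> = \<zero>"
    using *[of \<one>] *[of \<zero>] by (simp_all add: iota_one iota_zero)
qed (auto elim!: B_cases
    simp: algebra_char_coset B_simps free_char_simps free_character_mult)

lemma algebra_deriv_simps: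
  assumes d: "\<And>q. d q \<in> carrier K" and rel: "satisfies_relations K Q N M d"
  shows "b \<in> carrier B \<Longrightarrow> algebra_deriv K N M d b \<in> carrier K"
    and "a \<in> carrier B \<Longrightarrow> b \<in> carrier B \<Longrightarrow>
      algebra_deriv K N M d (a \<oplus>\<^bsub>B\<^esub> b) = algebra_deriv K N M d a \<oplus> algebra_deriv K N M d b"
    and "a \<in> carrier B \<Longrightarrow> b \<in> carrier B \<Longrightarrow>
      algebra_deriv K N M d (a \<otimes>\<^bsub>B\<^esub> b) =
        algebra_char K N a \<otimes> algebra_deriv K N M d b \<oplus> algebra_deriv K N M d a \<otimes> algebra_char K M b"
    and "c \<in> carrier K \<Longrightarrow> algebra_deriv K N M d (\<iota> c) = \<zero>"
    and "t \<in> V \<Longrightarrow> algebra_deriv K N M d (X t) = d t"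
proof -
  note d' = free_deriv_simps[where d = d, OF d]
  have coset: "algebra_deriv K N M d (I +>\<^bsub>F\<^esub> f) = free_deriv K N M d f" if "f \<in> carrier F" for f
    unfolding algebra_deriv_def using that
    by (intro the_elem_coset ideal_in_kernel[OF d rel]) (auto simp: d')
  show "c \<in> carrier K \<Longrightarrow> algebra_deriv K N M d (\<iota> c) = \<zero>"
    by (simp add: iota_eq coset monomial_closed d')
  show "b \<in> carrier B \<Longrightarrow> algebra_deriv K N M d b \<in> carrier K"
    and "a \<in> carrier B \<Longrightarrow> b \<in> carrier B \<Longrightarrow>
      algebra_deriv K N M d (a \<oplus>\<^bsub>B\<^esub> b) = algebra_deriv K N M d a \<oplus> algebra_deriv K N M d b"
    and "a \<in> carrier B \<Longrightarrow> b \<in> carrier B \<Longrightarrow>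
      algebra_deriv K N M d (a \<otimes>\<^bsub>B\<^esub> b) =
        algebra_char K N a \<otimes> algebra_deriv K N M d b \<oplus> algebra_deriv K N M d a \<otimes> algebra_char K M b"
    and "t \<in> V \<Longrightarrow> algebra_deriv K N M d (X t) = d t"
    by (auto elim!: B_cases simp: coset algebra_char_coset B_simps d' d free_deriv_mult)
qed

text \<open>The corner equations result from applying \<open>\<delta>\<close> to the relations
  between the generators of \<open>B\<close> and expanding by the product rule.\<close>

lemma generator_derivation_satisfies:
  assumes cl: "\<And>b. b \<in> carrier B \<Longrightarrow> \<delta> b \<in> carrier K"
    and mult: "\<And>a b. a \<in> carrier B \<Longrightarrow> b \<in> carrier B \<Longrightarrow>
      \<delta> (a \<otimes>\<^bsub>B\<^esub> b) = algebra_char K N a \<otimes> \<delta> b \<oplus> \<delta> a \<otimes> algebra_char K M b"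
  shows "satisfies_relations K Q N M (\<lambda>t. \<delta> (X t))"
  unfolding satisfies_relations_def Let_def
proof (intro ballI conjI impI)
  fix s t assume st: "s \<in> V" "t \<in> V"
  note simps = mult algebra_char_simps B.m_closed generator_closed
  show "generator_char K N s \<otimes> \<delta> (X s) \<oplus> \<delta> (X s) \<otimes> generator_char K M s = \<delta> (X s)"
    using arg_cong[OF generator_relations(1)[OF st], of \<delta>] st by (simp only: simps)
  show "generator_char K N s \<otimes> generator_char K N t \<otimes> \<delta> (X s) \<oplus>
        (generator_char K N s \<otimes> \<delta> (X t) \<oplus> \<delta> (X s) \<otimes> generator_char K M t) \<otimes> generator_char K M s =
        generator_char K N t \<otimes> generator_char K N s \<otimes> \<delta> (X t) \<oplus>
        (generator_char K N t \<otimes> \<delta> (X s) \<oplus> \<delta> (X t) \<otimes> generator_char K M s) \<otimes> generator_char K M t"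
    using arg_cong[OF generator_relations(2)[OF st], of \<delta>] st by (simp only: simps)
  assume arc: "(t, s) \<notin> arcs_ends Q"
  show "generator_char K N t \<otimes> generator_char K N s \<otimes> \<delta> (X t) \<oplus>
        (generator_char K N t \<otimes> \<delta> (X s) \<oplus> \<delta> (X t) \<otimes> generator_char K M s) \<otimes> generator_char K M t =
        generator_char K N s \<otimes> \<delta> (X t) \<oplus> \<delta> (X s) \<otimes> generator_char K M t"
    using arg_cong[OF generator_relations(3)[OF st arc], of \<delta>] st by (simp only: simps)
qed

text \<open>Each claim is one relation evaluated at the values 0 and 1 of the characters.
  Idempotence reads \<open>d s + d s = d s\<close> inside both sets and \<open>0 = d s\<close>
  outside both. The braid relation reduces to \<open>d s = d t\<close> within either difference. The
  last claim is the third relation with the roles of \<open>s\<close> and \<open>t\<close>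
  exchanged, where one corner is 0 and the other the sum.\<close>

lemma satisfies_relationsD:
  assumes rel: "satisfies_relations K Q N M d" and d: "\<And>q. q \<in> V \<Longrightarrow> d q \<in> carrier K"
    and s: "s \<in> V" and t: "t \<in> V"
  shows "(s \<in> M \<longleftrightarrow> s \<in> N) \<Longrightarrow> d s = \<zero>"
    and "s \<in> M - N \<Longrightarrow> t \<in> M - N \<Longrightarrow> d s = d t"
    and "s \<in> N - M \<Longrightarrow> t \<in> N - M \<Longrightarrow> d s = d t"
    and "s \<in> M - N \<Longrightarrow> t \<in> N - M \<Longrightarrow> (s, t) \<notin> arcs_ends Q \<Longrightarrow> d s \<oplus> d t = \<zero>"
proof -
  note r = rel[unfolded satisfies_relations_def Let_def, rule_format]
  note cl = d[OF s] d[OF t]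
  show "s \<in> M - N \<Longrightarrow> t \<in> M - N \<Longrightarrow> d s = d t"
    using r[OF s t, THEN conjunct2, THEN conjunct1] cl by simp
  show "s \<in> N - M \<Longrightarrow> t \<in> N - M \<Longrightarrow> d s = d t"
    using r[OF s t, THEN conjunct2, THEN conjunct1] cl by simp
  show "s \<in> M - N \<Longrightarrow> t \<in> N - M \<Longrightarrow> (s, t) \<notin> arcs_ends Q \<Longrightarrow> d s \<oplus> d t = \<zero>"
    using r[OF t s, THEN conjunct2, THEN conjunct2] cl by (simp add: K.a_comm)
  show "d s = \<zero>" if "s \<in> M \<longleftrightarrow> s \<in> N"
    using r[OF s s, THEN conjunct1] cl that
    by (cases "s \<in> M") (auto simp: K.add.r_cancel_one')
qed

text \<open>Going through the four possible positions of \<open>s\<close> and of \<open>t\<close>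
  relative to \<open>M\<close> and \<open>N\<close>, the only equation that fails is the third one
  for \<open>t\<close> in \<open>M - N\<close> and \<open>s\<close> in \<open>N - M\<close>; for
  these pairs the assumed arrow from \<open>t\<close> to \<open>s\<close> takes the relation
  away.\<close>

lemma satisfies_relations_indicator:
  assumes "\<And>m n. m \<in> M - N \<Longrightarrow> n \<in> N - M \<Longrightarrow> m \<in> V \<Longrightarrow> n \<in> V \<Longrightarrow> (m, n) \<in> arcs_ends Q"
  shows "satisfies_relations K Q N M (\<lambda>t. if t \<in> M - N then \<one> else \<zero>)"
  using assms by (auto simp: satisfies_relations_def)

end


section \<open>Simple modules\<close>

context left_module
begin

lemma smult_r_null [simp]: "a \<in> carrier R \<Longrightarrow> a \<odot>\<^bsub>M\<^esub> \<zero>\<^bsub>M\<^esub> = \<zero>\<^bsub>M\<^esub>"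
  using smult_r_distr[of a "\<zero>\<^bsub>M\<^esub>" "\<zero>\<^bsub>M\<^esub>"] smult_closed[of a "\<zero>\<^bsub>M\<^esub>"]
  by (simp add: M.add.r_cancel_one')

lemma smult_l_null [simp]: "x \<in> carrier M \<Longrightarrow> \<zero>\<^bsub>R\<^esub> \<odot>\<^bsub>M\<^esub> x = \<zero>\<^bsub>M\<^esub>"
  using smult_l_distr[of "\<zero>\<^bsub>R\<^esub>" "\<zero>\<^bsub>R\<^esub>" x] smult_closed[of "\<zero>\<^bsub>R\<^esub>" x]
  by (simp add: M.add.r_cancel_one')

lemma smult_l_minus:
  assumes "a \<in> carrier R" "x \<in> carrier M"
  shows "(\<ominus>\<^bsub>R\<^esub> a) \<odot>\<^bsub>M\<^esub> x = \<ominus>\<^bsub>M\<^esub> (a \<odot>\<^bsub>M\<^esub> x)"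
  using assms smult_l_distr[of "\<ominus>\<^bsub>R\<^esub> a" a x]
  by (intro M.minus_equality[symmetric]) (auto simp: R.l_neg smult_closed)

lemma smult_r_minus:
  assumes "a \<in> carrier R" "x \<in> carrier M"
  shows "a \<odot>\<^bsub>M\<^esub> (\<ominus>\<^bsub>M\<^esub> x) = \<ominus>\<^bsub>M\<^esub> (a \<odot>\<^bsub>M\<^esub> x)"
  using assms smult_r_distr[of a "\<ominus>\<^bsub>M\<^esub> x" x]
  by (intro M.minus_equality[symmetric]) (auto simp: M.l_neg smult_closed)

lemma left_submoduleI:
  assumes sub: "H \<subseteq> carrier M" and zero: "\<zero>\<^bsub>M\<^esub> \<in> H"
    and add: "\<And>x y. x \<in> H \<Longrightarrow> y \<in> H \<Longrightarrow> x \<oplus>\<^bsub>M\<^esub> y \<in> H"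
    and smult: "\<And>a x. a \<in> carrier R \<Longrightarrow> x \<in> H \<Longrightarrow> a \<odot>\<^bsub>M\<^esub> x \<in> H"
  shows "Module.submodule H R M"
proof (intro Module.submodule.intro submodule_axioms.intro smult)
  show "subgroup H (add_monoid M)"
  proof (rule M.add.subgroupI)
    fix x assume x: "x \<in> H"
    then have "(\<ominus>\<^bsub>R\<^esub> \<one>\<^bsub>R\<^esub>) \<odot>\<^bsub>M\<^esub> x \<in> H" by (intro smult) auto
    then show "\<ominus>\<^bsub>M\<^esub> x \<in> H" using x sub by (auto simp: smult_l_minus smult_one)
  qed (use sub zero add in auto)
qed

lemma module_hom_zero:
  assumes "f \<in> LinearCombinations.module_hom R M N" "left_module R N"
  shows "f \<zero>\<^bsub>M\<^esub> = \<zero>\<^bsub>N\<^esub>"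
proof -
  interpret N: left_module R N by fact
  have "f \<zero>\<^bsub>M\<^esub> \<in> carrier N" "f (\<zero>\<^bsub>M\<^esub> \<oplus>\<^bsub>M\<^esub> \<zero>\<^bsub>M\<^esub>) = f \<zero>\<^bsub>M\<^esub> \<oplus>\<^bsub>N\<^esub> f \<zero>\<^bsub>M\<^esub>"
    using assms M.zero_closed by (auto simp: LinearCombinations.module_hom_def simp del: M.r_zero M.l_zero)
  then show ?thesis by (simp add: N.M.add.r_cancel_one')
qed

end

lemma left_module_iso_sym:
  assumes M: "left_module R M" and iso: "left_module_iso R M N"
  shows "left_module_iso R N M"
proof -
  interpret M: left_module R M by fact
  obtain f where f: "f \<in> LinearCombinations.module_hom R M N" "bij_betw f (carrier M) (carrier N)"
    using iso unfolding left_module_iso_def by blast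
  let ?g = "inv_into (carrier M) f"
  have g: "bij_betw ?g (carrier N) (carrier M)" using f(2) by (rule bij_betw_inv_into)
  then have cl: "y \<in> carrier N \<Longrightarrow> ?g y \<in> carrier M" for y by (auto simp: bij_betw_def)
  have fg: "y \<in> carrier N \<Longrightarrow> f (?g y) = y" for y using f(2) by (simp add: bij_betw_inv_into_right)
  have gf: "x \<in> carrier M \<Longrightarrow> ?g (f x) = x" for x using f(2) by (simp add: bij_betw_inv_into_left)
  have "?g \<in> LinearCombinations.module_hom R N M"
    unfolding LinearCombinations.module_hom_def
  proof (intro CollectI conjI allI impI)
    fix x y assume xy: "x \<in> carrier N \<and> y \<in> carrier N"
    then have "f (?g x \<oplus>\<^bsub>M\<^esub> ?g y) = x \<oplus>\<^bsub>N\<^esub> y" using f(1) cl fg by (simp add: LinearCombinations.module_hom_add)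
    then show "?g (x \<oplus>\<^bsub>N\<^esub> y) = ?g x \<oplus>\<^bsub>M\<^esub> ?g y"
      using gf[of "?g x \<oplus>\<^bsub>M\<^esub> ?g y"] cl xy by simp
  next
    fix a x assume ax: "a \<in> carrier R \<and> x \<in> carrier N"
    then have "f (a \<odot>\<^bsub>M\<^esub> ?g x) = a \<odot>\<^bsub>N\<^esub> x" using f(1) cl fg by (simp add: LinearCombinations.module_hom_smult)
    then show "?g (a \<odot>\<^bsub>N\<^esub> x) = a \<odot>\<^bsub>M\<^esub> ?g x"
      using gf[of "a \<odot>\<^bsub>M\<^esub> ?g x"] cl ax M.smult_closed by simp
  qed (use cl in auto)
  then show ?thesis using g unfolding left_module_iso_def by blast
qed

lemma left_module_iso_trans:
  assumes "left_module_iso R M N" "left_module_iso R N P"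
  shows "left_module_iso R M P"
proof -
  obtain f g where f: "f \<in> LinearCombinations.module_hom R M N" "bij_betw f (carrier M) (carrier N)"
    and g: "g \<in> LinearCombinations.module_hom R N P" "bij_betw g (carrier N) (carrier P)"
    using assms unfolding left_module_iso_def by blast
  have "g \<circ> f \<in> LinearCombinations.module_hom R M P"
    using f(1) g(1) by (auto simp: LinearCombinations.module_hom_def Pi_iff)
  moreover have "bij_betw (g \<circ> f) (carrier M) (carrier P)" using f(2) g(2) by (rule bij_betw_trans)
  ultimately show ?thesis unfolding left_module_iso_def by blast
qed

lemma left_module_iso_refl: "left_module_iso R M M"
  unfolding left_module_iso_def
  by (rule bexI[where x = "\<lambda>x. x"]) (auto simp: LinearCombinations.module_hom_def bij_betw_def)

text \<open>The preimage of a submodule of \<open>N\<close> is a submodule of \<open>M\<close>,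
  hence zero or everything.\<close>

lemma simple_left_module_iso:
  assumes simple: "simple_left_module R M" and N: "left_module R N" and iso: "left_module_iso R M N"
  shows "simple_left_module R N"
proof -
  interpret M: left_module R M using simple by (simp add: simple_left_module_def)
  interpret N: left_module R N by fact
  obtain f where f: "f \<in> LinearCombinations.module_hom R M N" "bij_betw f (carrier M) (carrier N)"
    using iso unfolding left_module_iso_def by blast
  have f0: "f \<zero>\<^bsub>M\<^esub> = \<zero>\<^bsub>N\<^esub>" by (rule M.module_hom_zero[OF f(1) N])
  have img: "f ` carrier M = carrier N" and inj: "inj_on f (carrier M)"
    using f(2) by (auto simp: bij_betw_def)
  have "carrier N \<noteq> {\<zero>\<^bsub>N\<^esub>}"
  proof
    assume eq: "carrier N = {\<zero>\<^bsub>N\<^esub>}"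
    have "x = \<zero>\<^bsub>M\<^esub>" if "x \<in> carrier M" for x
      using that img eq f0 inj_onD[OF inj, of x "\<zero>\<^bsub>M\<^esub>"] by auto
    then show False using simple M.M.zero_closed unfolding simple_left_module_def by blast
  qed
  moreover have "H = {\<zero>\<^bsub>N\<^esub>} \<or> H = carrier N" if H: "Module.submodule H R N" for H
  proof -
    interpret H: Module.submodule H R N by fact
    let ?G = "{x \<in> carrier M. f x \<in> H}"
    have fG: "f ` ?G = H" using img H.subset by auto
    have "Module.submodule ?G R M"
      using f(1) f0 H.one_closed H.m_closed
      by (intro M.left_submoduleI) (auto simp: LinearCombinations.module_hom_add LinearCombinations.module_hom_smult M.smult_closed)
    then have "?G = {\<zero>\<^bsub>M\<^esub>} \<or> ?G = carrier M" using simple by (auto simp: simple_left_module_def)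
    then show ?thesis
    proof
      assume "?G = {\<zero>\<^bsub>M\<^esub>}"
      then show ?thesis using fG f0 by auto
    next
      assume "?G = carrier M"
      then show ?thesis using fG img by auto
    qed
  qed
  ultimately show ?thesis using N by (simp add: simple_left_module_def)
qed

text \<open>Produces a copy of a module on another type. It is used to realize
  \<open>E_module\<close>, which lives on the field, as a module on the type of the vertices of the
  Gabriel quiver.\<close>

lemma left_module_transport:
  fixes \<phi> :: "'m \<Rightarrow> 'n" and M :: "('a, 'm, 'y) module_scheme"
  assumes M: "left_module R M" and inj: "inj_on \<phi> (carrier M)"
  obtains N :: "('a, 'n) module" where "left_module R N" "left_module_iso R M N"
proof -
  interpret M: left_module R M by fact
  let ?i = "inv_into (carrier M) \<phi>"
  define N :: "('a, 'n) module" where "N = \<lparr>carrier = \<phi> ` carrier M, mult = (\<lambda>x y. \<phi> \<zero>\<^bsub>M\<^esub>),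
      one = \<phi> \<zero>\<^bsub>M\<^esub>, zero = \<phi> \<zero>\<^bsub>M\<^esub>, add = (\<lambda>x y. \<phi> (?i x \<oplus>\<^bsub>M\<^esub> ?i y)),
      smult = (\<lambda>a x. \<phi> (a \<odot>\<^bsub>M\<^esub> ?i x))\<rparr>"
  have N: "carrier N = \<phi> ` carrier M" "zero N = \<phi> \<zero>\<^bsub>M\<^esub>"
    "x \<in> carrier M \<Longrightarrow> y \<in> carrier M \<Longrightarrow> \<phi> x \<oplus>\<^bsub>N\<^esub> \<phi> y = \<phi> (x \<oplus>\<^bsub>M\<^esub> y)"
    "x \<in> carrier M \<Longrightarrow> a \<odot>\<^bsub>N\<^esub> \<phi> x = \<phi> (a \<odot>\<^bsub>M\<^esub> x)" for x y a
    by (simp_all add: N_def inj)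
  have "abelian_group N"
  proof (rule abelian_groupI)
    fix x assume "x \<in> carrier N"
    then obtain x' where x: "x' \<in> carrier M" "x = \<phi> x'" by (auto simp: N(1))
    show "\<zero>\<^bsub>N\<^esub> \<oplus>\<^bsub>N\<^esub> x = x" using x by (simp add: N)
    have "\<phi> (\<ominus>\<^bsub>M\<^esub> x') \<oplus>\<^bsub>N\<^esub> x = \<zero>\<^bsub>N\<^esub>" using x by (simp add: N M.M.l_neg)
    then show "\<exists>y\<in>carrier N. y \<oplus>\<^bsub>N\<^esub> x = \<zero>\<^bsub>N\<^esub>" using x(1) by (auto simp: N(1))
    fix y assume "y \<in> carrier N"
    then obtain y' where y: "y' \<in> carrier M" "y = \<phi> y'" by (auto simp: N(1))
    show "x \<oplus>\<^bsub>N\<^esub> y \<in> carrier N" using x y by (simp add: N)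
    show "x \<oplus>\<^bsub>N\<^esub> y = y \<oplus>\<^bsub>N\<^esub> x" using x y by (simp add: N M.M.a_comm)
    fix z assume "z \<in> carrier N"
    then obtain z' where z: "z' \<in> carrier M" "z = \<phi> z'" by (auto simp: N(1))
    show "x \<oplus>\<^bsub>N\<^esub> y \<oplus>\<^bsub>N\<^esub> z = x \<oplus>\<^bsub>N\<^esub> (y \<oplus>\<^bsub>N\<^esub> z)" using x y z by (simp add: N M.M.a_assoc)
  qed (simp add: N)
  then have "left_module R N"
    using M.R.ring_axioms
    by (intro left_module.intro left_module_axioms.intro)
      (auto simp: N M.smult_closed M.smult_l_distr M.smult_r_distr M.smult_assoc1 M.smult_one)
  moreover have "left_module_iso R M N"
    unfolding left_module_iso_def using inj
    by (intro bexI[where x = \<phi>]) (auto simp: LinearCombinations.module_hom_def N bij_betw_def)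
  ultimately show ?thesis by (rule that)
qed

text \<open>\<open>S\<close> lives on the type of the vertices and thus belongs to its own class, so
  equality of classes yields an isomorphism. \<open>T\<close> may live elsewhere, for instance be an
  \<open>E_module\<close>.\<close>

lemma iso_class_eq_iff:
  fixes S :: "('a, 'a set) module"
  assumes S: "simple_left_module A S"
  shows "iso_class A S = iso_class A T \<longleftrightarrow> left_module_iso A S T"
proof
  assume "iso_class A S = iso_class A T"
  moreover have "S \<in> iso_class A S" using S left_module_iso_refl by (auto simp: iso_class_def)
  ultimately show "left_module_iso A S T" by (auto simp: iso_class_def)
next
  assume "left_module_iso A S T"
  moreover from this have "left_module_iso A T S"
    using S left_module_iso_sym by (auto simp: simple_left_module_def)
  ultimately show "iso_class A S = iso_class A T"
    unfolding iso_class_def by (metis (no_types, lifting) left_module_iso_trans)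
qed

lemma E_module_simps [simp]:
  "carrier (E_module K M) = carrier K"
  "zero (E_module K M) = zero K"
  "add (E_module K M) = add K"
  "b \<odot>\<^bsub>E_module K M\<^esub> x = algebra_char K M b \<otimes>\<^bsub>K\<^esub> x"
  by (simp_all add: E_module_def algebra_char_def)

section \<open>Classification of the simple modules\<close>

context quiver_algebra_over
begin

lemma E_module_left_module: "left_module B (E_module K M)"
proof -
  have "abelian_group (E_module K M)"
    by (rule abelian_groupI) (auto simp: K.a_ac intro!: bexI[of _ "\<ominus> _"] K.l_neg)
  then show ?thesis
    using B.ring_axioms
    by (intro left_module.intro left_module_axioms.intro)
      (auto simp: algebra_char_simps K.l_distr K.r_distr K.m_assoc)
qed

text \<open>The scalars \<open>\<iota> c\<close> act as multiplication by \<open>c\<close>, so any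
  nonzero \<open>x\<close> reaches every \<open>y\<close> by means of \<open>y / x\<close>.\<close>

lemma E_module_simple: "simple_left_module B (E_module K M)"
  unfolding simple_left_module_def
proof (intro conjI allI impI)
  show "carrier (E_module K M) \<noteq> {\<zero>\<^bsub>E_module K M\<^esub>}"
    using K.one_not_zero K.one_closed by (simp only: E_module_simps) blast
  fix H assume H: "Module.submodule H B (E_module K M)"
  interpret H: Module.submodule H B "E_module K M" by fact
  have "carrier K \<subseteq> H" if x: "x \<in> H" "x \<noteq> \<zero>" for x
  proof
    fix y assume y: "y \<in> carrier K"
    have xK: "x \<in> carrier K" using x H.subset by auto
    then have xU: "x \<in> Units K" using x by (simp add: K.field_Units)
    have "\<iota> (y \<otimes> inv x) \<odot>\<^bsub>E_module K M\<^esub> x \<in> H"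
      using x y xU by (intro H.smult_closed) auto
    also have "\<iota> (y \<otimes> inv x) \<odot>\<^bsub>E_module K M\<^esub> x = y"
      using xK xU y by (simp add: algebra_char_simps K.m_assoc)
    finally show "y \<in> H" .
  qed
  moreover have "\<zero> \<in> H" using H.one_closed by simp
  ultimately show "H = {\<zero>\<^bsub>E_module K M\<^esub>} \<or> H = carrier (E_module K M)"
    using H.subset by auto
qed (rule E_module_left_module)

lemma E_module_isoE:
  assumes "left_module_iso B S (E_module K M)"
  obtains h where "bij_betw h (carrier S) (carrier K)"
    and "\<And>x. x \<in> carrier S \<Longrightarrow> h x \<in> carrier K"
    and "\<And>x y. x \<in> carrier S \<Longrightarrow> y \<in> carrier S \<Longrightarrow> h (x \<oplus>\<^bsub>S\<^esub> y) = h x \<oplus> h y"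
    and "\<And>b x. b \<in> carrier B \<Longrightarrow> x \<in> carrier S \<Longrightarrow> h (b \<odot>\<^bsub>S\<^esub> x) = algebra_char K M b \<otimes> h x"
  using assms unfolding left_module_iso_def LinearCombinations.module_hom_def by (auto simp: Pi_iff)

text \<open>The action of \<open>X t\<close> on \<open>\<one>\<close> and on its nonzero image
  \<open>h \<one>\<close> reveals whether \<open>t\<close> lies in \<open>M\<close> and in
  \<open>N\<close>, and \<open>h\<close> intertwines the two actions.\<close>

lemma E_module_iso_unique:
  assumes iso: "left_module_iso B (E_module K M) (E_module K N)" and "M \<subseteq> V" "N \<subseteq> V"
  shows "M = N"
proof -
  obtain h where h: "bij_betw h (carrier K) (carrier K)"
    and cl: "\<And>x. x \<in> carrier K \<Longrightarrow> h x \<in> carrier K"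
    and add: "\<And>x y. x \<in> carrier K \<Longrightarrow> y \<in> carrier K \<Longrightarrow> h (x \<oplus> y) = h x \<oplus> h y"
    and smult: "\<And>b x. b \<in> carrier B \<Longrightarrow> x \<in> carrier K \<Longrightarrow>
      h (algebra_char K M b \<otimes> x) = algebra_char K N b \<otimes> h x"
    using iso by (rule E_module_isoE) auto
  have h0: "h \<zero> = \<zero>" using add[of \<zero> \<zero>] cl[of \<zero>] by (simp add: K.add.r_cancel_one')
  have h1: "h \<one> \<noteq> \<zero>"
    using h h0 K.one_not_zero inj_onD[of h "carrier K" \<one> \<zero>] by (auto simp: bij_betw_def)
  have "t \<in> M \<longleftrightarrow> t \<in> N" if "t \<in> V" for t
    using smult[of "X t" \<one>] that h0 h1 cl[of \<one>] by (auto simp: algebra_char_simps split: if_splits)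
  then show ?thesis using assms(2,3) by blast
qed

lemma acyclic_arcs_ends:
  assumes "acyclic_quiver Q"
  shows "acyclic (arcs_ends Q)"
proof (rule acyclicI, rule allI, rule notI)
  fix u assume "(u, u) \<in> (arcs_ends Q)\<^sup>+"
  then obtain p where "awalk u p u" "p \<noteq> []" using reachable1_awalk by blast
  then have "closed_w p" unfolding closed_w_def by blast
  then show False using closed_w_imp_cycle assms unfolding acyclic_quiver_def by blast
qed

lemma finite_arcs_ends: "finite (arcs_ends Q)"
  unfolding arcs_ends_def by simp

text \<open>If \<open>q\<close> has no arrow into the set of vertices not known to act by scalars, then the image
  of \<open>X_q\<close> is a submodule, so by simplicity \<open>X_q\<close> acts as \<open>0\<close> or \<open>1\<close>.\<close>

lemma generator_acts_by_scalar:
  assumes simple: "simple_left_module B S" and acyclic: "acyclic_quiver Q" and t: "t \<in> V"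
  shows "(\<forall>x\<in>carrier S. X t \<odot>\<^bsub>S\<^esub> x = x) \<or> (\<forall>x\<in>carrier S. X t \<odot>\<^bsub>S\<^esub> x = \<zero>\<^bsub>S\<^esub>)"
proof (rule ccontr)
  interpret S: left_module B S using simple by (simp add: simple_left_module_def)
  let ?scalar = "\<lambda>t. (\<forall>x\<in>carrier S. X t \<odot>\<^bsub>S\<^esub> x = x) \<or> (\<forall>x\<in>carrier S. X t \<odot>\<^bsub>S\<^esub> x = \<zero>\<^bsub>S\<^esub>)"
  define U where "U = {t \<in> V. \<not> ?scalar t}"
  assume "\<not> ?scalar t"
  then have tU: "t \<in> U" using t by (simp add: U_def)
  \<comment> \<open>A finite acyclic relation has a well-founded converse, so \<open>U\<close>
    contains some \<open>q\<close> without an arrow into \<open>U\<close>, a sink of the quiver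
    induced on \<open>U\<close>.\<close>
  have "wf ((arcs_ends Q)\<inverse>)"
    using finite_arcs_ends acyclic_arcs_ends[OF acyclic] by (rule finite_acyclic_wf_converse)
  then obtain q where q: "q \<in> U" and sink: "\<And>s. s \<in> U \<Longrightarrow> (q, s) \<notin> arcs_ends Q"
    using tU unfolding wf_eq_minimal by (metis converse_iff)
  have qV: "q \<in> V" using q by (simp add: U_def)
  define H where "H = (\<lambda>x. X q \<odot>\<^bsub>S\<^esub> x) ` carrier S"
  have H_I: "X q \<odot>\<^bsub>S\<^esub> x \<in> H" if "x \<in> carrier S" for x using that by (simp add: H_def)
  have H_sub: "H \<subseteq> carrier S" using qV by (auto simp: H_def S.smult_closed)
  have H_add: "x \<oplus>\<^bsub>S\<^esub> y \<in> H" if xy: "x \<in> H" "y \<in> H" for x y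
  proof -
    obtain x' y' where "x' \<in> carrier S" "y' \<in> carrier S" "x = X q \<odot>\<^bsub>S\<^esub> x'" "y = X q \<odot>\<^bsub>S\<^esub> y'"
      using xy by (auto simp: H_def)
    then show ?thesis unfolding H_def using qV
      by (intro image_eqI[where x = "x' \<oplus>\<^bsub>S\<^esub> y'"]) (auto simp: S.smult_r_distr)
  qed
  have H_zero: "\<zero>\<^bsub>S\<^esub> \<in> H"
    unfolding H_def using qV by (intro image_eqI[where x = "\<zero>\<^bsub>S\<^esub>"]) auto
  have H_smult: "\<forall>y\<in>H. b \<odot>\<^bsub>S\<^esub> y \<in> H" if "b \<in> carrier B" for b
    using that
  proof (induction rule: B_induct)
    case (scalar c)
    show ?case
    proof
      fix y assume "y \<in> H"
      then obtain x where x: "x \<in> carrier S" "y = X q \<odot>\<^bsub>S\<^esub> x" by (auto simp: H_def)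
      then have "\<iota> c \<odot>\<^bsub>S\<^esub> y = X q \<odot>\<^bsub>S\<^esub> (\<iota> c \<odot>\<^bsub>S\<^esub> x)"
        using qV scalar iota_central by (simp add: S.smult_assoc1[symmetric])
      then show "\<iota> c \<odot>\<^bsub>S\<^esub> y \<in> H" using x scalar by (simp add: S.smult_closed H_I)
    qed
  next
    case (generator s)
    show ?case
    proof
      fix y assume y: "y \<in> H"
      then obtain x where x: "x \<in> carrier S" "y = X q \<odot>\<^bsub>S\<^esub> x" by (auto simp: H_def)
      have yS: "y \<in> carrier S" using y H_sub by blast
      show "X s \<odot>\<^bsub>S\<^esub> y \<in> H"
      proof (cases "s \<in> U")
        case True
        \<comment> \<open>No arrow leads from \<open>q\<close> to \<open>s\<close>, so
          \<open>X s * X q = X q * X s * X q\<close>, which displays the vector as an image under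
          \<open>X q\<close>.\<close>
        have "X s \<odot>\<^bsub>S\<^esub> y = (X q \<otimes>\<^bsub>B\<^esub> X s \<otimes>\<^bsub>B\<^esub> X q) \<odot>\<^bsub>S\<^esub> x"
          using x qV generator generator_relations(3)[OF generator qV sink[OF True]]
          by (simp add: S.smult_assoc1)
        also have "\<dots> = X q \<odot>\<^bsub>S\<^esub> (X s \<odot>\<^bsub>S\<^esub> y)"
          using x qV generator by (simp add: S.smult_assoc1 S.smult_closed)
        also have "\<dots> \<in> H" using yS generator by (intro H_I S.smult_closed) auto
        finally show ?thesis .
      next
        case False
        then have "?scalar s" using generator by (simp add: U_def)
        then have "X s \<odot>\<^bsub>S\<^esub> y = y \<or> X s \<odot>\<^bsub>S\<^esub> y = \<zero>\<^bsub>S\<^esub>" using yS by auto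
        then show ?thesis using y H_zero by auto
      qed
    qed
  next
    case (add a b)
    then show ?case using H_add H_sub by (auto simp: S.smult_l_distr subset_iff)
  next
    case (mult a b)
    then show ?case using H_sub by (auto simp: S.smult_assoc1 subset_iff)
  qed
  have "Module.submodule H B S"
    using H_sub H_zero H_add H_smult by (intro S.left_submoduleI) auto
  then have "H = {\<zero>\<^bsub>S\<^esub>} \<or> H = carrier S" using simple by (auto simp: simple_left_module_def)
  then have "?scalar q"
  proof
    assume "H = {\<zero>\<^bsub>S\<^esub>}"
    then show ?thesis unfolding H_def by blast
  next
    assume H: "H = carrier S"
    \<comment> \<open>\<open>X q\<close> is idempotent and hence the identity on its image, which is
      all of \<open>S\<close> here.\<close>
    have "X q \<odot>\<^bsub>S\<^esub> x = x" if "x \<in> carrier S" for x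
    proof -
      obtain y where "y \<in> carrier S" "x = X q \<odot>\<^bsub>S\<^esub> y" using \<open>x \<in> carrier S\<close> H by (auto simp: H_def)
      then show ?thesis using qV generator_relations(1)[of q q]
        by (simp add: S.smult_assoc1[symmetric])
    qed
    then show ?thesis by blast
  qed
  then show False using q unfolding U_def by blast
qed

text \<open>Once the generators act as 0 or 1, every \<open>b\<close> acts as the scalar
  \<open>\<iota> (algebra_char K M b)\<close>. The line through any nonzero \<open>v\<close> is then
  a submodule, hence all of \<open>S\<close>, and \<open>c \<mapsto> c v\<close> is the
  isomorphism.\<close>

lemma simple_iso_E_module:
  assumes simple: "simple_left_module B S" and acyclic: "acyclic_quiver Q"
  obtains M where "M \<subseteq> V" "left_module_iso B S (E_module K M)"
proof -
  interpret S: left_module B S using simple by (simp add: simple_left_module_def)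
  define M where "M = {t \<in> V. \<forall>x\<in>carrier S. X t \<odot>\<^bsub>S\<^esub> x = x}"
  have act: "\<forall>x\<in>carrier S. b \<odot>\<^bsub>S\<^esub> x = \<iota> (algebra_char K M b) \<odot>\<^bsub>S\<^esub> x" if "b \<in> carrier B" for b
    using that
  proof (induction rule: B_induct)
    case (scalar c)
    then show ?case by (simp add: algebra_char_simps)
  next
    case (generator t)
    then show ?case using generator_acts_by_scalar[OF simple acyclic generator]
      by (auto simp: algebra_char_simps iota_one iota_zero S.smult_one M_def)
  next
    case (add a b)
    then show ?case by (simp add: algebra_char_simps iota_add S.smult_l_distr)
  next
    case (mult a b)
    then show ?case
      by (simp add: algebra_char_simps iota_mult S.smult_assoc1 S.smult_closed)
  qed
  obtain v where v: "v \<in> carrier S" "v \<noteq> \<zero>\<^bsub>S\<^esub>"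
    using simple S.M.zero_closed unfolding simple_left_module_def by blast
  define g where "g c = \<iota> c \<odot>\<^bsub>S\<^esub> v" for c
  have g_add: "g (c \<oplus> e) = g c \<oplus>\<^bsub>S\<^esub> g e" if "c \<in> carrier K" "e \<in> carrier K" for c e
    using that v by (simp add: g_def iota_add S.smult_l_distr)
  have g_smult: "g (algebra_char K M b \<otimes> c) = b \<odot>\<^bsub>S\<^esub> g c" if "b \<in> carrier B" "c \<in> carrier K" for b c
    using that v act[of b]
    by (simp add: g_def iota_mult S.smult_assoc1 algebra_char_simps S.smult_closed)
  have g_closed: "g c \<in> carrier S" if "c \<in> carrier K" for c
    using that v by (simp add: g_def S.smult_closed)
  have g_zero: "g \<zero> = \<zero>\<^bsub>S\<^esub>" using v by (simp add: g_def iota_zero)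
  have g_one: "g \<one> = v" using v by (simp add: g_def iota_one S.smult_one)
  have "Module.submodule (g ` carrier K) B S"
  proof (rule S.left_submoduleI)
    show "\<zero>\<^bsub>S\<^esub> \<in> g ` carrier K" using g_zero by (metis K.zero_closed image_eqI)
    show "x \<oplus>\<^bsub>S\<^esub> y \<in> g ` carrier K" if "x \<in> g ` carrier K" "y \<in> g ` carrier K" for x y
      using that g_add by (auto simp: image_iff) (metis K.a_closed)
    show "a \<odot>\<^bsub>S\<^esub> x \<in> g ` carrier K" if "a \<in> carrier B" "x \<in> g ` carrier K" for a x
      using that g_smult algebra_char_simps(1)[of a M] by (auto simp: image_iff) (metis K.m_closed)
  qed (use g_closed in auto)
  moreover have "v \<in> g ` carrier K" using g_one by (metis K.one_closed image_eqI)
  ultimately have img: "g ` carrier K = carrier S"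
    using simple v unfolding simple_left_module_def by blast
  have "inj_on g (carrier K)"
  proof (rule inj_onI, rule ccontr)
    fix c e assume ce: "c \<in> carrier K" "e \<in> carrier K" "g c = g e" "c \<noteq> e"
    let ?z = "c \<ominus> e"
    have z: "?z \<in> Units K" using ce by (simp add: K.field_Units)
    have "g c = g (?z \<oplus> e)"
    proof -
      have "c = ?z \<oplus> e" using ce by algebra
      then show ?thesis by simp
    qed
    also have "\<dots> = g ?z \<oplus>\<^bsub>S\<^esub> g e" using ce by (simp add: g_add)
    finally have "g ?z = \<zero>\<^bsub>S\<^esub>" using ce g_closed by (simp add: S.M.add.l_cancel_one')
    then have "\<iota> (inv ?z) \<odot>\<^bsub>S\<^esub> g ?z = \<zero>\<^bsub>S\<^esub>" using z by simp
    moreover have "\<iota> (inv ?z) \<odot>\<^bsub>S\<^esub> g ?z = v"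
      using z v K.Units_closed[OF z] g_smult[of "\<iota> (inv ?z)" ?z, symmetric] g_one
      by (simp add: algebra_char_simps)
    ultimately show False using v by simp
  qed
  then have "left_module_iso B (E_module K M) S"
    unfolding left_module_iso_def using img g_add g_smult g_closed
    by (intro bexI[where x = g]) (auto simp: LinearCombinations.module_hom_def bij_betw_def)
  then have "left_module_iso B S (E_module K M)"
    by (rule left_module_iso_sym[OF E_module_left_module])
  moreover have "M \<subseteq> V" by (auto simp: M_def)
  ultimately show ?thesis using that by blast
qed

end


section \<open>Extensions of simple modules\<close>

lemma additive_finsum:
  assumes "abelian_monoid G" "abelian_monoid H"
    and "\<phi> \<in> carrier G \<rightarrow> carrier H" "\<phi> \<zero>\<^bsub>G\<^esub> = \<zero>\<^bsub>H\<^esub>"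
    and "\<And>x y. x \<in> carrier G \<Longrightarrow> y \<in> carrier G \<Longrightarrow> \<phi> (x \<oplus>\<^bsub>G\<^esub> y) = \<phi> x \<oplus>\<^bsub>H\<^esub> \<phi> y"
    and "finite A" "g \<in> A \<rightarrow> carrier G"
  shows "\<phi> (\<Oplus>\<^bsub>G\<^esub>s\<in>A. g s) = (\<Oplus>\<^bsub>H\<^esub>s\<in>A. \<phi> (g s))"
proof -
  interpret G: abelian_monoid G by fact
  interpret H: abelian_monoid H by fact
  show ?thesis
    using assms(6,7)
  proof (induction A rule: finite_induct)
    case (insert a A)
    moreover from this have "g \<in> A \<rightarrow> carrier G" "(\<lambda>s. \<phi> (g s)) \<in> A \<rightarrow> carrier H"
      "g a \<in> carrier G" "\<phi> (g a) \<in> carrier H"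
      using assms(3) by auto
    ultimately show ?case using assms(5) by (simp add: G.finsum_closed)
  qed (simp add: assms(4))
qed

text \<open>The injection \<open>\<Lambda>\<close> into the field pulls back all vector space
  axioms, so \<open>V\<close> enters only as a record with closed operations. If \<open>v\<close> is
  nonzero, then \<open>x\<close> and \<open>(\<Lambda> x / \<Lambda> v) v\<close> have the same
  image, so \<open>v\<close> alone generates.\<close>

lemma vs_dim_of_embedding:
  fixes K :: "('k, 'w) ring_scheme" and V :: "('k, 'v, 'y) module_scheme"
  assumes K: "field K"
    and zero: "\<zero>\<^bsub>V\<^esub> \<in> carrier V"
    and add: "\<And>x y. x \<in> carrier V \<Longrightarrow> y \<in> carrier V \<Longrightarrow> x \<oplus>\<^bsub>V\<^esub> y \<in> carrier V"
    and smult: "\<And>c x. c \<in> carrier K \<Longrightarrow> x \<in> carrier V \<Longrightarrow> c \<odot>\<^bsub>V\<^esub> x \<in> carrier V"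
    and inj: "inj_on \<Lambda> (carrier V)" and cl: "\<And>x. x \<in> carrier V \<Longrightarrow> \<Lambda> x \<in> carrier K"
    and \<Lambda>_zero: "\<Lambda> \<zero>\<^bsub>V\<^esub> = \<zero>\<^bsub>K\<^esub>"
    and \<Lambda>_add: "\<And>x y. x \<in> carrier V \<Longrightarrow> y \<in> carrier V \<Longrightarrow> \<Lambda> (x \<oplus>\<^bsub>V\<^esub> y) = \<Lambda> x \<oplus>\<^bsub>K\<^esub> \<Lambda> y"
    and \<Lambda>_smult: "\<And>c x. c \<in> carrier K \<Longrightarrow> x \<in> carrier V \<Longrightarrow> \<Lambda> (c \<odot>\<^bsub>V\<^esub> x) = c \<otimes>\<^bsub>K\<^esub> \<Lambda> x"
  shows "vs_dim K V = (if carrier V = {\<zero>\<^bsub>V\<^esub>} then 0 else 1)"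
proof -
  interpret K: field K by fact
  note eqI = inj_onD[OF inj]
  note simps = zero add smult cl \<Lambda>_zero \<Lambda>_add \<Lambda>_smult
  have "abelian_group V"
  proof (rule abelian_groupI)
    fix x assume x: "x \<in> carrier V"
    have "(\<ominus>\<^bsub>K\<^esub> \<one>\<^bsub>K\<^esub>) \<odot>\<^bsub>V\<^esub> x \<oplus>\<^bsub>V\<^esub> x = \<zero>\<^bsub>V\<^esub>"
      using x by (intro eqI) (auto simp: simps K.l_minus K.l_neg)
    then show "\<exists>y\<in>carrier V. y \<oplus>\<^bsub>V\<^esub> x = \<zero>\<^bsub>V\<^esub>" using x smult K.a_inv_closed K.one_closed by blast
  qed (auto intro!: eqI simp: simps K.a_ac)
  then interpret V: vectorspace K V
    by (intro vectorspace.intro moduleI)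
      (auto intro!: eqI simp: simps K.is_cring K.field_axioms K.l_distr K.r_distr K.m_assoc)
  have span_empty: "V.span {} = {\<zero>\<^bsub>V\<^esub>}" by (auto simp: V.span_def V.lincomb_def)
  show ?thesis
  proof (cases "carrier V = {\<zero>\<^bsub>V\<^esub>}")
    case True
    then have gen: "V.gen_set {}" using span_empty by simp
    then have "V.fin_dim" unfolding V.fin_dim_def by blast
    moreover have "V.dim = 0"
      unfolding V.dim_def by (rule Least_equality) (use gen in \<open>auto intro!: exI[of _ "{}"]\<close>)
    ultimately show ?thesis using True by (simp add: vs_dim_def zero_enat_def)
  next
    case False
    then obtain v where v: "v \<in> carrier V" "v \<noteq> \<zero>\<^bsub>V\<^esub>" using zero by blast
    then have "\<Lambda> v \<noteq> \<zero>\<^bsub>K\<^esub>" using eqI[of v "\<zero>\<^bsub>V\<^esub>"] zero \<Lambda>_zero by auto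
    then have vU: "\<Lambda> v \<in> Units K" using v cl by (simp add: K.field_Units)
    have span: "LinearCombinations.submodule K (V.span {v}) V" "v \<in> V.span {v}"
      using v V.span_is_submodule V.in_own_span[of "{v}"] by auto
    have "x \<in> V.span {v}" if x: "x \<in> carrier V" for x
    proof -
      have "x = (\<Lambda> x \<otimes>\<^bsub>K\<^esub> inv\<^bsub>K\<^esub> \<Lambda> v) \<odot>\<^bsub>V\<^esub> v"
        using x v vU by (intro eqI) (auto simp: simps K.m_assoc)
      then show ?thesis
        using x v vU cl span LinearCombinations.submodule.smult_closed[OF span(1)] 
        by (metis K.Units_inv_closed K.m_closed)
    qed
    then have gen: "V.gen_set {v}" using V.span_is_subset2[of "{v}"] v by blast
    have "V.fin_dim" unfolding V.fin_dim_def using gen v by (intro exI[of _ "{v}"]) auto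
    moreover have "V.dim = 1"
      unfolding V.dim_def
    proof (rule Least_equality)
      show "\<exists>A. finite A \<and> card A = 1 \<and> A \<subseteq> carrier V \<and> V.gen_set A"
        using gen v by (intro exI[of _ "{v}"]) auto
      fix n assume "\<exists>A. finite A \<and> card A = n \<and> A \<subseteq> carrier V \<and> V.gen_set A"
      then obtain A where "finite A" "card A = n" "V.gen_set A" by blast
      then show "1 \<le> n" using span_empty False by (cases "A = {}") (auto simp: Suc_le_eq card_gt_0_iff)
    qed
    ultimately show ?thesis using False by (simp add: vs_dim_def one_enat_def)
  qed
qed

text \<open>The cosets of the kernel of a linear functional are its level sets.\<close>

lemma vs_dim_quotient_kernel:
  fixes K :: "('k, 'w) ring_scheme" and H :: "('k, 'v, 'y) module_scheme"
  assumes K: "field K" and H: "abelian_group H"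
    and smult: "\<And>c x. c \<in> carrier K \<Longrightarrow> x \<in> carrier H \<Longrightarrow> c \<odot>\<^bsub>H\<^esub> x \<in> carrier H"
    and cl: "\<And>x. x \<in> carrier H \<Longrightarrow> \<mu> x \<in> carrier K"
    and \<mu>_add: "\<And>x y. x \<in> carrier H \<Longrightarrow> y \<in> carrier H \<Longrightarrow> \<mu> (x \<oplus>\<^bsub>H\<^esub> y) = \<mu> x \<oplus>\<^bsub>K\<^esub> \<mu> y"
    and \<mu>_smult: "\<And>c x. c \<in> carrier K \<Longrightarrow> x \<in> carrier H \<Longrightarrow> \<mu> (c \<odot>\<^bsub>H\<^esub> x) = c \<otimes>\<^bsub>K\<^esub> \<mu> x"
    and N: "N = {x \<in> carrier H. \<mu> x = \<zero>\<^bsub>K\<^esub>}"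
  shows "vs_dim K (quotient H N) = (if \<forall>x\<in>carrier H. \<mu> x = \<zero>\<^bsub>K\<^esub> then 0 else 1)"
proof -
  interpret K: field K by fact
  interpret H: abelian_group H by fact
  have \<mu>0: "\<mu> \<zero>\<^bsub>H\<^esub> = \<zero>\<^bsub>K\<^esub>" using \<mu>_add[of "\<zero>\<^bsub>H\<^esub>" "\<zero>\<^bsub>H\<^esub>"] cl[of "\<zero>\<^bsub>H\<^esub>"]
    by (simp add: K.add.r_cancel_one')
  have \<mu>_neg: "\<mu> (\<ominus>\<^bsub>H\<^esub> x) = \<ominus>\<^bsub>K\<^esub> \<mu> x" if "x \<in> carrier H" for x
    using that \<mu>_add[of "\<ominus>\<^bsub>H\<^esub> x" x] cl by (simp add: H.l_neg \<mu>0 K.minus_equality)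
  define level where "level c = {x \<in> carrier H. \<mu> x = c}" for c
  have coset: "N +>\<^bsub>H\<^esub> f = level (\<mu> f)" if f: "f \<in> carrier H" for f
  proof (intro Set.set_eqI iffI)
    fix x assume "x \<in> N +>\<^bsub>H\<^esub> f"
    then show "x \<in> level (\<mu> f)" using f cl by (auto simp: a_r_coset_def' N level_def \<mu>_add)
  next
    fix x assume x: "x \<in> level (\<mu> f)"
    then have "x \<ominus>\<^bsub>H\<^esub> f \<in> N" "x = (x \<ominus>\<^bsub>H\<^esub> f) \<oplus>\<^bsub>H\<^esub> f"
      using f cl by (auto simp: N level_def H.minus_eq \<mu>_add \<mu>_neg K.r_neg H.a_assoc H.l_neg)
    then show "x \<in> N +>\<^bsub>H\<^esub> f" unfolding a_r_coset_def' by blast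
  qed
  have level_image: "level (\<mu> f) \<noteq> {} \<and> \<mu> ` level (\<mu> f) = {\<mu> f}" if "f \<in> carrier H" for f
    using that by (auto simp: level_def)
  have carr: "carrier (quotient H N) = (\<lambda>f. level (\<mu> f)) ` carrier H"
    by (auto simp: quotient_simps A_RCOSETS_def' coset)
  have q_zero: "\<zero>\<^bsub>quotient H N\<^esub> = level \<zero>\<^bsub>K\<^esub>" by (simp add: quotient_simps N level_def)
  have q_add: "level (\<mu> f) \<oplus>\<^bsub>quotient H N\<^esub> level (\<mu> g) = level (\<mu> (f \<oplus>\<^bsub>H\<^esub> g))"
    if f: "f \<in> carrier H" and g: "g \<in> carrier H" for f g
  proof (intro Set.set_eqI iffI)
    fix x assume "x \<in> level (\<mu> f) \<oplus>\<^bsub>quotient H N\<^esub> level (\<mu> g)"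
    then show "x \<in> level (\<mu> (f \<oplus>\<^bsub>H\<^esub> g))"
      using f g by (auto simp: quotient_simps set_add_def' level_def \<mu>_add)
  next
    fix x assume x: "x \<in> level (\<mu> (f \<oplus>\<^bsub>H\<^esub> g))"
    then have xH: "x \<in> carrier H" and eq: "\<mu> x = \<mu> f \<oplus>\<^bsub>K\<^esub> \<mu> g" using f g by (auto simp: level_def \<mu>_add)
    have "\<mu> (x \<ominus>\<^bsub>H\<^esub> g) = \<mu> f"
      using xH f g cl by (simp add: H.minus_eq \<mu>_add \<mu>_neg eq K.a_assoc K.r_neg)
    moreover have "x = (x \<ominus>\<^bsub>H\<^esub> g) \<oplus>\<^bsub>H\<^esub> g" using xH g by (simp add: H.minus_eq H.a_assoc H.l_neg)
    ultimately show "x \<in> level (\<mu> f) \<oplus>\<^bsub>quotient H N\<^esub> level (\<mu> g)"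
      using xH g unfolding quotient_simps set_add_def' level_def by blast
  qed
  have q_smult: "c \<odot>\<^bsub>quotient H N\<^esub> level (\<mu> f) = level (\<mu> (c \<odot>\<^bsub>H\<^esub> f))"
    if c: "c \<in> carrier K" and f: "f \<in> carrier H" for c f
  proof -
    have "N +>\<^bsub>H\<^esub> (c \<odot>\<^bsub>H\<^esub> x) = level (\<mu> (c \<odot>\<^bsub>H\<^esub> f))" if "x \<in> level (\<mu> f)" for x
      using that c f by (auto simp: level_def coset smult \<mu>_smult)
    then show ?thesis using level_image[OF f] unfolding quotient_simps by auto
  qed
  \<comment> \<open>\<open>?\<Lambda>\<close> is the functional induced by \<open>\<mu>\<close> on
    the quotient. It reads off the level of a coset, which makes it injective.\<close>
  let ?\<Lambda> = "\<lambda>Y. the_elem (\<mu> ` Y)"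
  have \<Lambda>: "?\<Lambda> (level (\<mu> f)) = \<mu> f" if "f \<in> carrier H" for f using level_image[OF that] by simp
  have "vs_dim K (quotient H N) =
      (if carrier (quotient H N) = {\<zero>\<^bsub>quotient H N\<^esub>} then 0 else 1)"
  proof (rule vs_dim_of_embedding[OF K, where \<Lambda> = ?\<Lambda>])
    show "\<zero>\<^bsub>quotient H N\<^esub> \<in> carrier (quotient H N)"
      unfolding carr q_zero \<mu>0[symmetric] by blast
    show "?\<Lambda> \<zero>\<^bsub>quotient H N\<^esub> = \<zero>\<^bsub>K\<^esub>" unfolding q_zero using \<Lambda>[of "\<zero>\<^bsub>H\<^esub>"] by (simp add: \<mu>0)
  qed (auto simp: carr q_add q_smult \<Lambda> cl \<mu>_add[symmetric] \<mu>_smult[symmetric] smult inj_on_def)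
  moreover have "carrier (quotient H N) = {\<zero>\<^bsub>quotient H N\<^esub>} \<longleftrightarrow> (\<forall>x\<in>carrier H. \<mu> x = \<zero>\<^bsub>K\<^esub>)"
  proof
    assume eq: "carrier (quotient H N) = {\<zero>\<^bsub>quotient H N\<^esub>}"
    show "\<forall>x\<in>carrier H. \<mu> x = \<zero>\<^bsub>K\<^esub>"
    proof
      fix x assume x: "x \<in> carrier H"
      then have "level (\<mu> x) = level \<zero>\<^bsub>K\<^esub>" using eq unfolding carr q_zero by blast
      then show "\<mu> x = \<zero>\<^bsub>K\<^esub>" using x by (auto simp: level_def)
    qed
  next
    assume "\<forall>x\<in>carrier H. \<mu> x = \<zero>\<^bsub>K\<^esub>"
    then show "carrier (quotient H N) = {\<zero>\<^bsub>quotient H N\<^esub>}" using H.zero_closed by (auto simp: carr q_zero)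
  qed
  ultimately show ?thesis by simp
qed

text \<open>All operations are pointwise, so the axioms come from \<open>T\<close>; extensionality
  makes pointwise equality on \<open>carrier X\<close> an equality of functions.\<close>

lemma hom_space_abelian_group:
  assumes T: "left_module R T"
    and X: "\<And>x y. x \<in> carrier X \<Longrightarrow> y \<in> carrier X \<Longrightarrow> x \<oplus>\<^bsub>X\<^esub> y \<in> carrier X"
      "\<And>a x. a \<in> carrier R \<Longrightarrow> x \<in> carrier X \<Longrightarrow> a \<odot>\<^bsub>X\<^esub> x \<in> carrier X"
  shows "abelian_group (hom_space R X T)"
proof -
  interpret T: left_module R T by fact
  have mem: "f \<in> carrier (hom_space R X T) \<longleftrightarrow> f \<in> extensional (carrier X) \<and>
      (\<forall>x\<in>carrier X. f x \<in> carrier T) \<and>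
      (\<forall>x\<in>carrier X. \<forall>y\<in>carrier X. f (x \<oplus>\<^bsub>X\<^esub> y) = f x \<oplus>\<^bsub>T\<^esub> f y) \<and>
      (\<forall>a\<in>carrier R. \<forall>x\<in>carrier X. f (a \<odot>\<^bsub>X\<^esub> x) = a \<odot>\<^bsub>T\<^esub> f x)" for f
    by (auto simp: hom_space_def LinearCombinations.module_hom_def)
  show ?thesis
  proof (rule abelian_groupI)
    fix f g h assume f: "f \<in> carrier (hom_space R X T)"
    let ?g = "\<lambda>x\<in>carrier X. \<ominus>\<^bsub>T\<^esub> f x"
    have "?g \<in> carrier (hom_space R X T)"
      using f unfolding mem by (auto simp: X T.smult_r_minus T.M.minus_add T.M.a_comm)
    moreover have "?g \<oplus>\<^bsub>hom_space R X T\<^esub> f = \<zero>\<^bsub>hom_space R X T\<^esub>"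
      using f unfolding mem by (auto simp: hom_space_def fun_eq_iff T.M.l_neg)
    ultimately show "\<exists>g\<in>carrier (hom_space R X T). g \<oplus>\<^bsub>hom_space R X T\<^esub> f = \<zero>\<^bsub>hom_space R X T\<^esub>"
      by blast
    show "\<zero>\<^bsub>hom_space R X T\<^esub> \<oplus>\<^bsub>hom_space R X T\<^esub> f = f"
      using f unfolding mem by (auto simp: hom_space_def fun_eq_iff extensional_def)
    assume g: "g \<in> carrier (hom_space R X T)"
    show "f \<oplus>\<^bsub>hom_space R X T\<^esub> g \<in> carrier (hom_space R X T)"
      using f g unfolding mem by (auto simp: hom_space_def X T.smult_r_distr T.M.a_ac)
    show "f \<oplus>\<^bsub>hom_space R X T\<^esub> g = g \<oplus>\<^bsub>hom_space R X T\<^esub> f"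
      using f g unfolding mem by (auto simp: hom_space_def fun_eq_iff T.M.a_comm)
    assume h: "h \<in> carrier (hom_space R X T)"
    show "f \<oplus>\<^bsub>hom_space R X T\<^esub> g \<oplus>\<^bsub>hom_space R X T\<^esub> h = f \<oplus>\<^bsub>hom_space R X T\<^esub> (g \<oplus>\<^bsub>hom_space R X T\<^esub> h)"
      using f g h unfolding mem by (auto simp: hom_space_def fun_eq_iff T.M.a_assoc)
  next
    show "\<zero>\<^bsub>hom_space R X T\<^esub> \<in> carrier (hom_space R X T)"
      unfolding mem by (auto simp: hom_space_def X)
  qed
qed

lemma (in ring) free_left_module_left_module: "left_module R (free_left_module R S)"
proof -
  have mem: "f \<in> carrier (free_left_module R S) \<longleftrightarrow>
      (\<forall>s. f s \<in> carrier R) \<and> (\<forall>s. s \<notin> S \<longrightarrow> f s = \<zero>) \<and> finite {s. f s \<noteq> \<zero>}" for f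
    by (simp add: free_left_module_def)
  have ops: "f \<oplus>\<^bsub>free_left_module R S\<^esub> g = (\<lambda>s. f s \<oplus> g s)"
    "a \<odot>\<^bsub>free_left_module R S\<^esub> f = (\<lambda>s. a \<otimes> f s)"
    "\<zero>\<^bsub>free_left_module R S\<^esub> = (\<lambda>s. \<zero>)" for f g a
    by (simp_all add: free_left_module_def)
  have fin_smult: "finite {s. a \<otimes> f s \<noteq> \<zero>}"
    if "finite {s. f s \<noteq> \<zero>}" "a \<in> carrier R" for f and a
    using that(1) by (rule rev_finite_subset) (use that(2) in auto)
  have "abelian_group (free_left_module R S)"
  proof (rule abelian_groupI; (unfold ops)?)
    fix f g h assume f: "f \<in> carrier (free_left_module R S)"
    have "(\<lambda>s. \<ominus> f s) \<in> carrier (free_left_module R S)"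
      using f unfolding mem by (auto elim!: rev_finite_subset)
    moreover have "(\<lambda>s. \<ominus> f s \<oplus> f s) = (\<lambda>s. \<zero>)" using f unfolding mem by (auto simp: l_neg)
    ultimately show "\<exists>g\<in>carrier (free_left_module R S). (\<lambda>s. g s \<oplus> f s) = (\<lambda>s. \<zero>)"
      by (intro bexI[where x = "\<lambda>s. \<ominus> f s"])
    show "(\<lambda>s. \<zero> \<oplus> f s) = f" using f unfolding mem by auto
    assume g: "g \<in> carrier (free_left_module R S)"
    show "(\<lambda>s. f s \<oplus> g s) \<in> carrier (free_left_module R S)"
      using f g unfolding mem
      by (auto intro: finite_subset[of _ "{s. f s \<noteq> \<zero>} \<union> {s. g s \<noteq> \<zero>}"])
    show "(\<lambda>s. f s \<oplus> g s) = (\<lambda>s. g s \<oplus> f s)" using f g unfolding mem by (auto simp: a_comm)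
    assume h: "h \<in> carrier (free_left_module R S)"
    show "(\<lambda>s. f s \<oplus> g s \<oplus> h s) = (\<lambda>s. f s \<oplus> (g s \<oplus> h s))" using f g h unfolding mem by (auto simp: a_assoc)
  qed (simp add: mem)
  moreover have "a \<odot>\<^bsub>free_left_module R S\<^esub> f \<in> carrier (free_left_module R S)"
    if "a \<in> carrier R" "f \<in> carrier (free_left_module R S)" for a f
    using that fin_smult[of f a] unfolding ops mem by auto
  ultimately show ?thesis
    using ring_axioms
    by (intro left_module.intro left_module_axioms.intro)
      (simp_all add: ops mem fun_eq_iff l_distr r_distr m_assoc)
qed


text \<open>\<open>S\<close> and \<open>T\<close> are arbitrary copies of
  \<open>E_module K M\<close> and \<open>E_module K N\<close>, on any types, given together with
  coordinates \<open>hS\<close> and \<open>hT\<close> in the field. This fits the representatives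
  that \<open>gabriel_quiver\<close> picks by \<open>SOME\<close>.\<close>

locale simple_pair = quiver_algebra_over K Q +
    S: left_module "quiver_algebra K Q" S + T: left_module "quiver_algebra K Q" T
  for K :: "('k, 'w) ring_scheme" (structure) and Q :: "('v, 'e) pre_digraph"
    and S :: "(('v list \<Rightarrow> 'k) set, 's, 'y) module_scheme"
    and T :: "(('v list \<Rightarrow> 'k) set, 't, 'z) module_scheme" +
  fixes M N :: "'v set" and hS :: "'s \<Rightarrow> 'k" and hT :: "'t \<Rightarrow> 'k"
  assumes M: "M \<subseteq> verts Q" and N: "N \<subseteq> verts Q"
    and hS_bij: "bij_betw hS (carrier S) (carrier K)"
    and hS_add: "\<And>x y. x \<in> carrier S \<Longrightarrow> y \<in> carrier S \<Longrightarrow> hS (x \<oplus>\<^bsub>S\<^esub> y) = hS x \<oplus> hS y"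
    and hS_smult: "\<And>b x. b \<in> carrier B \<Longrightarrow> x \<in> carrier S \<Longrightarrow>
      hS (b \<odot>\<^bsub>S\<^esub> x) = algebra_char K M b \<otimes> hS x"
    and hT_bij: "bij_betw hT (carrier T) (carrier K)"
    and hT_add: "\<And>x y. x \<in> carrier T \<Longrightarrow> y \<in> carrier T \<Longrightarrow> hT (x \<oplus>\<^bsub>T\<^esub> y) = hT x \<oplus> hT y"
    and hT_smult: "\<And>b x. b \<in> carrier B \<Longrightarrow> x \<in> carrier T \<Longrightarrow>
      hT (b \<odot>\<^bsub>T\<^esub> x) = algebra_char K N b \<otimes> hT x"
begin

abbreviation "P \<equiv> free_cover B S"
abbreviation "\<Omega> \<equiv> syzygy B S"

lemma hS_closed [simp]: "x \<in> carrier S \<Longrightarrow> hS x \<in> carrier K"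
  using hS_bij by (auto simp: bij_betw_def)

lemma hT_closed [simp]: "x \<in> carrier T \<Longrightarrow> hT x \<in> carrier K"
  using hT_bij by (auto simp: bij_betw_def)

lemma hS_zero: "hS \<zero>\<^bsub>S\<^esub> = \<zero>"
  using hS_add[of "\<zero>\<^bsub>S\<^esub>" "\<zero>\<^bsub>S\<^esub>"] by (simp add: K.add.r_cancel_one')

lemma hT_eqI: "x \<in> carrier T \<Longrightarrow> y \<in> carrier T \<Longrightarrow> hT x = hT y \<Longrightarrow> x = y"
  using hT_bij by (auto simp: bij_betw_def dest: inj_onD)

definition kT where "kT = inv_into (carrier T) hT"

lemma kT: "c \<in> carrier K \<Longrightarrow> kT c \<in> carrier T" "c \<in> carrier K \<Longrightarrow> hT (kT c) = c"
  unfolding kT_def using hT_bij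
  by (auto simp: bij_betw_def f_inv_into_f intro: inv_into_into)

sublocale P: left_module B P
  unfolding free_cover_def by (rule B.free_left_module_left_module)

lemma P_iff: "u \<in> carrier P \<longleftrightarrow> (\<forall>s. u s \<in> carrier B) \<and> (\<forall>s. s \<notin> carrier S \<longrightarrow> u s = \<zero>\<^bsub>B\<^esub>) \<and>
    finite {s. u s \<noteq> \<zero>\<^bsub>B\<^esub>}"
  by (simp add: free_cover_def free_left_module_def)

lemma P_ops: "u \<oplus>\<^bsub>P\<^esub> w = (\<lambda>s. u s \<oplus>\<^bsub>B\<^esub> w s)" "b \<odot>\<^bsub>P\<^esub> u = (\<lambda>s. b \<otimes>\<^bsub>B\<^esub> u s)"
  by (simp_all add: free_cover_def free_left_module_def)

text \<open>The map \<open>\<Sum> u\<^sub>s e\<^sub>s \<mapsto> \<Sum> \<epsilon>(u\<^sub>s) hS(s)\<close>. For the character \<open>\<chi>\<close> of \<open>S\<close> it is the presentation map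
  in the coordinate \<open>hS\<close>; for a derivation it is linear over the algebra on the kernel of the
  former, and so turns derivations into homomorphisms on the syzygy.\<close>

definition coeff_sum :: "(('v list \<Rightarrow> 'k) set \<Rightarrow> 'k) \<Rightarrow> ('s \<Rightarrow> ('v list \<Rightarrow> 'k) set) \<Rightarrow> 'k" where
  "coeff_sum \<epsilon> u = support_sum K \<zero>\<^bsub>B\<^esub> (\<lambda>s b. if s \<in> carrier S then \<epsilon> b \<otimes> hS s else \<zero>) u"

definition additive :: "(('v list \<Rightarrow> 'k) set \<Rightarrow> 'k) \<Rightarrow> bool" where
  "additive \<epsilon> \<longleftrightarrow> (\<forall>b\<in>carrier B. \<epsilon> b \<in> carrier K) \<and>
     (\<forall>a\<in>carrier B. \<forall>b\<in>carrier B. \<epsilon> (a \<oplus>\<^bsub>B\<^esub> b) = \<epsilon> a \<oplus> \<epsilon> b)"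

lemma additive_zero: 
  assumes "additive \<epsilon>"
  shows "\<epsilon> \<zero>\<^bsub>B\<^esub> = \<zero>"
proof -
  have "\<epsilon> \<zero>\<^bsub>B\<^esub> \<in> carrier K" "\<epsilon> (\<zero>\<^bsub>B\<^esub> \<oplus>\<^bsub>B\<^esub> \<zero>\<^bsub>B\<^esub>) = \<epsilon> \<zero>\<^bsub>B\<^esub> \<oplus> \<epsilon> \<zero>\<^bsub>B\<^esub>"
    using assms B.zero_closed unfolding additive_def by blast+
  then show ?thesis by (simp add: K.add.r_cancel_one')
qed

lemma coeff_sum_superset:
  assumes "additive \<epsilon>" "u \<in> carrier P" "finite A" "{s. u s \<noteq> \<zero>\<^bsub>B\<^esub>} \<subseteq> A"
  shows "coeff_sum \<epsilon> u = (\<Oplus>s\<in>A. if s \<in> carrier S then \<epsilon> (u s) \<otimes> hS s else \<zero>)"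
  unfolding coeff_sum_def
  by (rule K.support_sum_superset)
    (use assms additive_zero[OF assms(1)] in \<open>auto simp: P_iff additive_def\<close>)

lemma coeff_sum_closed:
  assumes "additive \<epsilon>" "u \<in> carrier P"
  shows "coeff_sum \<epsilon> u \<in> carrier K"
  unfolding coeff_sum_def
  by (rule K.support_sum_closed) (use assms in \<open>auto simp: P_iff additive_def\<close>)

lemma coeff_sum_add:
  assumes "additive \<epsilon>" "u \<in> carrier P" "w \<in> carrier P"
  shows "coeff_sum \<epsilon> (u \<oplus>\<^bsub>P\<^esub> w) = coeff_sum \<epsilon> u \<oplus> coeff_sum \<epsilon> w"
  unfolding coeff_sum_def
  by (rule K.support_sum_add)
    (use assms additive_zero[OF assms(1)] in \<open>auto simp: P_iff P_ops additive_def K.l_distr\<close>)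

text \<open>Two summands again cover two uses: \<open>\<beta> = \<zero>\<close> gives the linearity
  of \<open>val\<close>, and a derivation \<open>\<epsilon>\<close> with \<open>\<epsilon>''\<close>
  the character of \<open>S\<close> gives a rule whose second summand vanishes on the
  syzygy.\<close>

lemma coeff_sum_smult:
  assumes \<epsilon>: "additive \<epsilon>" "additive \<epsilon>'" "additive \<epsilon>''"
    and u: "u \<in> carrier P" and b: "b \<in> carrier B" and \<alpha>\<beta>: "\<alpha> \<in> carrier K" "\<beta> \<in> carrier K"
    and mult: "\<And>c. c \<in> carrier B \<Longrightarrow> \<epsilon> (b \<otimes>\<^bsub>B\<^esub> c) = \<alpha> \<otimes> \<epsilon>' c \<oplus> \<beta> \<otimes> \<epsilon>'' c"
  shows "coeff_sum \<epsilon> (b \<odot>\<^bsub>P\<^esub> u) = \<alpha> \<otimes> coeff_sum \<epsilon>' u \<oplus> \<beta> \<otimes> coeff_sum \<epsilon>'' u"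
proof -
  let ?A = "{s. u s \<noteq> \<zero>\<^bsub>B\<^esub>}"
  let ?g = "\<lambda>\<epsilon> s. if s \<in> carrier S then \<epsilon> (u s) \<otimes> hS s else \<zero>"
  have fin: "finite ?A" and uB: "\<And>s. u s \<in> carrier B" using u by (auto simp: P_iff)
  have cl: "?g \<epsilon>' \<in> ?A \<rightarrow> carrier K" "?g \<epsilon>'' \<in> ?A \<rightarrow> carrier K"
    using \<epsilon> uB by (auto simp: additive_def)
  have "coeff_sum \<epsilon> (b \<odot>\<^bsub>P\<^esub> u) =
      (\<Oplus>s\<in>?A. if s \<in> carrier S then \<epsilon> ((b \<odot>\<^bsub>P\<^esub> u) s) \<otimes> hS s else \<zero>)"
    by (rule coeff_sum_superset[OF \<epsilon>(1) P.smult_closed[OF b u] fin])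
      (use b uB in \<open>auto simp: P_ops\<close>)
  also have "\<dots> = (\<Oplus>s\<in>?A. \<alpha> \<otimes> ?g \<epsilon>' s \<oplus> \<beta> \<otimes> ?g \<epsilon>'' s)"
  proof (rule K.finsum_cong')
    show "(if s \<in> carrier S then \<epsilon> ((b \<odot>\<^bsub>P\<^esub> u) s) \<otimes> hS s else \<zero>) =
        \<alpha> \<otimes> ?g \<epsilon>' s \<oplus> \<beta> \<otimes> ?g \<epsilon>'' s" for s
    proof -
      have "\<epsilon>' (u s) \<in> carrier K" "\<epsilon>'' (u s) \<in> carrier K" using \<epsilon> uB by (auto simp: additive_def)
      then show ?thesis using \<alpha>\<beta> uB mult by (auto simp: P_ops K.l_distr K.m_assoc)
    qed
  qed (use \<alpha>\<beta> cl in auto)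
  also have "\<dots> = (\<Oplus>s\<in>?A. \<alpha> \<otimes> ?g \<epsilon>' s) \<oplus> (\<Oplus>s\<in>?A. \<beta> \<otimes> ?g \<epsilon>'' s)"
    using cl \<alpha>\<beta> by (intro K.finsum_addf) auto
  also have "\<dots> = \<alpha> \<otimes> (\<Oplus>s\<in>?A. ?g \<epsilon>' s) \<oplus> \<beta> \<otimes> (\<Oplus>s\<in>?A. ?g \<epsilon>'' s)"
    using cl \<alpha>\<beta> fin by (simp add: K.finsum_rdistr)
  also have "(\<Oplus>s\<in>?A. ?g \<epsilon>' s) = coeff_sum \<epsilon>' u"
    by (rule coeff_sum_superset[OF \<epsilon>(2) u fin subset_refl, symmetric])
  also have "(\<Oplus>s\<in>?A. ?g \<epsilon>'' s) = coeff_sum \<epsilon>'' u"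
    by (rule coeff_sum_superset[OF \<epsilon>(3) u fin subset_refl, symmetric])
  finally show ?thesis .
qed

section \<open>The syzygy as the kernel of a functional\<close>

abbreviation "\<chi> \<equiv> algebra_char K M"
abbreviation "\<psi> \<equiv> algebra_char K N"
abbreviation "val \<equiv> coeff_sum \<chi>"

lemma additive_char: "additive (algebra_char K M')"
  by (simp add: additive_def algebra_char_simps)

lemma val_smult: "u \<in> carrier P \<Longrightarrow> b \<in> carrier B \<Longrightarrow> val (b \<odot>\<^bsub>P\<^esub> u) = \<chi> b \<otimes> val u"
  using coeff_sum_smult[OF additive_char additive_char additive_char, of u b "\<chi> b" \<zero> M M M]
  by (simp add: algebra_char_simps coeff_sum_closed additive_char)

text \<open>In the coordinate \<open>hS\<close> the presentation map is \<open>val\<close>, and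
  \<open>hS\<close> is injective. From here on the syzygy is the kernel of
  \<open>val\<close>.\<close>

lemma cover_map_eq_zero_iff:
  assumes u: "u \<in> carrier P"
  shows "cover_map B S u = \<zero>\<^bsub>S\<^esub> \<longleftrightarrow> val u = \<zero>"
proof -
  let ?A = "{s. u s \<noteq> \<zero>\<^bsub>B\<^esub>}"
  have A: "finite ?A" "?A \<subseteq> carrier S" and uB: "\<And>s. u s \<in> carrier B" using u by (auto simp: P_iff)
  have "hS (cover_map B S u) = (\<Oplus>s\<in>?A. hS (u s \<odot>\<^bsub>S\<^esub> s))"
    unfolding cover_map_def using A uB
    by (intro additive_finsum[OF S.M.abelian_monoid_axioms K.abelian_monoid_axioms])
      (auto simp: hS_zero hS_add S.smult_closed)
  also have "\<dots> = (\<Oplus>s\<in>?A. if s \<in> carrier S then \<chi> (u s) \<otimes> hS s else \<zero>)"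
    using A uB by (intro K.finsum_cong') (auto simp: hS_smult algebra_char_simps)
  also have "\<dots> = val u"
    by (rule coeff_sum_superset[OF additive_char u A(1) subset_refl, symmetric])
  finally have "hS (cover_map B S u) = val u" .
  moreover have "cover_map B S u \<in> carrier S"
    unfolding cover_map_def using A uB by (intro S.M.finsum_closed) (auto intro!: S.smult_closed)
  ultimately show ?thesis
    using hS_bij hS_zero inj_onD[of hS "carrier S" "cover_map B S u" "\<zero>\<^bsub>S\<^esub>"]
    by (auto simp: bij_betw_def)
qed

lemma \<Omega>_iff: "u \<in> carrier \<Omega> \<longleftrightarrow> u \<in> carrier P \<and> val u = \<zero>"
  using cover_map_eq_zero_iff by (auto simp: syzygy_def)

lemma \<Omega>_ops [simp]: "add \<Omega> = add P" "smult \<Omega> = smult P"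
  by (simp_all add: syzygy_def)

lemma \<Omega>_P: "u \<in> carrier \<Omega> \<Longrightarrow> u \<in> carrier P"
  by (simp add: \<Omega>_iff)

lemma \<Omega>_add: "u \<in> carrier \<Omega> \<Longrightarrow> w \<in> carrier \<Omega> \<Longrightarrow> u \<oplus>\<^bsub>P\<^esub> w \<in> carrier \<Omega>"
  by (simp add: \<Omega>_iff coeff_sum_add additive_char)

lemma \<Omega>_smult: "b \<in> carrier B \<Longrightarrow> u \<in> carrier \<Omega> \<Longrightarrow> b \<odot>\<^bsub>P\<^esub> u \<in> carrier \<Omega>"
  by (simp add: \<Omega>_iff val_smult P.smult_closed algebra_char_simps)

text \<open>The basis vector of the free cover at the element of coordinate \<open>\<one>\<close>.
  Since \<open>val e = \<one>\<close>, the cover is the direct sum of the syzygy and the line of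
  \<open>e\<close> as a vector space.\<close>

definition e where
  "e = (\<lambda>s. if s = inv_into (carrier S) hS \<one> then \<one>\<^bsub>B\<^esub> else \<zero>\<^bsub>B\<^esub>)"

lemma e: "e \<in> carrier P" "val e = \<one>"
proof -
  let ?v = "inv_into (carrier S) hS \<one>"
  have v: "?v \<in> carrier S" "hS ?v = \<one>"
    using hS_bij by (auto simp: bij_betw_def f_inv_into_f intro: inv_into_into)
  show eP: "e \<in> carrier P" using v by (auto simp: P_iff e_def)
  have "val e = (\<Oplus>s\<in>{?v}. if s \<in> carrier S then \<chi> (e s) \<otimes> hS s else \<zero>)"
    by (rule coeff_sum_superset[OF additive_char eP]) (auto simp: e_def)
  then show "val e = \<one>" using v by (simp add: e_def algebra_char_simps)
qed

text \<open>The component of \<open>b\<close> in the kernel of \<open>\<chi>\<close> along the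
  scalars; multiplying \<open>e\<close> by it gives an element of the syzygy.\<close>

definition \<kappa> where "\<kappa> b = b \<ominus>\<^bsub>B\<^esub> \<iota> (\<chi> b)"

lemma char_minus: "a \<in> carrier B \<Longrightarrow> b \<in> carrier B \<Longrightarrow>
    algebra_char K M' (a \<ominus>\<^bsub>B\<^esub> b) = algebra_char K M' a \<ominus> algebra_char K M' b"
proof -
  assume ab: "a \<in> carrier B" "b \<in> carrier B"
  have "algebra_char K M' (\<ominus>\<^bsub>B\<^esub> b) \<oplus> algebra_char K M' b = \<zero>"
    using ab algebra_char_simps(2)[of "\<ominus>\<^bsub>B\<^esub> b" b M'] by (simp add: B.l_neg algebra_char_simps)
  then have "algebra_char K M' (\<ominus>\<^bsub>B\<^esub> b) = \<ominus> algebra_char K M' b"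
    using ab by (intro K.minus_equality[symmetric]) (auto simp: algebra_char_simps)
  then show ?thesis using ab by (simp add: B.minus_eq K.minus_eq algebra_char_simps)
qed

lemma \<kappa>_closed [simp]: "b \<in> carrier B \<Longrightarrow> \<kappa> b \<in> carrier B"
  by (simp add: \<kappa>_def algebra_char_simps)

lemma \<kappa>_char: "b \<in> carrier B \<Longrightarrow> algebra_char K M' (\<kappa> b) = algebra_char K M' b \<ominus> \<chi> b"
  by (simp add: \<kappa>_def char_minus algebra_char_simps)

lemma \<kappa>_add: "a \<in> carrier B \<Longrightarrow> b \<in> carrier B \<Longrightarrow> \<kappa> (a \<oplus>\<^bsub>B\<^esub> b) = \<kappa> a \<oplus>\<^bsub>B\<^esub> \<kappa> b"
  by (simp add: \<kappa>_def algebra_char_simps iota_add B.minus_eq B.minus_add B.a_ac)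

text \<open>Source of the product rule for \<open>D\<close>: the middle term
  \<open>a * \<chi> b\<close> is subtracted and added. The scalar is moved to the left so that a
  homomorphism can pull it out.\<close>

lemma \<kappa>_mult:
  assumes a: "a \<in> carrier B" and b: "b \<in> carrier B"
  shows "\<kappa> (a \<otimes>\<^bsub>B\<^esub> b) = a \<otimes>\<^bsub>B\<^esub> \<kappa> b \<oplus>\<^bsub>B\<^esub> \<iota> (\<chi> b) \<otimes>\<^bsub>B\<^esub> \<kappa> a"
proof -
  let ?a = "\<iota> (\<chi> a)" and ?b = "\<iota> (\<chi> b)"
  have cl: "?a \<in> carrier B" "?b \<in> carrier B" "\<chi> a \<in> carrier K" "\<chi> b \<in> carrier K"
    using a b by (simp_all add: algebra_char_simps)
  have "a \<otimes>\<^bsub>B\<^esub> \<kappa> b \<oplus>\<^bsub>B\<^esub> ?b \<otimes>\<^bsub>B\<^esub> \<kappa> a =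
      a \<otimes>\<^bsub>B\<^esub> b \<oplus>\<^bsub>B\<^esub> \<ominus>\<^bsub>B\<^esub> (a \<otimes>\<^bsub>B\<^esub> ?b) \<oplus>\<^bsub>B\<^esub> (a \<otimes>\<^bsub>B\<^esub> ?b \<oplus>\<^bsub>B\<^esub> \<ominus>\<^bsub>B\<^esub> (?b \<otimes>\<^bsub>B\<^esub> ?a))"
    using a b cl iota_central[of "\<chi> b" a] by (simp add: \<kappa>_def B.minus_eq B.r_distr B.r_minus)
  also have "\<dots> = a \<otimes>\<^bsub>B\<^esub> b \<oplus>\<^bsub>B\<^esub> \<ominus>\<^bsub>B\<^esub> (?b \<otimes>\<^bsub>B\<^esub> ?a)"
    using a b cl by (simp add: B.a_assoc B.r_neg1 B.r_neg2)
  also have "?b \<otimes>\<^bsub>B\<^esub> ?a = \<iota> (\<chi> (a \<otimes>\<^bsub>B\<^esub> b))"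
    using a b cl by (simp add: algebra_char_simps iota_mult[symmetric] K.m_comm)
  finally show ?thesis by (simp add: \<kappa>_def B.minus_eq)
qed

lemma \<kappa>_iota: "c \<in> carrier K \<Longrightarrow> \<kappa> (\<iota> c) = \<zero>\<^bsub>B\<^esub>"
  by (simp add: \<kappa>_def algebra_char_simps B.minus_eq B.r_neg)

lemma \<kappa>_\<Omega> [simp]: "b \<in> carrier B \<Longrightarrow> \<kappa> b \<odot>\<^bsub>P\<^esub> e \<in> carrier \<Omega>"
  by (simp add: \<Omega>_iff val_smult e P.smult_closed \<kappa>_char algebra_char_simps K.minus_eq K.r_neg)

section \<open>Homomorphisms on the syzygy and derivations\<close>

lemma \<Omega>_hom:
  "f \<in> carrier (hom_space B \<Omega> T) \<longleftrightarrow> f \<in> extensional (carrier \<Omega>) \<and>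
    (\<forall>u\<in>carrier \<Omega>. f u \<in> carrier T) \<and>
    (\<forall>u\<in>carrier \<Omega>. \<forall>w\<in>carrier \<Omega>. f (u \<oplus>\<^bsub>P\<^esub> w) = f u \<oplus>\<^bsub>T\<^esub> f w) \<and>
    (\<forall>b\<in>carrier B. \<forall>u\<in>carrier \<Omega>. f (b \<odot>\<^bsub>P\<^esub> u) = b \<odot>\<^bsub>T\<^esub> f u)"
  by (auto simp: hom_space_def LinearCombinations.module_hom_def)

lemma P_hom:
  "f \<in> carrier (hom_space B P T) \<longleftrightarrow> f \<in> extensional (carrier P) \<and>
    (\<forall>u\<in>carrier P. f u \<in> carrier T) \<and>
    (\<forall>u\<in>carrier P. \<forall>w\<in>carrier P. f (u \<oplus>\<^bsub>P\<^esub> w) = f u \<oplus>\<^bsub>T\<^esub> f w) \<and>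
    (\<forall>b\<in>carrier B. \<forall>u\<in>carrier P. f (b \<odot>\<^bsub>P\<^esub> u) = b \<odot>\<^bsub>T\<^esub> f u)"
  by (auto simp: hom_space_def LinearCombinations.module_hom_def)

text \<open>The derivation attached to a homomorphism \<open>\<Omega> S \<rightarrow> T\<close>. It is inner exactly if the homomorphism
  extends to the free cover.\<close>

definition D where "D f b = hT (f (\<kappa> b \<odot>\<^bsub>P\<^esub> e))"

lemma D_closed [simp]: "f \<in> carrier (hom_space B \<Omega> T) \<Longrightarrow> b \<in> carrier B \<Longrightarrow> D f b \<in> carrier K"
  by (simp add: D_def \<Omega>_hom)

lemma D_add:
  "f \<in> carrier (hom_space B \<Omega> T) \<Longrightarrow> a \<in> carrier B \<Longrightarrow> b \<in> carrier B \<Longrightarrow>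
    D f (a \<oplus>\<^bsub>B\<^esub> b) = D f a \<oplus> D f b"
  by (simp add: D_def \<Omega>_hom \<kappa>_add P.smult_l_distr e hT_add)

lemma D_mult:
  assumes f: "f \<in> carrier (hom_space B \<Omega> T)" and a: "a \<in> carrier B" and b: "b \<in> carrier B"
  shows "D f (a \<otimes>\<^bsub>B\<^esub> b) = \<psi> a \<otimes> D f b \<oplus> D f a \<otimes> \<chi> b"
proof -
  have cl: "\<chi> b \<in> carrier K" using b by (simp add: algebra_char_simps)
  have "D f (a \<otimes>\<^bsub>B\<^esub> b) = hT (f (a \<odot>\<^bsub>P\<^esub> (\<kappa> b \<odot>\<^bsub>P\<^esub> e) \<oplus>\<^bsub>P\<^esub> \<iota> (\<chi> b) \<odot>\<^bsub>P\<^esub> (\<kappa> a \<odot>\<^bsub>P\<^esub> e)))"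
    using a b cl e by (simp add: D_def \<kappa>_mult P.smult_l_distr P.smult_assoc1)
  also have "\<dots> = hT (a \<odot>\<^bsub>T\<^esub> f (\<kappa> b \<odot>\<^bsub>P\<^esub> e) \<oplus>\<^bsub>T\<^esub> \<iota> (\<chi> b) \<odot>\<^bsub>T\<^esub> f (\<kappa> a \<odot>\<^bsub>P\<^esub> e))"
    using f a b cl by (simp add: \<Omega>_hom \<Omega>_smult)
  also have "\<dots> = \<psi> a \<otimes> D f b \<oplus> \<chi> b \<otimes> D f a"
    using f a b cl by (simp add: \<Omega>_hom hT_add hT_smult T.smult_closed D_def algebra_char_simps)
  finally show ?thesis using f a cl by (simp add: K.m_comm)
qed

lemma D_iota: "f \<in> carrier (hom_space B \<Omega> T) \<Longrightarrow> c \<in> carrier K \<Longrightarrow> D f (\<iota> c) = \<zero>"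
  using D_add[of f "\<zero>\<^bsub>B\<^esub>" "\<zero>\<^bsub>B\<^esub>"] D_closed[of f "\<zero>\<^bsub>B\<^esub>"] \<kappa>_iota[of c] \<kappa>_iota[of \<zero>]
  by (simp add: D_def iota_zero K.add.r_cancel_one')

text \<open>The right side is the inner derivation
  \<open>b \<mapsto> \<psi> b * c - c * \<chi> b\<close> of the linear map \<open>c\<close>,
  evaluated at a generator.\<close>

definition inner_at where
  "inner_at c f \<longleftrightarrow> (\<forall>t\<in>V. D f (X t) = c \<otimes> (generator_char K N t \<ominus> generator_char K M t))"

text \<open>Both sides vanish on scalars, are additive and obey the same product rule, so agreement
  on generators is enough.\<close>

lemma inner_on_algebra:
  assumes f: "f \<in> carrier (hom_space B \<Omega> T)" and c: "c \<in> carrier K" and inner: "inner_at c f"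
    and b: "b \<in> carrier B"
  shows "D f b = c \<otimes> (\<psi> b \<ominus> \<chi> b)"
  using b
proof (induction rule: B_induct)
  case (scalar x)
  then show ?case using f c by (simp add: D_iota algebra_char_simps K.minus_eq K.r_neg)
next
  case (generator t)
  then show ?case using inner by (simp add: inner_at_def algebra_char_simps)
next
  case (add a b)
  moreover have "c \<otimes> (x \<ominus> y) \<oplus> c \<otimes> (x' \<ominus> y') = c \<otimes> (x \<oplus> x' \<ominus> (y \<oplus> y'))"
    if "x \<in> carrier K" "y \<in> carrier K" "x' \<in> carrier K" "y' \<in> carrier K" for x y x' y'
    using that c by algebra
  ultimately show ?case using f by (simp add: D_add algebra_char_simps)
next
  case (mult a b)
  moreover have "x \<otimes> (c \<otimes> (x' \<ominus> y')) \<oplus> c \<otimes> (x \<ominus> y) \<otimes> y' = c \<otimes> (x \<otimes> x' \<ominus> y \<otimes> y')"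
    if "x \<in> carrier K" "y \<in> carrier K" "x' \<in> carrier K" "y' \<in> carrier K" for x y x' y'
    using that c by algebra
  ultimately show ?case using f by (simp add: D_mult algebra_char_simps)
qed

text \<open>If \<open>g\<close> is defined at \<open>e\<close> itself, then
  \<open>g (\<kappa> b e) = \<kappa> b (g e)\<close>, and \<open>\<kappa> b\<close> acts on
  \<open>T\<close> as \<open>\<psi> b - \<chi> b\<close>.\<close>

lemma restriction_imp_inner:
  assumes g: "g \<in> carrier (hom_space B P T)"
  shows "restrict g (carrier \<Omega>) \<in> carrier (hom_space B \<Omega> T)"
    and "inner_at (hT (g e)) (restrict g (carrier \<Omega>))"
proof -
  show "restrict g (carrier \<Omega>) \<in> carrier (hom_space B \<Omega> T)"
    using g by (auto simp: \<Omega>_hom P_hom \<Omega>_add \<Omega>_smult \<Omega>_P)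
  have "D (restrict g (carrier \<Omega>)) b = hT (g e) \<otimes> (\<psi> b \<ominus> \<chi> b)" if b: "b \<in> carrier B" for b
  proof -
    have "D (restrict g (carrier \<Omega>)) b = (\<psi> b \<ominus> \<chi> b) \<otimes> hT (g e)"
      using g b e(1) by (simp add: D_def P_hom hT_smult \<kappa>_char)
    then show ?thesis using g b e(1) by (simp add: K.m_comm P_hom algebra_char_simps)
  qed
  then show "inner_at (hT (g e)) (restrict g (carrier \<Omega>))"
    by (simp add: inner_at_def algebra_char_simps)
qed

text \<open>Write \<open>u\<close> as \<open>r u\<close> in the syzygy plus \<open>val u\<close>
  times \<open>e\<close>; the extension is \<open>f\<close> on the first part and sends
  \<open>e\<close> to the element \<open>y\<close> of coordinate \<open>c\<close>. Additivity is
  clear, while linearity over \<open>B\<close> is where innerness is used.\<close>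

lemma inner_imp_restriction:
  assumes f: "f \<in> carrier (hom_space B \<Omega> T)" and c: "c \<in> carrier K" and inner: "inner_at c f"
  obtains g where "g \<in> carrier (hom_space B P T)" "f = restrict g (carrier \<Omega>)"
proof -
  define y where "y = kT c"
  have y: "y \<in> carrier T" "hT y = c" using kT c by (auto simp: y_def)
  define r where "r u = u \<ominus>\<^bsub>P\<^esub> \<iota> (val u) \<odot>\<^bsub>P\<^esub> e" for u
  have val_closed: "val u \<in> carrier K" if "u \<in> carrier P" for u
    using that by (simp add: coeff_sum_closed additive_char)
  note simps = val_closed y P.smult_closed T.smult_closed e
  have neg: "\<ominus>\<^bsub>P\<^esub> (\<iota> x \<odot>\<^bsub>P\<^esub> e) = \<iota> (\<ominus> x) \<odot>\<^bsub>P\<^esub> e" if "x \<in> carrier K" for x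
    using that e P.smult_l_distr[of "\<iota> (\<ominus> x)" "\<iota> x" e]
    by (intro P.M.minus_equality) (auto simp: iota_add[symmetric] K.l_neg iota_zero P.smult_closed)
  have r_\<Omega>: "r u \<in> carrier \<Omega>" if u: "u \<in> carrier P" for u
    using u by (simp add: r_def P.M.minus_eq neg simps \<Omega>_iff coeff_sum_add additive_char val_smult
        algebra_char_simps K.r_neg)
  have r_add: "r (u \<oplus>\<^bsub>P\<^esub> w) = r u \<oplus>\<^bsub>P\<^esub> r w" if "u \<in> carrier P" "w \<in> carrier P" for u w
    using that by (simp add: r_def coeff_sum_add additive_char iota_add P.smult_l_distr simps
        P.M.minus_eq P.M.minus_add P.M.a_ac)
  define g where "g = (\<lambda>u\<in>carrier P. f (r u) \<oplus>\<^bsub>T\<^esub> \<iota> (val u) \<odot>\<^bsub>T\<^esub> y)"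
  have "g \<in> carrier (hom_space B P T)"
    unfolding P_hom
  proof (intro conjI ballI)
    show "g \<in> extensional (carrier P)" by (simp add: g_def)
    fix u assume u: "u \<in> carrier P"
    have fr: "f (r u) \<in> carrier T" using f r_\<Omega>[OF u] by (simp add: \<Omega>_hom)
    show "g u \<in> carrier T" using u fr by (simp add: g_def simps)
    {
      fix w assume w: "w \<in> carrier P"
      have fr': "f (r w) \<in> carrier T" using f r_\<Omega>[OF w] by (simp add: \<Omega>_hom)
      have "f (r u \<oplus>\<^bsub>P\<^esub> r w) = f (r u) \<oplus>\<^bsub>T\<^esub> f (r w)" using f r_\<Omega>[OF u] r_\<Omega>[OF w] by (simp add: \<Omega>_hom)
      then show "g (u \<oplus>\<^bsub>P\<^esub> w) = g u \<oplus>\<^bsub>T\<^esub> g w"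
        using u w fr fr' by (simp add: g_def r_add coeff_sum_add additive_char iota_add
            T.smult_l_distr simps T.M.a_ac)
    }
    fix b assume b: "b \<in> carrier B"
    have bu: "b \<odot>\<^bsub>P\<^esub> u \<in> carrier P" using b u by (rule P.smult_closed)
    let ?k = "\<iota> (val u) \<odot>\<^bsub>P\<^esub> (\<kappa> b \<odot>\<^bsub>P\<^esub> e)"
    have k\<Omega>: "?k \<in> carrier \<Omega>" using u b by (simp add: \<Omega>_smult simps)
    have \<kappa>b: "b = \<kappa> b \<oplus>\<^bsub>B\<^esub> \<iota> (\<chi> b)"
      using b by (simp add: \<kappa>_def B.minus_eq B.a_assoc B.l_neg algebra_char_simps)
    \<comment> \<open>The projection \<open>r\<close> is not linear over \<open>B\<close>:
      multiplying the part on the line of \<open>e\<close> by \<open>b\<close> leaves that line, and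
      \<open>?k\<close> is the resulting component in the syzygy.\<close>
    have "r (b \<odot>\<^bsub>P\<^esub> u) = b \<odot>\<^bsub>P\<^esub> r u \<oplus>\<^bsub>P\<^esub> ?k"
    proof -
      have "(\<iota> (val u) \<otimes>\<^bsub>B\<^esub> \<kappa> b) \<odot>\<^bsub>P\<^esub> e \<oplus>\<^bsub>P\<^esub> (\<iota> (val u) \<otimes>\<^bsub>B\<^esub> \<iota> (\<chi> b)) \<odot>\<^bsub>P\<^esub> e =
          (\<iota> (val u) \<otimes>\<^bsub>B\<^esub> (\<kappa> b \<oplus>\<^bsub>B\<^esub> \<iota> (\<chi> b))) \<odot>\<^bsub>P\<^esub> e"
        using u b by (simp add: B.r_distr P.smult_l_distr simps algebra_char_simps)
      also have "\<dots> = (b \<otimes>\<^bsub>B\<^esub> \<iota> (val u)) \<odot>\<^bsub>P\<^esub> e"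
        using u b \<kappa>b iota_central[of "val u" b] by (simp add: simps)
      finally have eq: "b \<odot>\<^bsub>P\<^esub> (\<iota> (val u) \<odot>\<^bsub>P\<^esub> e) = ?k \<oplus>\<^bsub>P\<^esub> \<iota> (val (b \<odot>\<^bsub>P\<^esub> u)) \<odot>\<^bsub>P\<^esub> e"
        using u b by (simp add: P.smult_assoc1 simps val_smult iota_mult[symmetric] K.m_comm
            algebra_char_simps)
      have "b \<odot>\<^bsub>P\<^esub> r u \<oplus>\<^bsub>P\<^esub> ?k = b \<odot>\<^bsub>P\<^esub> u \<ominus>\<^bsub>P\<^esub> b \<odot>\<^bsub>P\<^esub> (\<iota> (val u) \<odot>\<^bsub>P\<^esub> e) \<oplus>\<^bsub>P\<^esub> ?k"
        using u b by (simp add: r_def P.M.minus_eq P.smult_r_distr P.smult_r_minus simps)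
      also have "\<dots> = r (b \<odot>\<^bsub>P\<^esub> u)"
      proof -
        have *: "x \<ominus>\<^bsub>P\<^esub> (k \<oplus>\<^bsub>P\<^esub> z) \<oplus>\<^bsub>P\<^esub> k = x \<ominus>\<^bsub>P\<^esub> z"
          if "x \<in> carrier P" "k \<in> carrier P" "z \<in> carrier P" for x k z
          using that
          by (simp add: P.M.minus_eq P.M.minus_add P.M.a_assoc P.M.a_comm[of "\<ominus>\<^bsub>P\<^esub> z" k] P.M.r_neg1)
        show ?thesis unfolding eq r_def
          by (rule *) (use u b bu \<Omega>_P[OF k\<Omega>] in \<open>auto simp: simps\<close>)
      qed
      finally show ?thesis by simp
    qed
    then have fr_b: "f (r (b \<odot>\<^bsub>P\<^esub> u)) = b \<odot>\<^bsub>T\<^esub> f (r u) \<oplus>\<^bsub>T\<^esub> \<iota> (val u) \<odot>\<^bsub>T\<^esub> f (\<kappa> b \<odot>\<^bsub>P\<^esub> e)"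
      using f r_\<Omega>[OF u] b k\<Omega> u by (simp add: \<Omega>_hom \<Omega>_smult simps)
    have f\<kappa>: "f (\<kappa> b \<odot>\<^bsub>P\<^esub> e) \<in> carrier T" using f b by (simp add: \<Omega>_hom)
    show "g (b \<odot>\<^bsub>P\<^esub> u) = b \<odot>\<^bsub>T\<^esub> g u"
    proof (rule hT_eqI)
      have a: "val u \<in> carrier K" "\<chi> b \<in> carrier K" "\<psi> b \<in> carrier K" "hT (f (r u)) \<in> carrier K"
        using u b fr by (auto simp: simps algebra_char_simps)
      have "hT (g (b \<odot>\<^bsub>P\<^esub> u)) = \<psi> b \<otimes> hT (f (r u)) \<oplus> val u \<otimes> D f b \<oplus> \<chi> b \<otimes> val u \<otimes> c"
        using u b bu fr f\<kappa> a by (simp add: g_def fr_b hT_add hT_smult simps val_smult D_def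
            algebra_char_simps)
      \<comment> \<open>Innerness turns the contribution of \<open>?k\<close> into
        \<open>val u * c * (\<psi> b - \<chi> b)\<close>, whose \<open>\<chi> b\<close> part cancels
        the last summand.\<close>
      also have "\<dots> = \<psi> b \<otimes> hT (f (r u)) \<oplus> val u \<otimes> (c \<otimes> (\<psi> b \<ominus> \<chi> b)) \<oplus> \<chi> b \<otimes> val u \<otimes> c"
        using inner_on_algebra[OF f c inner b] by simp
      also have "\<dots> = \<psi> b \<otimes> (hT (f (r u)) \<oplus> val u \<otimes> c)" using a c by algebra
      also have "\<dots> = hT (b \<odot>\<^bsub>T\<^esub> g u)"
        using u b fr a by (simp add: g_def hT_add hT_smult simps algebra_char_simps)
      finally show "hT (g (b \<odot>\<^bsub>P\<^esub> u)) = hT (b \<odot>\<^bsub>T\<^esub> g u)" .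
      show "g (b \<odot>\<^bsub>P\<^esub> u) \<in> carrier T" "b \<odot>\<^bsub>T\<^esub> g u \<in> carrier T"
        using u b bu fr fr_b f\<kappa> by (simp_all add: g_def simps)
    qed
  qed
  moreover have "f = restrict g (carrier \<Omega>)"
  proof
    fix u show "f u = restrict g (carrier \<Omega>) u"
    proof (cases "u \<in> carrier \<Omega>")
      case True
      then have u: "u \<in> carrier P" "val u = \<zero>" "f u \<in> carrier T" using f by (auto simp: \<Omega>_iff \<Omega>_hom)
      have "r u = u" using u e by (simp add: r_def iota_zero P.M.minus_eq)
      then show ?thesis using True u y by (simp add: g_def iota_zero)
    next
      case False
      then show ?thesis using f by (simp add: \<Omega>_hom extensional_def)
    qed
  qed
  ultimately show ?thesis by (rule that)
qed

lemma inner_iff_restriction: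
  "{f \<in> carrier (hom_space B \<Omega> T). \<exists>c\<in>carrier K. inner_at c f} =
    (\<lambda>g. restrict g (carrier \<Omega>)) ` carrier (hom_space B P T)"
proof (intro subset_antisym subsetI)
  fix f assume "f \<in> {f \<in> carrier (hom_space B \<Omega> T). \<exists>c\<in>carrier K. inner_at c f}"
  then obtain c where "f \<in> carrier (hom_space B \<Omega> T)" "c \<in> carrier K" "inner_at c f" by auto
  then obtain g where "g \<in> carrier (hom_space B P T)" "f = restrict g (carrier \<Omega>)"
    by (rule inner_imp_restriction)
  then show "f \<in> (\<lambda>g. restrict g (carrier \<Omega>)) ` carrier (hom_space B P T)" by simp
next
  fix f assume "f \<in> (\<lambda>g. restrict g (carrier \<Omega>)) ` carrier (hom_space B P T)"
  then obtain g where g: "g \<in> carrier (hom_space B P T)" "f = restrict g (carrier \<Omega>)" by auto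
  then have "hT (g e) \<in> carrier K" using e(1) by (simp add: P_hom)
  then show "f \<in> {f \<in> carrier (hom_space B \<Omega> T). \<exists>c\<in>carrier K. inner_at c f}"
    using restriction_imp_inner[OF g(1)] g(2) by auto
qed

end


section \<open>The obstruction to extending a homomorphism to the free cover\<close>

context simple_pair
begin

abbreviation "H \<equiv> hom_space B \<Omega> T"

lemma H_ops:
  "f \<oplus>\<^bsub>H\<^esub> g = (\<lambda>u\<in>carrier \<Omega>. f u \<oplus>\<^bsub>T\<^esub> g u)"
  "c \<odot>\<^bsub>H\<^esub> f = (\<lambda>u\<in>carrier \<Omega>. \<iota> c \<odot>\<^bsub>T\<^esub> f u)"
  by (simp_all add: hom_space_def)

text \<open>Scalars are central in \<open>B\<close>, so multiplication by them commutes with the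
  action on \<open>T\<close>.\<close>

lemma H_smult_closed:
  assumes c: "c \<in> carrier K" and f: "f \<in> carrier H"
  shows "c \<odot>\<^bsub>H\<^esub> f \<in> carrier H"
proof -
  have "\<iota> c \<odot>\<^bsub>T\<^esub> (b \<odot>\<^bsub>T\<^esub> x) = b \<odot>\<^bsub>T\<^esub> (\<iota> c \<odot>\<^bsub>T\<^esub> x)" if "b \<in> carrier B" "x \<in> carrier T" for b x
    using that c iota_central[of c b] by (simp add: T.smult_assoc1[symmetric])
  then show ?thesis
    using f c by (auto simp: \<Omega>_hom H_ops \<Omega>_add \<Omega>_smult T.smult_r_distr T.smult_closed)
qed

lemma D_hom_add:
  "f \<in> carrier H \<Longrightarrow> g \<in> carrier H \<Longrightarrow> b \<in> carrier B \<Longrightarrow> D (f \<oplus>\<^bsub>H\<^esub> g) b = D f b \<oplus> D g b"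
  by (simp add: D_def H_ops \<Omega>_hom hT_add)

lemma D_hom_smult:
  "f \<in> carrier H \<Longrightarrow> c \<in> carrier K \<Longrightarrow> b \<in> carrier B \<Longrightarrow> D (c \<odot>\<^bsub>H\<^esub> f) b = c \<otimes> D f b"
  by (simp add: D_def H_ops \<Omega>_hom hT_smult algebra_char_simps)

lemma D_satisfies_relations: "f \<in> carrier H \<Longrightarrow> satisfies_relations K Q N M (\<lambda>t. D f (X t))"
  by (rule generator_derivation_satisfies) (auto simp: D_mult)

lemma D_generator:
  assumes f: "f \<in> carrier H" and s: "s \<in> V" and t: "t \<in> V"
  shows "(s \<in> M \<longleftrightarrow> s \<in> N) \<Longrightarrow> D f (X s) = \<zero>"
    and "s \<in> M - N \<Longrightarrow> t \<in> M - N \<Longrightarrow> D f (X s) = D f (X t)"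
    and "s \<in> N - M \<Longrightarrow> t \<in> N - M \<Longrightarrow> D f (X s) = D f (X t)"
    and "s \<in> M - N \<Longrightarrow> t \<in> N - M \<Longrightarrow> (s, t) \<notin> arcs_ends Q \<Longrightarrow> D f (X s) \<oplus> D f (X t) = \<zero>"
proof -
  have cl: "D f (X r) \<in> carrier K" if "r \<in> V" for r using f that by simp
  note * = satisfies_relationsD[where d = "\<lambda>t. D f (X t)", OF D_satisfies_relations[OF f] _ s t]
  show "D f (X s) = \<zero>" if "s \<in> M \<longleftrightarrow> s \<in> N"
    by (rule *(1)) (use that cl in auto)
  show "D f (X s) = D f (X t)" if "s \<in> M - N" "t \<in> M - N"
    by (rule *(2)) (use that cl in auto)
  show "D f (X s) = D f (X t)" if "s \<in> N - M" "t \<in> N - M"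
    by (rule *(3)) (use that cl in auto)
  show "D f (X s) \<oplus> D f (X t) = \<zero>" if "s \<in> M - N" "t \<in> N - M" "(s, t) \<notin> arcs_ends Q"
    by (rule *(4)) (use that cl in auto)
qed

text \<open>A derivation is constant on \<open>M - N\<close> and on \<open>N - M\<close> and vanishes on the other generators, while
  inner derivations have opposite values on the two sets. So the sum of the two values is the
  obstruction to being inner.\<close>

definition obstruction where
  "obstruction f = (if M - N \<noteq> {} \<and> N - M \<noteq> {}
     then D f (X (SOME p. p \<in> M - N)) \<oplus> D f (X (SOME q. q \<in> N - M)) else \<zero>)"

text \<open>Independence of the points picked by \<open>SOME\<close>, because \<open>D f\<close> is
  constant on each of the two differences.\<close>

lemma obstruction_eq:
  assumes f: "f \<in> carrier H" and p: "p \<in> M - N" and q: "q \<in> N - M"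
  shows "obstruction f = D f (X p) \<oplus> D f (X q)"
proof -
  let ?p = "SOME p. p \<in> M - N" and ?q = "SOME q. q \<in> N - M"
  have pq: "?p \<in> M - N" "?q \<in> N - M" unfolding some_in_eq using p q by blast+
  have V: "p \<in> V" "q \<in> V" "?p \<in> V" "?q \<in> V" using p q pq M N by blast+
  have "D f (X ?p) = D f (X p)" "D f (X ?q) = D f (X q)"
    by (rule D_generator(2)[where f = f and s = ?p and t = p, OF f V(3,1) pq(1) p],
        rule D_generator(3)[where f = f and s = ?q and t = q, OF f V(4,2) pq(2) q])
  moreover have ne: "M - N \<noteq> {} \<and> N - M \<noteq> {}" using p q by blast
  ultimately show ?thesis unfolding obstruction_def if_P[OF ne] by (simp only:)
qed

lemma obstruction_closed: "f \<in> carrier H \<Longrightarrow> obstruction f \<in> carrier K"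
proof (cases "M - N \<noteq> {} \<and> N - M \<noteq> {}")
  case True
  assume f: "f \<in> carrier H"
  obtain p q where pq: "p \<in> M - N" "q \<in> N - M" using True by blast
  then have "p \<in> V" "q \<in> V" using M N by auto
  then show ?thesis using f pq by (simp add: obstruction_eq)
next
  case False
  then show ?thesis unfolding obstruction_def if_not_P[OF False] by simp
qed

lemma H_abelian_group: "abelian_group H"
  by (rule hom_space_abelian_group) (auto simp: T.left_module_axioms \<Omega>_add \<Omega>_smult)

lemma obstruction_linear:
  assumes f: "f \<in> carrier H"
  shows "g \<in> carrier H \<Longrightarrow> obstruction (f \<oplus>\<^bsub>H\<^esub> g) = obstruction f \<oplus> obstruction g"
    and "c \<in> carrier K \<Longrightarrow> obstruction (c \<odot>\<^bsub>H\<^esub> f) = c \<otimes> obstruction f"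
proof -
  interpret H: abelian_group H by (rule H_abelian_group)
  show "obstruction (f \<oplus>\<^bsub>H\<^esub> g) = obstruction f \<oplus> obstruction g" if g: "g \<in> carrier H"
  proof (cases "M - N \<noteq> {} \<and> N - M \<noteq> {}")
    case True
    then obtain p q where pq: "p \<in> M - N" "q \<in> N - M" by blast
    then have V: "X p \<in> carrier B" "X q \<in> carrier B" using M N by auto
    note eq = obstruction_eq[OF _ pq]
    have "obstruction (f \<oplus>\<^bsub>H\<^esub> g) = (D f (X p) \<oplus> D g (X p)) \<oplus> (D f (X q) \<oplus> D g (X q))"
      using f g V by (simp add: eq D_hom_add)
    also have "\<dots> = obstruction f \<oplus> obstruction g"
      using f g V by (simp add: eq K.a_ac)
    finally show ?thesis .
  next
    case False
    then show ?thesis by (auto simp: obstruction_def)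
  qed
  show "obstruction (c \<odot>\<^bsub>H\<^esub> f) = c \<otimes> obstruction f" if c: "c \<in> carrier K"
  proof (cases "M - N \<noteq> {} \<and> N - M \<noteq> {}")
    case True
    then obtain p q where pq: "p \<in> M - N" "q \<in> N - M" by blast
    then have V: "X p \<in> carrier B" "X q \<in> carrier B" using M N by auto
    note eq = obstruction_eq[OF _ pq]
    show ?thesis using f c V by (simp add: eq H_smult_closed D_hom_smult K.r_distr)
  next
    case False
    then show ?thesis using c by (auto simp: obstruction_def)
  qed
qed

text \<open>The constant \<open>c\<close> is read off from \<open>D f\<close> on
  \<open>N - M\<close>; a vanishing obstruction then says that \<open>D f\<close> is
  \<open>- c\<close> on \<open>M - N\<close>.\<close>

lemma obstruction_zero_iff:
  assumes f: "f \<in> carrier H"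
  shows "obstruction f = \<zero> \<longleftrightarrow> (\<exists>c\<in>carrier K. inner_at c f)"
proof
  have cl: "D f (X t) \<in> carrier K" if "t \<in> V" for t using f that by simp
  note rel = D_generator[OF f]
  {
    assume "\<exists>c\<in>carrier K. inner_at c f"
    then obtain c where c: "c \<in> carrier K" "inner_at c f" by blast
    show "obstruction f = \<zero>"
    proof (cases "M - N \<noteq> {} \<and> N - M \<noteq> {}")
      case True
      then obtain p q where pq: "p \<in> M - N" "q \<in> N - M" by blast
      then have "D f (X p) = c \<otimes> (\<zero> \<ominus> \<one>)" "D f (X q) = c \<otimes> (\<one> \<ominus> \<zero>)"
        using c M N by (auto simp: inner_at_def)
      moreover have "c \<otimes> (\<zero> \<ominus> \<one>) \<oplus> c \<otimes> (\<one> \<ominus> \<zero>) = \<zero>" using c(1) by algebra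
      ultimately show ?thesis using f pq by (simp add: obstruction_eq)
    next
      case False
      then show ?thesis by (auto simp: obstruction_def)
    qed
  }
  assume zero: "obstruction f = \<zero>"
  have innerI: "inner_at c f" if "c \<in> carrier K" "\<And>t. t \<in> M - N \<Longrightarrow> D f (X t) = \<ominus> c"
      "\<And>t. t \<in> N - M \<Longrightarrow> D f (X t) = c" for c
    unfolding inner_at_def
  proof
    fix t assume t: "t \<in> V"
    have "c \<otimes> (\<zero> \<ominus> \<one>) = \<ominus> c" "c \<otimes> (\<one> \<ominus> \<zero>) = c" "c \<otimes> (\<zero> \<ominus> \<zero>) = \<zero>" "c \<otimes> (\<one> \<ominus> \<one>) = \<zero>"
      using that(1) by (simp_all add: K.minus_eq K.r_minus K.r_neg)
    then show "D f (X t) = c \<otimes> (generator_char K N t \<ominus> generator_char K M t)"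
      using that(2,3)[of t] rel(1)[where s = t, OF t t] by auto
  qed
  show "\<exists>c\<in>carrier K. inner_at c f"
  proof (cases "N - M = {}")
    case False
    then obtain q where q: "q \<in> N - M" by blast
    then have qV: "q \<in> V" using N by blast
    have "D f (X t) = \<ominus> D f (X q)" if t: "t \<in> M - N" for t
    proof -
      have tV: "t \<in> V" using t M by blast
      have "D f (X t) \<oplus> D f (X q) = \<zero>" using obstruction_eq[OF f t q] zero by simp
      then show ?thesis using cl[OF tV] cl[OF qV] by (simp add: K.minus_equality)
    qed
    moreover have "D f (X t) = D f (X q)" if t: "t \<in> N - M" for t
      using rel(3)[where s = t and t = q] qV t q N by blast
    ultimately show ?thesis using innerI cl[OF qV] by blast
  next
    \<comment> \<open>With \<open>N - M\<close> empty, the value on \<open>M - N\<close> alone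
      determines \<open>c\<close>, so every \<open>f\<close> is inner. This agrees with the default
      \<open>\<zero>\<close> in \<open>obstruction\<close>.\<close>
    case NM: True
    show ?thesis
    proof (cases "M - N = {}")
      case True
      then show ?thesis using innerI[of \<zero>] NM by auto
    next
      case False
      then obtain p where p: "p \<in> M - N" by blast
      then have pV: "p \<in> V" using M by blast
      have "D f (X t) = \<ominus> (\<ominus> D f (X p))" if t: "t \<in> M - N" for t
        using rel(2)[where s = t and t = p] pV p t M cl[OF pV] by auto
      then show ?thesis using innerI[of "\<ominus> D f (X p)"] NM cl[OF pV] by auto
    qed
  qed
qed

text \<open>The denominator of Ext becomes the kernel of one functional with values in the field,
  which bounds the dimension by 1.\<close>

lemma ext1_eq: "ext1 B S T = quotient H {f \<in> carrier H. obstruction f = \<zero>}"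
proof -
  have "{f \<in> carrier H. obstruction f = \<zero>} = {f \<in> carrier H. \<exists>c\<in>carrier K. inner_at c f}"
    using obstruction_zero_iff by auto
  then show ?thesis unfolding ext1_def by (simp add: inner_iff_restriction)
qed

text \<open>Applying the derivation to the coefficients gives a map that obeys the Leibniz rule on
  the free cover. On the syzygy \<open>val\<close> vanishes, the extra summand disappears, and the
  map is linear over \<open>B\<close>.\<close>

lemma derivation_hom:
  assumes d: "\<And>t. d t \<in> carrier K" and rel: "satisfies_relations K Q N M d"
  obtains f where "f \<in> carrier H" "\<And>t. t \<in> V \<Longrightarrow> D f (X t) = d t"
proof -
  let ?\<delta> = "algebra_deriv K N M d"
  note \<delta> = algebra_deriv_simps[where d = d, OF d rel]
  have additive: "additive ?\<delta>" by (simp add: additive_def \<delta>)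
  define f where "f = (\<lambda>u\<in>carrier \<Omega>. kT (coeff_sum ?\<delta> u))"
  have smult: "coeff_sum ?\<delta> (b \<odot>\<^bsub>P\<^esub> u) = \<psi> b \<otimes> coeff_sum ?\<delta> u \<oplus> ?\<delta> b \<otimes> val u"
    if "b \<in> carrier B" "u \<in> carrier P" for b u
    using that by (intro coeff_sum_smult additive additive_char) (auto simp: \<delta> algebra_char_simps)
  have hf: "hT (f u) = coeff_sum ?\<delta> u" "f u \<in> carrier T" if "u \<in> carrier \<Omega>" for u
    using that kT coeff_sum_closed[OF additive] \<Omega>_P by (auto simp: f_def)
  have f: "f \<in> carrier H"
    unfolding \<Omega>_hom
  proof (intro conjI ballI)
    show "f \<in> extensional (carrier \<Omega>)" by (simp add: f_def)
    fix u assume u: "u \<in> carrier \<Omega>"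
    show "f u \<in> carrier T" using u by (rule hf)
    show "f (u \<oplus>\<^bsub>P\<^esub> w) = f u \<oplus>\<^bsub>T\<^esub> f w" if w: "w \<in> carrier \<Omega>" for w
      using u w \<Omega>_add[OF u w]
      by (intro hT_eqI) (auto simp: hf hT_add coeff_sum_add[OF additive] \<Omega>_P)
    show "f (b \<odot>\<^bsub>P\<^esub> u) = b \<odot>\<^bsub>T\<^esub> f u" if b: "b \<in> carrier B" for b
    proof (rule hT_eqI)
      have "val u = \<zero>" "u \<in> carrier P" using u by (auto simp: \<Omega>_iff)
      then show "hT (f (b \<odot>\<^bsub>P\<^esub> u)) = hT (b \<odot>\<^bsub>T\<^esub> f u)"
        using u b \<Omega>_smult[OF b u]
        by (simp add: hf hT_smult smult \<delta> algebra_char_simps coeff_sum_closed[OF additive])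
      show "f (b \<odot>\<^bsub>P\<^esub> u) \<in> carrier T" "b \<odot>\<^bsub>T\<^esub> f u \<in> carrier T"
        using u b \<Omega>_smult[OF b u] by (auto simp: hf T.smult_closed)
    qed
  qed
  \<comment> \<open>The only nonzero coefficient of \<open>e\<close> is \<open>\<one>\<close>, which
    a derivation kills. So \<open>D f\<close> returns the prescribed values without a correction
    from \<open>e\<close>.\<close>
  have delta_e: "coeff_sum ?\<delta> e = \<zero>"
  proof -
    have one: "?\<delta> \<one>\<^bsub>B\<^esub> = \<zero>" using \<delta>(4)[of \<one>] by (simp add: iota_one)
    have v: "hS (inv_into (carrier S) hS \<one>) \<in> carrier K"
      using hS_bij by (auto simp: bij_betw_def f_inv_into_f)
    have "coeff_sum ?\<delta> e = (\<Oplus>s\<in>{inv_into (carrier S) hS \<one>}.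
        if s \<in> carrier S then ?\<delta> (e s) \<otimes> hS s else \<zero>)"
      by (rule coeff_sum_superset[OF additive e(1)]) (auto simp: e_def)
    then show ?thesis using v one by (simp add: e_def)
  qed
  have "D f (X t) = d t" if t: "t \<in> V" for t
  proof -
    have "D f (X t) = coeff_sum ?\<delta> (\<kappa> (X t) \<odot>\<^bsub>P\<^esub> e)" using t by (simp add: D_def hf)
    also have "\<dots> = ?\<delta> (\<kappa> (X t))" using t by (simp add: smult e delta_e \<delta> algebra_char_simps)
    also have "\<dots> = d t"
    proof -
      have cl: "\<iota> (\<chi> (X t)) \<in> carrier B" "\<chi> (X t) \<in> carrier K" using t by (simp_all add: algebra_char_simps)
      have "?\<delta> (\<kappa> (X t)) \<oplus> ?\<delta> (\<iota> (\<chi> (X t))) = ?\<delta> (\<kappa> (X t) \<oplus>\<^bsub>B\<^esub> \<iota> (\<chi> (X t)))"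
        using t cl by (simp add: \<delta>)
      also have "\<kappa> (X t) \<oplus>\<^bsub>B\<^esub> \<iota> (\<chi> (X t)) = X t"
        using t cl by (simp add: \<kappa>_def B.minus_eq B.a_assoc B.l_neg)
      finally show ?thesis using t cl by (simp add: \<delta>)
    qed
    finally show ?thesis .
  qed
  with f show ?thesis by (rule that)
qed

text \<open>A single missing arrow suffices to force \<open>\<zero>\<close>, since the obstruction
  can be evaluated at the pair in question. If all arrows are present, the indicator of
  \<open>M - N\<close> is an admissible derivation, with values \<open>\<one>\<close> and
  \<open>\<zero>\<close> on the two sets.\<close>

lemma obstruction_nonzero_iff:
  "(\<exists>f\<in>carrier H. obstruction f \<noteq> \<zero>) \<longleftrightarrow>
     M - N \<noteq> {} \<and> N - M \<noteq> {} \<and> (\<forall>m \<in> M - N. \<forall>n \<in> N - M. (m, n) \<in> arcs_ends Q)"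
proof
  assume "\<exists>f\<in>carrier H. obstruction f \<noteq> \<zero>"
  then obtain f where f: "f \<in> carrier H" "obstruction f \<noteq> \<zero>" by blast
  have "(m, n) \<in> arcs_ends Q" if mn: "m \<in> M - N" "n \<in> N - M" for m n
  proof (rule ccontr)
    assume "(m, n) \<notin> arcs_ends Q"
    then have "D f (X m) \<oplus> D f (X n) = \<zero>"
      using D_generator(4)[where s = m and t = n, OF f(1) _ _ mn] mn M N by blast
    then show False using obstruction_eq[OF f(1) mn] f(2) by simp
  qed
  moreover have "M - N \<noteq> {} \<and> N - M \<noteq> {}" using f(2) by (auto simp: obstruction_def split: if_splits)
  ultimately show "M - N \<noteq> {} \<and> N - M \<noteq> {} \<and> (\<forall>m \<in> M - N. \<forall>n \<in> N - M. (m, n) \<in> arcs_ends Q)"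
    by blast
next
  assume arcs: "M - N \<noteq> {} \<and> N - M \<noteq> {} \<and> (\<forall>m \<in> M - N. \<forall>n \<in> N - M. (m, n) \<in> arcs_ends Q)"
  then obtain p q where pq: "p \<in> M - N" "q \<in> N - M" by blast
  let ?d = "\<lambda>t. if t \<in> M - N then \<one> else \<zero>"
  have "satisfies_relations K Q N M ?d" using arcs by (intro satisfies_relations_indicator) blast
  then obtain f where f: "f \<in> carrier H" "\<And>t. t \<in> V \<Longrightarrow> D f (X t) = ?d t"
    by (rule derivation_hom[rotated]) auto
  have "obstruction f = \<one> \<oplus> \<zero>"
  proof -
    have "p \<in> V" "q \<in> V" using pq M N by auto
    then show ?thesis using obstruction_eq[OF f(1) pq] f(2)[of p] f(2)[of q] pq by simp
  qed
  then show "\<exists>f\<in>carrier H. obstruction f \<noteq> \<zero>" using f(1) K.one_not_zero by (intro bexI[of _ f]) auto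
qed

lemma vs_dim_ext1:
  "vs_dim K (ext1 B S T) =
    (if M - N \<noteq> {} \<and> N - M \<noteq> {} \<and> (\<forall>m \<in> M - N. \<forall>n \<in> N - M. (m, n) \<in> arcs_ends Q) then 1 else 0)"
proof -
  have "vs_dim K (ext1 B S T) = (if \<forall>f\<in>carrier H. obstruction f = \<zero> then 0 else 1)"
    unfolding ext1_eq
    by (rule vs_dim_quotient_kernel[OF K.field_axioms H_abelian_group])
      (auto simp: H_smult_closed obstruction_closed obstruction_linear)
  then show ?thesis using obstruction_nonzero_iff by auto
qed

end

section \<open>The Gabriel quiver\<close>

context quiver_algebra_over
begin

lemma vs_dim_ext1_iso:
  assumes S: "left_module B S" "left_module_iso B S (E_module K M)" "M \<subseteq> V"
    and T: "left_module B T" "left_module_iso B T (E_module K N)" "N \<subseteq> V"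
  shows "vs_dim K (ext1 B S T) =
    (if M - N \<noteq> {} \<and> N - M \<noteq> {} \<and> (\<forall>m \<in> M - N. \<forall>n \<in> N - M. (m, n) \<in> arcs_ends Q) then 1 else 0)"
proof -
  interpret S: left_module B S by fact
  interpret T: left_module B T by fact
  obtain hS where hS: "bij_betw hS (carrier S) (carrier K)"
    "\<And>x y. x \<in> carrier S \<Longrightarrow> y \<in> carrier S \<Longrightarrow> hS (x \<oplus>\<^bsub>S\<^esub> y) = hS x \<oplus> hS y"
    "\<And>b x. b \<in> carrier B \<Longrightarrow> x \<in> carrier S \<Longrightarrow> hS (b \<odot>\<^bsub>S\<^esub> x) = algebra_char K M b \<otimes> hS x"
    using S(2) by (rule E_module_isoE) blast
  obtain hT where hT: "bij_betw hT (carrier T) (carrier K)"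
    "\<And>x y. x \<in> carrier T \<Longrightarrow> y \<in> carrier T \<Longrightarrow> hT (x \<oplus>\<^bsub>T\<^esub> y) = hT x \<oplus> hT y"
    "\<And>b x. b \<in> carrier B \<Longrightarrow> x \<in> carrier T \<Longrightarrow> hT (b \<odot>\<^bsub>T\<^esub> x) = algebra_char K N b \<otimes> hT x"
    using T(2) by (rule E_module_isoE) blast
  interpret simple_pair K Q S T M N hS hT
    by unfold_locales (fact S(3) T(3) hS hT)+
  show ?thesis by (rule vs_dim_ext1)
qed

lemma simple_unique_E_module:
  assumes "acyclic_quiver Q" and S: "simple_left_module B S"
  shows "\<exists>!M. M \<subseteq> V \<and> left_module_iso B S (E_module K M)"
proof (rule ex_ex1I)
  show "\<exists>M. M \<subseteq> V \<and> left_module_iso B S (E_module K M)"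
    using simple_iso_E_module[OF S assms(1)] by blast
  fix M N assume MN: "M \<subseteq> V \<and> left_module_iso B S (E_module K M)"
    "N \<subseteq> V \<and> left_module_iso B S (E_module K N)"
  have "left_module_iso B (E_module K M) S"
    using S MN(1) left_module_iso_sym by (auto simp: simple_left_module_def)
  then have "left_module_iso B (E_module K M) (E_module K N)"
    using MN(2) left_module_iso_trans by blast
  then show "M = N" using MN E_module_iso_unique by blast
qed

lemma simple_representative:
  obtains S :: "(('v list \<Rightarrow> 'k) set, ('v list \<Rightarrow> 'k) set set) module"
  where "simple_left_module B S" "left_module_iso B S (E_module K M)"
proof -
  \<comment> \<open>Any injection of the field into the type of sets of algebra elements serves; the
    nested singletons have no meaning as cosets.\<close>
  have "inj_on (\<lambda>c. {{\<lambda>_ :: 'v list. c}}) (carrier (E_module K M))"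
    by (auto intro!: inj_onI dest: fun_cong)
  then obtain S :: "(('v list \<Rightarrow> 'k) set, ('v list \<Rightarrow> 'k) set set) module"
    where S: "left_module B S" "left_module_iso B (E_module K M) S"
    by (rule left_module_transport[OF E_module_left_module])
  then have "simple_left_module B S" by (intro simple_left_module_iso[OF E_module_simple])
  moreover have "left_module_iso B S (E_module K M)"
    using S(2) by (rule left_module_iso_sym[OF E_module_left_module])
  ultimately show ?thesis by (rule that)
qed

text \<open>A copy of \<open>E_module K M\<close> on the vertex type shows that the class is
  inhabited, so that \<open>SOME\<close> in \<open>gabriel_quiver\<close> picks a true
  representative.\<close>

lemma iso_class_E_module:
  "iso_class B (E_module K M) \<in> simple_classes B"
  "S \<in> iso_class B (E_module K M) \<longleftrightarrow> simple_left_module B S \<and> left_module_iso B S (E_module K M)"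
  "(SOME S. S \<in> iso_class B (E_module K M)) \<in> iso_class B (E_module K M)"
proof -
  obtain S :: "(('v list \<Rightarrow> 'k) set, ('v list \<Rightarrow> 'k) set set) module"
    where S: "simple_left_module B S" "left_module_iso B S (E_module K M)"
    by (rule simple_representative[where M = M])
  then have "iso_class B S = iso_class B (E_module K M)" by (simp add: iso_class_eq_iff)
  then show "iso_class B (E_module K M) \<in> simple_classes B"
    using S(1) unfolding simple_classes_def by blast
  have "S \<in> iso_class B (E_module K M)" using S by (simp add: iso_class_def)
  then show "(SOME S. S \<in> iso_class B (E_module K M)) \<in> iso_class B (E_module K M)" by (rule someI)
qed (simp add: iso_class_def)

lemma iso_class_E_module_inj:
  assumes "M \<subseteq> V" "N \<subseteq> V" "iso_class B (E_module K M) = iso_class B (E_module K N)"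
  shows "M = N"
proof -
  obtain S :: "(('v list \<Rightarrow> 'k) set, ('v list \<Rightarrow> 'k) set set) module"
    where S: "simple_left_module B S" "left_module_iso B S (E_module K M)"
    by (rule simple_representative[where M = M])
  then have "left_module_iso B S (E_module K N)" using assms(3) iso_class_E_module(2) by blast
  moreover have "left_module_iso B (E_module K M) S"
    using S left_module_iso_sym by (auto simp: simple_left_module_def)
  ultimately have "left_module_iso B (E_module K M) (E_module K N)"
    using left_module_iso_trans by blast
  then show ?thesis using assms E_module_iso_unique by blast
qed

lemma simple_classesE:
  assumes "acyclic_quiver Q" "C \<in> simple_classes B"
  obtains M where "M \<subseteq> V" "C = iso_class B (E_module K M)"
proof -
  obtain S :: "(('v list \<Rightarrow> 'k) set, ('v list \<Rightarrow> 'k) set set) module"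
    where S: "simple_left_module B S" "C = iso_class B S"
    using assms(2) unfolding simple_classes_def by blast
  obtain M where "M \<subseteq> V" "left_module_iso B S (E_module K M)"
    using simple_iso_E_module[OF S(1) assms(1)] by blast
  then show ?thesis using S that by (simp add: iso_class_eq_iff)
qed

text \<open>Parallel arrows are labelled by the numbers below the dimension of Ext; as this is 0 or
  1, the only possible label is 0.\<close>

lemma gabriel_arc_iff:
  assumes "M \<subseteq> V" "N \<subseteq> V"
  shows "(iso_class B (E_module K M), iso_class B (E_module K N), i) \<in> arcs (gabriel_quiver K B) \<longleftrightarrow>
    i = 0 \<and> M - N \<noteq> {} \<and> N - M \<noteq> {} \<and> (\<forall>m \<in> M - N. \<forall>n \<in> N - M. (m, n) \<in> arcs_ends Q)"
proof -
  let ?S = "SOME S. S \<in> iso_class B (E_module K M)" and ?T = "SOME S. S \<in> iso_class B (E_module K N)"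
  have "simple_left_module B ?S" "left_module_iso B ?S (E_module K M)"
    "simple_left_module B ?T" "left_module_iso B ?T (E_module K N)"
    using iso_class_E_module(2,3) by blast+
  then have dim: "vs_dim K (ext1 B ?S ?T) =
    (if M - N \<noteq> {} \<and> N - M \<noteq> {} \<and> (\<forall>m \<in> M - N. \<forall>n \<in> N - M. (m, n) \<in> arcs_ends Q) then 1 else 0)"
    using assms by (intro vs_dim_ext1_iso) (auto simp: simple_left_module_def)
  show ?thesis
    using iso_class_E_module(1)[of M] iso_class_E_module(1)[of N]
    by (auto simp: gabriel_quiver_def dim one_enat_def zero_enat_def)
qed

end

theorem theorem1p2:
  fixes K :: "('k, 'w) ring_scheme"
    and Q :: "('v, 'e) pre_digraph"
  assumes "field K"
    and "fin_digraph Q"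
    and "acyclic_quiver Q"
  shows "let B = quiver_algebra K Q; \<Gamma> = gabriel_quiver K B; E = E_module K in
    (\<forall>M \<subseteq> verts Q. simple_left_module B (E M)) \<and>
    (\<forall>S :: (('v list \<Rightarrow> 'k) set, 'm) module. simple_left_module B S \<longrightarrow>
       (\<exists>!M. M \<subseteq> verts Q \<and> left_module_iso B S (E M))) \<and>
    bij_betw (\<lambda>M. iso_class B (E M)) (Pow (verts Q)) (verts \<Gamma>) \<and>
    nomulti_digraph \<Gamma> \<and>
    (\<forall>M \<subseteq> verts Q. \<forall>N \<subseteq> verts Q.
       (iso_class B (E M), iso_class B (E N)) \<in> arcs_ends \<Gamma> \<longleftrightarrow>
       M - N \<noteq> {} \<and> N - M \<noteq> {} \<and>
       (\<forall>m \<in> M - N. \<forall>n \<in> N - M. (m, n) \<in> arcs_ends Q))"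
proof -
  interpret quiver_algebra_over K Q
    using assms(1,2) by (simp add: quiver_algebra_over_def)
  let ?\<Gamma> = "gabriel_quiver K B" and ?C = "\<lambda>M. iso_class B (E_module K M)"
  have \<Gamma>: "verts ?\<Gamma> = simple_classes B" "tail ?\<Gamma> = fst" "head ?\<Gamma> = (\<lambda>a. fst (snd a))"
    by (auto simp: gabriel_quiver_def)
  have arcs: "fst a \<in> simple_classes B \<and> fst (snd a) \<in> simple_classes B" if "a \<in> arcs ?\<Gamma>" for a
    using that by (auto simp: gabriel_quiver_def)
  \<comment> \<open>By the classification, which rests on acyclicity, every vertex is the class of
    some \<open>E_module\<close>, so the bound on the labels applies to all arcs.\<close>
  have arc_index: "i = 0" if "(C, D, i) \<in> arcs ?\<Gamma>" for C D i
  proof -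
    have "C \<in> simple_classes B" "D \<in> simple_classes B" using arcs[OF that] by simp_all
    then obtain M N where "M \<subseteq> V" "C = ?C M" "N \<subseteq> V" "D = ?C N"
      using simple_classesE[OF assms(3)] by metis
    then show ?thesis using that gabriel_arc_iff by blast
  qed
  have nomulti: "nomulti_digraph ?\<Gamma>"
  proof
    fix a assume "a \<in> arcs ?\<Gamma>"
    then show "tail ?\<Gamma> a \<in> verts ?\<Gamma>" "head ?\<Gamma> a \<in> verts ?\<Gamma>" using arcs by (auto simp: \<Gamma>)
  next
    fix a b assume "a \<in> arcs ?\<Gamma>" "b \<in> arcs ?\<Gamma>" "arc_to_ends ?\<Gamma> a = arc_to_ends ?\<Gamma> b"
    then show "a = b"
      by (cases a, cases b) (auto simp: arc_to_ends_def \<Gamma> dest!: arc_index)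
  qed
  have bij: "bij_betw ?C (Pow V) (verts ?\<Gamma>)"
    unfolding bij_betw_def \<Gamma>
  proof
    show "inj_on ?C (Pow V)" by (rule inj_onI) (auto dest: iso_class_E_module_inj)
    show "?C ` Pow V = simple_classes B"
      using iso_class_E_module(1) simple_classesE[OF assms(3)] by blast
  qed
  have ends: "(?C M, ?C N) \<in> arcs_ends ?\<Gamma> \<longleftrightarrow>
       M - N \<noteq> {} \<and> N - M \<noteq> {} \<and> (\<forall>m \<in> M - N. \<forall>n \<in> N - M. (m, n) \<in> arcs_ends Q)"
    if "M \<subseteq> V" "N \<subseteq> V" for M N
  proof -
    have "(?C M, ?C N) \<in> arcs_ends ?\<Gamma> \<longleftrightarrow> (\<exists>i. (?C M, ?C N, i) \<in> arcs ?\<Gamma>)"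
      by (force simp: arcs_ends_def arc_to_ends_def \<Gamma>)
    then show ?thesis using gabriel_arc_iff[OF that] by simp
  qed
  show ?thesis
    unfolding Let_def
  proof (intro conjI)
    show "\<forall>M \<subseteq> V. simple_left_module B (E_module K M)" by (simp add: E_module_simple)
    show "\<forall>S :: (('v list \<Rightarrow> 'k) set, 'm) module. simple_left_module B S \<longrightarrow>
        (\<exists>!M. M \<subseteq> V \<and> left_module_iso B S (E_module K M))"
      by (intro allI impI simple_unique_E_module[OF assms(3)])
    show "\<forall>M \<subseteq> V. \<forall>N \<subseteq> V. (?C M, ?C N) \<in> arcs_ends ?\<Gamma> \<longleftrightarrow>
        M - N \<noteq> {} \<and> N - M \<noteq> {} \<and> (\<forall>m \<in> M - N. \<forall>n \<in> N - M. (m, n) \<in> arcs_ends Q)"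
      by (intro allI impI ends)
  qed (fact bij nomulti)+
qed

end
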